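(* Let $\mathcal{C}$ be a finite multi-tensor category, let $I\in\mathcal{C}$ be an invertible object, let $A$ be an algebra in $\mathcal{C}$ equipped with an $I$-valued Frobenius trace $\lambda:A\to I$ with associated Nakayama isomorphism $\nu:A^{\vee\vee}\to I^{\vee}\otimes A\otimes I^{\vee\vee}$, and let $\mathcal{M}$ be a finite left $\mathcal{C}$-module category. Then the Nakayama functor of the category ${}_A\mathcal{M}$ of left $A$-modules in $\mathcal{M}$ is given (up to natural isomorphism) by the composition $${}_A\mathcal{M}\xrightarrow{\ I^{\vee}\triangleright(-)\ }{}_{A^{\vee\vee}}\mathcal{M}\xrightarrow{\ \widetilde{\mathbb{N}}\ }{}_A\mathcal{M},$$ where the first functor is $(M,a_M)\mapsto(I^{\vee}\triangleright M,\widetilde a_M)$ with $$\widetilde a_M=(\mathrm{id}_{I^{\vee}}\triangleright a_M)\circ(\mathrm{id}_{I^{\vee}}\triangleright\mathrm{id}_A\triangleright\mathrm{ev}_{I^{\vee}}\triangleright\mathrm{id}_M)\circ(\nu\triangleright\mathrm{id}_{I^{\vee}}\triangleright\mathrm{id}_M):A^{\vee\vee}\triangleright I^{\vee}\triangleright M\to I^{\vee}\triangleright M,$$ and the second functor sends $(M,a)$ to $\mathbb{N}_{\mathcal{M}}(M)$ with the $A$-action $A\triangleright\mathbb{N}_{\mathcal{M}}(M)\cong\mathbb{N}_{\mathcal{M}}(A^{\vee\vee}\triangleright M)\xrightarrow{\mathbb{N}_{\mathcal{M}}(a)}\mathbb{N}_{\mathcal{M}}(M)$.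
   Context: $\Bbbk$ is a field. A finite abelian category is a $\Bbbk$-linear category equivalent to the category of finite-dimensional left modules over a finite-dimensional $\Bbbk$-algebra. For an object $M$ of such a category $\mathcal{M}$, the copower $(-)\otimes M$ from finite-dimensional vector spaces to $\mathcal{M}$ is the left adjoint of $\mathrm{Hom}_{\mathcal{M}}(M,-)$. The Nakayama functor is the coend $\mathbb{N}_{\mathcal{M}}(M)=\int^{X\in\mathcal{M}}\mathrm{Hom}_{\mathcal{M}}(M,X)^*\otimes X$, with universal dinatural transformation $i_{M,X}$. Canonical isomorphism: write $G^{\mathrm{ra}}$, $G^{\mathrm{rra}}$ for the right and double right adjoint. If a linear functor $G:\mathcal{M}\to\mathcal{N}$ of finite abelian categories admits a triple right adjoint, $\phi_G(M):G^{\mathrm{rra}}\mathbb{N}_{\mathcal{M}}(M)\to\mathbb{N}_{\mathcal{N}}(G(M))$ is the natural isomorphism such that $\phi_G(M)\circ G^{\mathrm{rra}}(i_{M,X})=i_{G(M),G^{\mathrm{rra}}(X)}\circ(t^*\otimes\mathrm{id})$ for all $X\in\mathcal M$ (using that $G^{\mathrm{rra}}$ preserves copowers), where $t:\mathrm{Hom}_{\mathcal{N}}(G(M),G^{\mathrm{rra}}(X))\cong\mathrm{Hom}_{\mathcal{M}}(M,G^{\mathrm{ra}}G^{\mathrm{rra}}(X))\to\mathrm{Hom}_{\mathcal{M}}(M,X)$ is adjunction followed by the counit of $G^{\mathrm{ra}}\dashv G^{\mathrm{rra}}$. All monoidal and module categories are assumed strict. A finite multi-tensor category is a finite abelian category with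 a rigid monoidal structure $(\otimes,\mathbb{1})$ with bilinear tensor product. The left dual $X^{\vee}$ has $\mathrm{ev}_X:X^{\vee}\otimes X\to\mathbb{1}$, $\mathrm{coev}_X:\mathbb{1}\to X\otimes X^{\vee}$; ${}^{\vee}X$ is the right dual; $(-)^{\vee}$ and ${}^{\vee}(-)$ are assumed mutually inverse, strict, order-reversing monoidal. A finite left $\mathcal{C}$-module category is a finite abelian category $\mathcal{M}$ with a left $\mathcal{C}$-action $\triangleright$ linear and right exact in each variable. ${}_A\mathcal{M}$ is the category of modules over the monad $A\triangleright(-)$ on $\mathcal{M}$. The isomorphism $A\triangleright\mathbb{N}_{\mathcal{M}}(M)\cong\mathbb{N}_{\mathcal{M}}(A^{\vee\vee}\triangleright M)$ is $\phi_G(M)$ for $G=A^{\vee\vee}\triangleright(-)$, for which $G^{\mathrm{rra}}=A\triangleright(-)$. An $I$-valued Frobenius trace on an algebra $A$ with multiplication $m:A\otimes A\to A$ is a morphism $\lambda:A\to I$ such that $\varphi:=(\mathrm{ev}_I\otimes\mathrm{id}_{A^{\vee}})\circ(\mathrm{id}_{I^{\vee}}\otimes\lambda m\otimes\mathrm{id}_{A^{\vee}})\circ(\mathrm{id}_{I^{\vee}}\otimes\mathrm{id}_A\otimes\mathrm{coev}_A):I^{\vee}\otimes A\to A^{\vee}$ is invertible. The associated Nakayama isomorphism is $\nu:=(\varphi^{-1}\otimes\mathrm{id}_{I^{\vee\vee}})\circ\varphi^{\vee}:A^{\vee\vee}\to I^{\vee}\otimes A\otimes I^{\vee\vee}$,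 where $\varphi^{\vee}:A^{\vee\vee}\to(I^{\vee}\otimes A)^{\vee}=A^{\vee}\otimes I^{\vee\vee}$. *)

theory Defs
  imports Complex_Main "HOL-Library.Function_Algebras"
begin

section \<open>Finite-dimensional vector spaces\<close>

text \<open>
  Vector spaces over the field occur as subspaces of the pointwise function spaces
  \<^typ>\<open>'x \<Rightarrow> 'k\<close>.  For \<^typ>\<open>nat \<Rightarrow> 'k\<close> these contain a copy of every
  finite-dimensional vector space; for \<open>'x\<close> a type of arrows they contain the
  linear duals of the hom-spaces.
\<close>

definition fscale :: "'k::field \<Rightarrow> ('x \<Rightarrow> 'k) \<Rightarrow> 'x \<Rightarrow> 'k" where
  "fscale c v = (\<lambda>x. c * v x)"

interpretation fun_vs: vector_space "fscale :: 'k::field \<Rightarrow> ('x \<Rightarrow> 'k) \<Rightarrow> 'x \<Rightarrow> 'k"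
  by unfold_locales (auto simp: fscale_def fun_eq_iff algebra_simps)

definition fd_space :: "('x \<Rightarrow> 'k::field) set \<Rightarrow> bool" where
  "fd_space V \<longleftrightarrow> (\<exists>B. finite B \<and> V = fun_vs.span B)"

definition linear_on ::
  "('x \<Rightarrow> 'k::field) set \<Rightarrow> ('y \<Rightarrow> 'k) set \<Rightarrow> (('x \<Rightarrow> 'k) \<Rightarrow> ('y \<Rightarrow> 'k)) \<Rightarrow> bool" where
  "linear_on V W T \<longleftrightarrow>
     (\<forall>v\<in>V. T v \<in> W) \<and>
     (\<forall>v\<in>V. \<forall>w\<in>V. T (v + w) = T v + T w) \<and>
     (\<forall>c. \<forall>v\<in>V. T (fscale c v) = fscale c (T v))"


section \<open>Linear categories\<close>

record ('o, 'm, 'k) lincat =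
  obj :: "'o set"
  arr :: "'m set"
  src :: "'m \<Rightarrow> 'o"
  tgt :: "'m \<Rightarrow> 'o"
  ide :: "'o \<Rightarrow> 'm"
  cmp :: "'m \<Rightarrow> 'm \<Rightarrow> 'm" (infixr "\<cdot>\<index>" 65)
  add :: "'m \<Rightarrow> 'm \<Rightarrow> 'm" (infixl "\<oplus>\<index>" 60)
  zer :: "'o \<Rightarrow> 'o \<Rightarrow> 'm"
  scl :: "'k \<Rightarrow> 'm \<Rightarrow> 'm"

definition hom :: "('o, 'm, 'k, 'z) lincat_scheme \<Rightarrow> 'o \<Rightarrow> 'o \<Rightarrow> 'm set" where
  "hom C X Y = {f \<in> arr C. src C f = X \<and> tgt C f = Y}"

locale linear_category =
  fixes C :: "('o, 'm, 'k::field, 'z) lincat_scheme" (structure)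
  assumes src_obj: "f \<in> arr C \<Longrightarrow> src C f \<in> obj C"
    and tgt_obj: "f \<in> arr C \<Longrightarrow> tgt C f \<in> obj C"
    and ide_hom: "X \<in> obj C \<Longrightarrow> ide C X \<in> hom C X X"
    and cmp_hom: "f \<in> hom C X Y \<Longrightarrow> g \<in> hom C Y Z \<Longrightarrow> g \<cdot> f \<in> hom C X Z"
    and cmp_ide_left: "f \<in> hom C X Y \<Longrightarrow> ide C Y \<cdot> f = f"
    and cmp_ide_right: "f \<in> hom C X Y \<Longrightarrow> f \<cdot> ide C X = f"
    and cmp_assoc: "f \<in> hom C W X \<Longrightarrow> g \<in> hom C X Y \<Longrightarrow> h \<in> hom C Y Z \<Longrightarrow>
      (h \<cdot> g) \<cdot> f = h \<cdot> (g \<cdot> f)"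
    and add_hom: "f \<in> hom C X Y \<Longrightarrow> g \<in> hom C X Y \<Longrightarrow> f \<oplus> g \<in> hom C X Y"
    and zer_hom: "X \<in> obj C \<Longrightarrow> Y \<in> obj C \<Longrightarrow> zer C X Y \<in> hom C X Y"
    and scl_hom: "f \<in> hom C X Y \<Longrightarrow> scl C c f \<in> hom C X Y"
    and add_assoc: "f \<in> hom C X Y \<Longrightarrow> g \<in> hom C X Y \<Longrightarrow> h \<in> hom C X Y \<Longrightarrow>
      (f \<oplus> g) \<oplus> h = f \<oplus> (g \<oplus> h)"
    and add_comm: "f \<in> hom C X Y \<Longrightarrow> g \<in> hom C X Y \<Longrightarrow> f \<oplus> g = g \<oplus> f"
    and add_zer: "f \<in> hom C X Y \<Longrightarrow> f \<oplus> zer C X Y = f"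
    and add_inv: "f \<in> hom C X Y \<Longrightarrow> \<exists>g\<in>hom C X Y. f \<oplus> g = zer C X Y"
    and scl_one: "f \<in> hom C X Y \<Longrightarrow> scl C 1 f = f"
    and scl_scl: "f \<in> hom C X Y \<Longrightarrow> scl C c (scl C d f) = scl C (c * d) f"
    and scl_add_left: "f \<in> hom C X Y \<Longrightarrow> scl C (c + d) f = scl C c f \<oplus> scl C d f"
    and scl_add_right: "f \<in> hom C X Y \<Longrightarrow> g \<in> hom C X Y \<Longrightarrow>
      scl C c (f \<oplus> g) = scl C c f \<oplus> scl C c g"
    and cmp_add_left: "f \<in> hom C X Y \<Longrightarrow> g \<in> hom C Y Z \<Longrightarrow> h \<in> hom C Y Z \<Longrightarrow>
      (g \<oplus> h) \<cdot> f = (g \<cdot> f) \<oplus> (h \<cdot> f)"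
    and cmp_add_right: "f \<in> hom C X Y \<Longrightarrow> g \<in> hom C X Y \<Longrightarrow> h \<in> hom C Y Z \<Longrightarrow>
      h \<cdot> (f \<oplus> g) = (h \<cdot> f) \<oplus> (h \<cdot> g)"
    and cmp_scl_left: "f \<in> hom C X Y \<Longrightarrow> g \<in> hom C Y Z \<Longrightarrow>
      scl C c g \<cdot> f = scl C c (g \<cdot> f)"
    and cmp_scl_right: "f \<in> hom C X Y \<Longrightarrow> g \<in> hom C Y Z \<Longrightarrow>
      g \<cdot> scl C c f = scl C c (g \<cdot> f)"

definition inverse_arrows :: "('o, 'm, 'k, 'z) lincat_scheme \<Rightarrow> 'm \<Rightarrow> 'm \<Rightarrow> bool" where
  "inverse_arrows C f g \<longleftrightarrow>
     f \<in> arr C \<and> g \<in> hom C (tgt C f) (src C f) \<and>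
     g \<cdot>\<^bsub>C\<^esub> f = ide C (src C f) \<and> f \<cdot>\<^bsub>C\<^esub> g = ide C (tgt C f)"

definition is_iso :: "('o, 'm, 'k, 'z) lincat_scheme \<Rightarrow> 'm \<Rightarrow> bool" where
  "is_iso C f \<longleftrightarrow> (\<exists>g. inverse_arrows C f g)"

definition inv_arr :: "('o, 'm, 'k, 'z) lincat_scheme \<Rightarrow> 'm \<Rightarrow> 'm" where
  "inv_arr C f = (THE g. inverse_arrows C f g)"

definition isomorphic :: "('o, 'm, 'k, 'z) lincat_scheme \<Rightarrow> 'o \<Rightarrow> 'o \<Rightarrow> bool" where
  "isomorphic C X Y \<longleftrightarrow> (\<exists>f\<in>hom C X Y. is_iso C f)"

definition is_cokernel :: "('o, 'm, 'k, 'z) lincat_scheme \<Rightarrow> 'm \<Rightarrow> 'm \<Rightarrow> bool" where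
  "is_cokernel C f q \<longleftrightarrow>
     f \<in> arr C \<and> q \<in> arr C \<and> src C q = tgt C f \<and>
     q \<cdot>\<^bsub>C\<^esub> f = zer C (src C f) (tgt C q) \<and>
     (\<forall>Z\<in>obj C. \<forall>h\<in>hom C (tgt C f) Z. h \<cdot>\<^bsub>C\<^esub> f = zer C (src C f) Z \<longrightarrow>
        (\<exists>!u. u \<in> hom C (tgt C q) Z \<and> u \<cdot>\<^bsub>C\<^esub> q = h))"


section \<open>Functors and natural isomorphisms\<close>

record ('o, 'm, 'p, 'n) func =
  fobj :: "'o \<Rightarrow> 'p"
  farr :: "'m \<Rightarrow> 'n"

definition is_functor ::
  "('o, 'm, 'k, 'z) lincat_scheme \<Rightarrow> ('p, 'n, 'k, 'y) lincat_scheme \<Rightarrow> ('o, 'm, 'p, 'n) func \<Rightarrow> bool" where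
  "is_functor C D F \<longleftrightarrow>
     (\<forall>X\<in>obj C. fobj F X \<in> obj D) \<and>
     (\<forall>X Y. \<forall>f\<in>hom C X Y. farr F f \<in> hom D (fobj F X) (fobj F Y)) \<and>
     (\<forall>X\<in>obj C. farr F (ide C X) = ide D (fobj F X)) \<and>
     (\<forall>X Y Z. \<forall>f\<in>hom C X Y. \<forall>g\<in>hom C Y Z.
        farr F (g \<cdot>\<^bsub>C\<^esub> f) = farr F g \<cdot>\<^bsub>D\<^esub> farr F f)"

definition is_linear_functor ::
  "('o, 'm, 'k, 'z) lincat_scheme \<Rightarrow> ('p, 'n, 'k, 'y) lincat_scheme \<Rightarrow> ('o, 'm, 'p, 'n) func \<Rightarrow> bool" where
  "is_linear_functor C D F \<longleftrightarrow> is_functor C D F \<and>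
     (\<forall>X Y. \<forall>f\<in>hom C X Y. \<forall>g\<in>hom C X Y.
        farr F (f \<oplus>\<^bsub>C\<^esub> g) = farr F f \<oplus>\<^bsub>D\<^esub> farr F g) \<and>
     (\<forall>X Y c. \<forall>f\<in>hom C X Y. farr F (scl C c f) = scl D c (farr F f))"

text \<open>
  For a linear functor between abelian categories, preserving cokernels says that
  an exact sequence \<open>X \<rightarrow> Y \<rightarrow> Z \<rightarrow> 0\<close> is sent to an exact sequence.
\<close>

definition right_exact ::
  "('o, 'm, 'k, 'z) lincat_scheme \<Rightarrow> ('p, 'n, 'k, 'y) lincat_scheme \<Rightarrow> ('o, 'm, 'p, 'n) func \<Rightarrow> bool" where
  "right_exact C D F \<longleftrightarrow>
     (\<forall>f q. is_cokernel C f q \<longrightarrow> is_cokernel D (farr F f) (farr F q))"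

definition id_func :: "('o, 'm, 'o, 'm) func" where
  "id_func = \<lparr>fobj = (\<lambda>X. X), farr = (\<lambda>f. f)\<rparr>"

definition comp_func ::
  "('p, 'n, 'q, 'l) func \<Rightarrow> ('o, 'm, 'p, 'n) func \<Rightarrow> ('o, 'm, 'q, 'l) func" where
  "comp_func G F = \<lparr>fobj = (\<lambda>X. fobj G (fobj F X)), farr = (\<lambda>f. farr G (farr F f))\<rparr>"

definition nat_isomorphic ::
  "('o, 'm, 'k, 'z) lincat_scheme \<Rightarrow> ('p, 'n, 'k, 'y) lincat_scheme \<Rightarrow>
   ('o, 'm, 'p, 'n) func \<Rightarrow> ('o, 'm, 'p, 'n) func \<Rightarrow> bool" where
  "nat_isomorphic C D F G \<longleftrightarrow> is_functor C D F \<and> is_functor C D G \<and>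
     (\<exists>\<alpha>. (\<forall>X\<in>obj C. \<alpha> X \<in> hom D (fobj F X) (fobj G X) \<and> is_iso D (\<alpha> X)) \<and>
          (\<forall>X Y. \<forall>f\<in>hom C X Y. \<alpha> Y \<cdot>\<^bsub>D\<^esub> farr F f = farr G f \<cdot>\<^bsub>D\<^esub> \<alpha> X))"

definition linearly_equivalent ::
  "('o, 'm, 'k, 'z) lincat_scheme \<Rightarrow> ('p, 'n, 'k, 'y) lincat_scheme \<Rightarrow> bool" where
  "linearly_equivalent C D \<longleftrightarrow>
     (\<exists>F G. is_linear_functor C D F \<and> is_linear_functor D C G \<and>
        nat_isomorphic C C (comp_func G F) id_func \<and>
        nat_isomorphic D D (comp_func F G) id_func)"


section \<open>Finite abelian categories\<close>

record 'k fdalg =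
  alg_space :: "(nat \<Rightarrow> 'k) set"
  alg_mult :: "(nat \<Rightarrow> 'k) \<Rightarrow> (nat \<Rightarrow> 'k) \<Rightarrow> (nat \<Rightarrow> 'k)"
  alg_one :: "nat \<Rightarrow> 'k"

definition fd_algebra :: "('k::field) fdalg \<Rightarrow> bool" where
  "fd_algebra B \<longleftrightarrow> fd_space (alg_space B) \<and> alg_one B \<in> alg_space B \<and>
     (\<forall>a\<in>alg_space B. linear_on (alg_space B) (alg_space B) (\<lambda>b. alg_mult B a b)) \<and>
     (\<forall>b\<in>alg_space B. linear_on (alg_space B) (alg_space B) (\<lambda>a. alg_mult B a b)) \<and>
     (\<forall>a\<in>alg_space B. \<forall>b\<in>alg_space B. \<forall>c\<in>alg_space B.
        alg_mult B (alg_mult B a b) c = alg_mult B a (alg_mult B b c)) \<and>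
     (\<forall>a\<in>alg_space B. alg_mult B (alg_one B) a = a \<and> alg_mult B a (alg_one B) = a)"

type_synonym 'k fdmod =
  "(nat \<Rightarrow> 'k) set \<times> ((nat \<Rightarrow> 'k) \<Rightarrow> (nat \<Rightarrow> 'k) \<Rightarrow> (nat \<Rightarrow> 'k))"

definition fd_module :: "('k::field) fdalg \<Rightarrow> 'k fdmod \<Rightarrow> bool" where
  "fd_module B U \<longleftrightarrow> (case U of (V, \<rho>) \<Rightarrow> fd_space V \<and>
     (\<forall>b\<in>alg_space B. linear_on V V (\<rho> b)) \<and>
     (\<forall>v\<in>V. linear_on (alg_space B) V (\<lambda>b. \<rho> b v)) \<and>
     (\<forall>a\<in>alg_space B. \<forall>b\<in>alg_space B. \<forall>v\<in>V. \<rho> (alg_mult B a b) v = \<rho> a (\<rho> b v)) \<and>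
     (\<forall>v\<in>V. \<rho> (alg_one B) v = v))"

text \<open>
  An arrow carries its source and target.  The underlying map is required to vanish
  outside the source space, so that equality of arrows is equality of linear maps.
\<close>

definition fdmod_arrow ::
  "('k::field) fdalg \<Rightarrow> 'k fdmod \<times> ((nat \<Rightarrow> 'k) \<Rightarrow> (nat \<Rightarrow> 'k)) \<times> 'k fdmod \<Rightarrow> bool" where
  "fdmod_arrow B t \<longleftrightarrow> (case t of (U, T, U') \<Rightarrow> fd_module B U \<and> fd_module B U' \<and>
     linear_on (fst U) (fst U') T \<and> (\<forall>v. v \<notin> fst U \<longrightarrow> T v = 0) \<and>
     (\<forall>b\<in>alg_space B. \<forall>v\<in>fst U. T (snd U b v) = snd U' b (T v)))"

definition fdmod_cat :: "('k::field) fdalg \<Rightarrow>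
    ('k fdmod, 'k fdmod \<times> ((nat \<Rightarrow> 'k) \<Rightarrow> (nat \<Rightarrow> 'k)) \<times> 'k fdmod, 'k) lincat" where
  "fdmod_cat B =
     \<lparr>obj = Collect (fd_module B),
      arr = Collect (fdmod_arrow B),
      src = fst,
      tgt = (\<lambda>t. snd (snd t)),
      ide = (\<lambda>U. (U, (\<lambda>v. if v \<in> fst U then v else 0), U)),
      cmp = (\<lambda>t s. (fst s, (\<lambda>v. if v \<in> fst (fst s) then fst (snd t) (fst (snd s) v) else 0), snd (snd t))),
      add = (\<lambda>s t. (fst s, (\<lambda>v. fst (snd s) v + fst (snd t) v), snd (snd s))),
      zer = (\<lambda>U U'. (U, (\<lambda>v. 0), U')),
      scl = (\<lambda>c t. (fst t, (\<lambda>v. fscale c (fst (snd t) v)), snd (snd t)))\<rparr>"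

locale finite_abelian_category = linear_category +
  assumes equivalent_fdmod: "\<exists>B. fd_algebra B \<and> linearly_equivalent C (fdmod_cat B)"


section \<open>Copowers and the Nakayama functor\<close>

definition linear_into_hom ::
  "('o, 'm, 'k::field, 'z) lincat_scheme \<Rightarrow> ('x \<Rightarrow> 'k) set \<Rightarrow> 'o \<Rightarrow> 'o \<Rightarrow> (('x \<Rightarrow> 'k) \<Rightarrow> 'm) \<Rightarrow> bool" where
  "linear_into_hom C V X Y g \<longleftrightarrow>
     (\<forall>v\<in>V. g v \<in> hom C X Y) \<and>
     (\<forall>v\<in>V. \<forall>w\<in>V. g (v + w) = g v \<oplus>\<^bsub>C\<^esub> g w) \<and>
     (\<forall>c. \<forall>v\<in>V. g (fscale c v) = scl C c (g v))"

text \<open>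
  The left adjoint of \<open>Hom(X, -)\<close> at \<open>V\<close>, given by its universal arrow
  \<open>e : V \<rightarrow> Hom(X, P)\<close>.
\<close>

definition is_copower ::
  "('o, 'm, 'k::field, 'z) lincat_scheme \<Rightarrow> ('x \<Rightarrow> 'k) set \<Rightarrow> 'o \<Rightarrow> 'o \<Rightarrow> (('x \<Rightarrow> 'k) \<Rightarrow> 'm) \<Rightarrow> bool" where
  "is_copower C V X P e \<longleftrightarrow> P \<in> obj C \<and> linear_into_hom C V X P e \<and>
     (\<forall>Y\<in>obj C. \<forall>g. linear_into_hom C V X Y g \<longrightarrow>
        (\<exists>!h. h \<in> hom C P Y \<and> (\<forall>v\<in>V. h \<cdot>\<^bsub>C\<^esub> e v = g v)))"

definition copower_induced ::
  "('o, 'm, 'k, 'z) lincat_scheme \<Rightarrow> ('x \<Rightarrow> 'k) set \<Rightarrow> 'o \<Rightarrow> (('x \<Rightarrow> 'k) \<Rightarrow> 'm) \<Rightarrow>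
   'o \<Rightarrow> (('x \<Rightarrow> 'k) \<Rightarrow> 'm) \<Rightarrow> 'm" where
  "copower_induced C V P e Y g =
     (THE h. h \<in> hom C P Y \<and> (\<forall>v\<in>V. h \<cdot>\<^bsub>C\<^esub> e v = g v))"

record ('o, 'm, 'k) copow =
  cpobj :: "('m \<Rightarrow> 'k) set \<Rightarrow> 'o \<Rightarrow> 'o"
  cpunit :: "('m \<Rightarrow> 'k) set \<Rightarrow> 'o \<Rightarrow> ('m \<Rightarrow> 'k) \<Rightarrow> 'm"

definition has_copowers ::
  "('o, 'm, 'k::field, 'z) lincat_scheme \<Rightarrow> ('o, 'm, 'k) copow \<Rightarrow> bool" where
  "has_copowers C cp \<longleftrightarrow>
     (\<forall>V X. fd_space V \<longrightarrow> X \<in> obj C \<longrightarrow> is_copower C V X (cpobj cp V X) (cpunit cp V X))"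

text \<open>The arrow \<open>T \<otimes> g : V \<otimes> X \<rightarrow> W \<otimes> Y\<close> for a linear \<open>T : V \<rightarrow> W\<close> and \<open>g : X \<rightarrow> Y\<close>.\<close>

definition copower_map ::
  "('o, 'm, 'k, 'z) lincat_scheme \<Rightarrow> ('o, 'm, 'k) copow \<Rightarrow>
   ('m \<Rightarrow> 'k) set \<Rightarrow> 'o \<Rightarrow> ('m \<Rightarrow> 'k) set \<Rightarrow> 'o \<Rightarrow> (('m \<Rightarrow> 'k) \<Rightarrow> ('m \<Rightarrow> 'k)) \<Rightarrow> 'm \<Rightarrow> 'm" where
  "copower_map C cp V X W Y T g =
     copower_induced C V (cpobj cp V X) (cpunit cp V X) (cpobj cp W Y)
       (\<lambda>v. cpunit cp W Y (T v) \<cdot>\<^bsub>C\<^esub> g)"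

text \<open>
  The space \<open>Hom(X, Y)\<^sup>*\<close>; functionals are extended by \<open>0\<close> to all arrows.
\<close>

definition hom_dual ::
  "('o, 'm, 'k::field, 'z) lincat_scheme \<Rightarrow> 'o \<Rightarrow> 'o \<Rightarrow> ('m \<Rightarrow> 'k) set" where
  "hom_dual C X Y = {\<xi>. (\<forall>f. f \<notin> hom C X Y \<longrightarrow> \<xi> f = 0) \<and>
     (\<forall>f\<in>hom C X Y. \<forall>g\<in>hom C X Y. \<xi> (f \<oplus>\<^bsub>C\<^esub> g) = \<xi> f + \<xi> g) \<and>
     (\<forall>c. \<forall>f\<in>hom C X Y. \<xi> (scl C c f) = c * \<xi> f)}"

text \<open>The transpose of a linear map \<open>T\<close> defined on \<open>Hom(X, Y)\<close>.\<close>

definition hom_transpose ::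
  "('o, 'm, 'k::field, 'z) lincat_scheme \<Rightarrow> 'o \<Rightarrow> 'o \<Rightarrow> ('m \<Rightarrow> 'n) \<Rightarrow> ('n \<Rightarrow> 'k) \<Rightarrow> ('m \<Rightarrow> 'k)" where
  "hom_transpose C X Y T \<xi> = (\<lambda>f. if f \<in> hom C X Y then \<xi> (T f) else 0)"

text \<open>
  Dinatural transformations from \<open>(X', X) \<mapsto> Hom(M, X')\<^sup>* \<otimes> X\<close> to the constant \<open>Z\<close>:
  for \<open>g : X \<rightarrow> X'\<close> the two arrows \<open>Hom(M, X')\<^sup>* \<otimes> X \<rightarrow> Z\<close> agree.
\<close>

definition nak_dinatural ::
  "('o, 'm, 'k::field, 'z) lincat_scheme \<Rightarrow> ('o, 'm, 'k) copow \<Rightarrow> 'o \<Rightarrow> 'o \<Rightarrow> ('o \<Rightarrow> 'm) \<Rightarrow> bool" where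
  "nak_dinatural C cp M Z j \<longleftrightarrow>
     (\<forall>X\<in>obj C. j X \<in> hom C (cpobj cp (hom_dual C M X) X) Z) \<and>
     (\<forall>X X'. \<forall>g\<in>hom C X X'.
        j X \<cdot>\<^bsub>C\<^esub> copower_map C cp (hom_dual C M X') X (hom_dual C M X) X
                 (hom_transpose C M X (\<lambda>f. g \<cdot>\<^bsub>C\<^esub> f)) (ide C X) =
        j X' \<cdot>\<^bsub>C\<^esub> copower_map C cp (hom_dual C M X') X (hom_dual C M X') X' (\<lambda>\<xi>. \<xi>) g)"

text \<open>
  \<open>N\<close> is the functor \<open>M \<mapsto> \<integral>\<^sup>X Hom(M, X)\<^sup>* \<otimes> X\<close>, with universal dinatural
  transformation \<open>i M X : Hom(M, X)\<^sup>* \<otimes> X \<rightarrow> N M\<close>.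
\<close>

definition nakayama_coend ::
  "('o, 'm, 'k::field, 'z) lincat_scheme \<Rightarrow> ('o, 'm, 'k) copow \<Rightarrow>
   ('o, 'm, 'o, 'm) func \<Rightarrow> ('o \<Rightarrow> 'o \<Rightarrow> 'm) \<Rightarrow> bool" where
  "nakayama_coend C cp N i \<longleftrightarrow> has_copowers C cp \<and> is_functor C C N \<and>
     (\<forall>M\<in>obj C. nak_dinatural C cp M (fobj N M) (i M) \<and>
        (\<forall>Z\<in>obj C. \<forall>j. nak_dinatural C cp M Z j \<longrightarrow>
           (\<exists>!h. h \<in> hom C (fobj N M) Z \<and> (\<forall>X\<in>obj C. h \<cdot>\<^bsub>C\<^esub> i M X = j X)))) \<and>
     (\<forall>M M'. \<forall>f\<in>hom C M M'. \<forall>X\<in>obj C.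
        farr N f \<cdot>\<^bsub>C\<^esub> i M X =
        i M' X \<cdot>\<^bsub>C\<^esub> copower_map C cp (hom_dual C M X) X (hom_dual C M' X) X
                 (hom_transpose C M' X (\<lambda>g. g \<cdot>\<^bsub>C\<^esub> f)) (ide C X))"

definition is_nakayama_functor ::
  "('o, 'm, 'k::field, 'z) lincat_scheme \<Rightarrow> ('o, 'm, 'o, 'm) func \<Rightarrow> bool" where
  "is_nakayama_functor C N \<longleftrightarrow> (\<exists>cp i. nakayama_coend C cp N i)"

text \<open>
  The canonical arrow \<open>\<phi>\<^sub>G(M) : R' (N M) \<rightarrow> N' (G M)\<close> for \<open>G \<stileturn> R \<stileturn> R'\<close>, where \<open>un\<close> is the
  unit of \<open>G \<stileturn> R\<close> and \<open>co\<close> is the counit of \<open>R \<stileturn> R'\<close>.  Since \<open>R'\<close> preserves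
  copowers, \<open>R' (V \<otimes> X)\<close> is the copower \<open>V \<otimes> R' X\<close>, with universal arrow
  \<open>v \<mapsto> R' (e v)\<close>; the last line is \<open>t\<^sup>* \<otimes> id\<close> out of that copower.
\<close>

definition nak_t ::
  "('o, 'm, 'k, 'z) lincat_scheme \<Rightarrow> ('p, 'n, 'o, 'm) func \<Rightarrow> ('o \<Rightarrow> 'm) \<Rightarrow> ('o \<Rightarrow> 'm) \<Rightarrow>
   'o \<Rightarrow> 'o \<Rightarrow> 'n \<Rightarrow> 'm" where
  "nak_t C R un co M X f = co X \<cdot>\<^bsub>C\<^esub> farr R f \<cdot>\<^bsub>C\<^esub> un M"

definition nak_phi ::
  "('o, 'm, 'k::field, 'z) lincat_scheme \<Rightarrow> ('o, 'm, 'k) copow \<Rightarrow> ('o, 'm, 'o, 'm) func \<Rightarrow> ('o \<Rightarrow> 'o \<Rightarrow> 'm) \<Rightarrow>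
   ('p, 'n, 'k, 'y) lincat_scheme \<Rightarrow> ('p, 'n, 'k) copow \<Rightarrow> ('p, 'n, 'p, 'n) func \<Rightarrow> ('p \<Rightarrow> 'p \<Rightarrow> 'n) \<Rightarrow>
   ('o, 'm, 'p, 'n) func \<Rightarrow> ('p, 'n, 'o, 'm) func \<Rightarrow> ('o, 'm, 'p, 'n) func \<Rightarrow>
   ('o \<Rightarrow> 'm) \<Rightarrow> ('o \<Rightarrow> 'm) \<Rightarrow> 'o \<Rightarrow> 'n" where
  "nak_phi C cp N i D cp' N' i' G R R' un co M =
     (THE f. f \<in> hom D (fobj R' (fobj N M)) (fobj N' (fobj G M)) \<and>
        (\<forall>X\<in>obj C.
           f \<cdot>\<^bsub>D\<^esub> farr R' (i M X) =
           i' (fobj G M) (fobj R' X) \<cdot>\<^bsub>D\<^esub>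
             (let V = hom_dual C M X; W = hom_dual D (fobj G M) (fobj R' X) in
              copower_induced D V (fobj R' (cpobj cp V X)) (\<lambda>v. farr R' (cpunit cp V X v))
                (cpobj cp' W (fobj R' X))
                (\<lambda>v. cpunit cp' W (fobj R' X)
                   (hom_transpose D (fobj G M) (fobj R' X) (nak_t C R un co M X) v)))))"


section \<open>Finite multi-tensor categories\<close>

record ('o, 'm, 'k) moncat = "('o, 'm, 'k) lincat" +
  tobj :: "'o \<Rightarrow> 'o \<Rightarrow> 'o" (infixr "\<otimes>\<^sub>o\<index>" 70)
  tarr :: "'m \<Rightarrow> 'm \<Rightarrow> 'm" (infixr "\<otimes>\<index>" 70)
  one :: "'o"
  ldual :: "'o \<Rightarrow> 'o"
  ev :: "'o \<Rightarrow> 'm"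
  coev :: "'o \<Rightarrow> 'm"
  rdual :: "'o \<Rightarrow> 'o"
  evr :: "'o \<Rightarrow> 'm"
  coevr :: "'o \<Rightarrow> 'm"

definition ldual_arr :: "('o, 'm, 'k, 'z) moncat_scheme \<Rightarrow> 'm \<Rightarrow> 'm" where
  "ldual_arr C f =
     (let X = src C f; Y = tgt C f; iX = ide C (ldual C X); iY = ide C (ldual C Y) in
      (ev C Y \<otimes>\<^bsub>C\<^esub> iX) \<cdot>\<^bsub>C\<^esub> (iY \<otimes>\<^bsub>C\<^esub> f \<otimes>\<^bsub>C\<^esub> iX) \<cdot>\<^bsub>C\<^esub> (iY \<otimes>\<^bsub>C\<^esub> coev C X))"

definition rdual_arr :: "('o, 'm, 'k, 'z) moncat_scheme \<Rightarrow> 'm \<Rightarrow> 'm" where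
  "rdual_arr C f =
     (let X = src C f; Y = tgt C f; iX = ide C (rdual C X); iY = ide C (rdual C Y) in
      (iX \<otimes>\<^bsub>C\<^esub> evr C Y) \<cdot>\<^bsub>C\<^esub> (iX \<otimes>\<^bsub>C\<^esub> f \<otimes>\<^bsub>C\<^esub> iY) \<cdot>\<^bsub>C\<^esub> (coevr C X \<otimes>\<^bsub>C\<^esub> iY))"

locale strict_monoidal_linear_category = linear_category C
  for C :: "('o, 'm, 'k::field, 'z) moncat_scheme" (structure) +
  assumes tobj_obj: "X \<in> obj C \<Longrightarrow> Y \<in> obj C \<Longrightarrow> X \<otimes>\<^sub>o Y \<in> obj C"
    and one_obj: "one C \<in> obj C"
    and tarr_hom: "f \<in> hom C X X' \<Longrightarrow> g \<in> hom C Y Y' \<Longrightarrow>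
      f \<otimes> g \<in> hom C (X \<otimes>\<^sub>o Y) (X' \<otimes>\<^sub>o Y')"
    and tarr_ide: "X \<in> obj C \<Longrightarrow> Y \<in> obj C \<Longrightarrow> ide C X \<otimes> ide C Y = ide C (X \<otimes>\<^sub>o Y)"
    and tarr_cmp: "f \<in> hom C X X' \<Longrightarrow> f' \<in> hom C X' X'' \<Longrightarrow> g \<in> hom C Y Y' \<Longrightarrow> g' \<in> hom C Y' Y'' \<Longrightarrow>
      (f' \<cdot> f) \<otimes> (g' \<cdot> g) = (f' \<otimes> g') \<cdot> (f \<otimes> g)"
    and tobj_assoc: "X \<in> obj C \<Longrightarrow> Y \<in> obj C \<Longrightarrow> Z \<in> obj C \<Longrightarrow>
      (X \<otimes>\<^sub>o Y) \<otimes>\<^sub>o Z = X \<otimes>\<^sub>o (Y \<otimes>\<^sub>o Z)"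
    and tarr_assoc: "f \<in> arr C \<Longrightarrow> g \<in> arr C \<Longrightarrow> h \<in> arr C \<Longrightarrow> (f \<otimes> g) \<otimes> h = f \<otimes> (g \<otimes> h)"
    and tobj_one: "X \<in> obj C \<Longrightarrow> one C \<otimes>\<^sub>o X = X" "X \<in> obj C \<Longrightarrow> X \<otimes>\<^sub>o one C = X"
    and tarr_one: "f \<in> arr C \<Longrightarrow> ide C (one C) \<otimes> f = f" "f \<in> arr C \<Longrightarrow> f \<otimes> ide C (one C) = f"
    and tarr_add_left: "f \<in> hom C X X' \<Longrightarrow> f' \<in> hom C X X' \<Longrightarrow> g \<in> arr C \<Longrightarrow>
      (f \<oplus> f') \<otimes> g = (f \<otimes> g) \<oplus> (f' \<otimes> g)"
    and tarr_add_right: "f \<in> arr C \<Longrightarrow> g \<in> hom C Y Y' \<Longrightarrow> g' \<in> hom C Y Y' \<Longrightarrow>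
      f \<otimes> (g \<oplus> g') = (f \<otimes> g) \<oplus> (f \<otimes> g')"
    and tarr_scl_left: "f \<in> arr C \<Longrightarrow> g \<in> arr C \<Longrightarrow> scl C c f \<otimes> g = scl C c (f \<otimes> g)"
    and tarr_scl_right: "f \<in> arr C \<Longrightarrow> g \<in> arr C \<Longrightarrow> f \<otimes> scl C c g = scl C c (f \<otimes> g)"

text \<open>
  The left dual has \<open>ev X : ldual X \<otimes> X \<rightarrow> 1\<close> and \<open>coev X : 1 \<rightarrow> X \<otimes> ldual X\<close>, the right
  dual has \<open>evr X : X \<otimes> rdual X \<rightarrow> 1\<close> and \<open>coevr X : 1 \<rightarrow> rdual X \<otimes> X\<close>.  Strictness of the
  duality functors as order-reversing monoidal functors means that the canonical
  isomorphisms \<open>ldual (X \<otimes> Y) \<cong> ldual Y \<otimes> ldual X\<close> are identities; this is expressed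
  by equations for the evaluations and coevaluations.
\<close>

locale strict_rigid_linear_category = strict_monoidal_linear_category +
  assumes ldual_obj: "X \<in> obj C \<Longrightarrow> ldual C X \<in> obj C"
    and ev_hom: "X \<in> obj C \<Longrightarrow> ev C X \<in> hom C (ldual C X \<otimes>\<^sub>o X) (one C)"
    and coev_hom: "X \<in> obj C \<Longrightarrow> coev C X \<in> hom C (one C) (X \<otimes>\<^sub>o ldual C X)"
    and ldual_zigzag1: "X \<in> obj C \<Longrightarrow>
      (ide C X \<otimes> ev C X) \<cdot> (coev C X \<otimes> ide C X) = ide C X"
    and ldual_zigzag2: "X \<in> obj C \<Longrightarrow>
      (ev C X \<otimes> ide C (ldual C X)) \<cdot> (ide C (ldual C X) \<otimes> coev C X) = ide C (ldual C X)"
    and rdual_obj: "X \<in> obj C \<Longrightarrow> rdual C X \<in> obj C"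
    and evr_hom: "X \<in> obj C \<Longrightarrow> evr C X \<in> hom C (X \<otimes>\<^sub>o rdual C X) (one C)"
    and coevr_hom: "X \<in> obj C \<Longrightarrow> coevr C X \<in> hom C (one C) (rdual C X \<otimes>\<^sub>o X)"
    and rdual_zigzag1: "X \<in> obj C \<Longrightarrow>
      (evr C X \<otimes> ide C X) \<cdot> (ide C X \<otimes> coevr C X) = ide C X"
    and rdual_zigzag2: "X \<in> obj C \<Longrightarrow>
      (ide C (rdual C X) \<otimes> evr C X) \<cdot> (coevr C X \<otimes> ide C (rdual C X)) = ide C (rdual C X)"
    and ldual_tobj: "X \<in> obj C \<Longrightarrow> Y \<in> obj C \<Longrightarrow> ldual C (X \<otimes>\<^sub>o Y) = ldual C Y \<otimes>\<^sub>o ldual C X"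
    and ev_tobj: "X \<in> obj C \<Longrightarrow> Y \<in> obj C \<Longrightarrow>
      ev C (X \<otimes>\<^sub>o Y) = ev C Y \<cdot> (ide C (ldual C Y) \<otimes> ev C X \<otimes> ide C Y)"
    and coev_tobj: "X \<in> obj C \<Longrightarrow> Y \<in> obj C \<Longrightarrow>
      coev C (X \<otimes>\<^sub>o Y) = (ide C X \<otimes> coev C Y \<otimes> ide C (ldual C X)) \<cdot> coev C X"
    and ldual_one: "ldual C (one C) = one C"
    and ev_one: "ev C (one C) = ide C (one C)"
    and coev_one: "coev C (one C) = ide C (one C)"
    and rdual_tobj: "X \<in> obj C \<Longrightarrow> Y \<in> obj C \<Longrightarrow> rdual C (X \<otimes>\<^sub>o Y) = rdual C Y \<otimes>\<^sub>o rdual C X"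
    and evr_tobj: "X \<in> obj C \<Longrightarrow> Y \<in> obj C \<Longrightarrow>
      evr C (X \<otimes>\<^sub>o Y) = evr C X \<cdot> (ide C X \<otimes> evr C Y \<otimes> ide C (rdual C X))"
    and coevr_tobj: "X \<in> obj C \<Longrightarrow> Y \<in> obj C \<Longrightarrow>
      coevr C (X \<otimes>\<^sub>o Y) = (ide C (rdual C Y) \<otimes> coevr C X \<otimes> ide C Y) \<cdot> coevr C Y"
    and rdual_one: "rdual C (one C) = one C"
    and evr_one: "evr C (one C) = ide C (one C)"
    and coevr_one: "coevr C (one C) = ide C (one C)"
    and rdual_ldual: "X \<in> obj C \<Longrightarrow> rdual C (ldual C X) = X"
    and ldual_rdual: "X \<in> obj C \<Longrightarrow> ldual C (rdual C X) = X"
    and rdual_ldual_arr: "f \<in> arr C \<Longrightarrow> rdual_arr C (ldual_arr C f) = f"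
    and ldual_rdual_arr: "f \<in> arr C \<Longrightarrow> ldual_arr C (rdual_arr C f) = f"

locale finite_multitensor_category =
  strict_rigid_linear_category C + finite_abelian_category C
  for C :: "('o, 'm, 'k::field, 'z) moncat_scheme" (structure)

definition invertible_object :: "('o, 'm, 'k, 'z) moncat_scheme \<Rightarrow> 'o \<Rightarrow> bool" where
  "invertible_object C I \<longleftrightarrow> I \<in> obj C \<and>
     (\<exists>J\<in>obj C. isomorphic C (I \<otimes>\<^sub>o\<^bsub>C\<^esub> J) (one C) \<and> isomorphic C (J \<otimes>\<^sub>o\<^bsub>C\<^esub> I) (one C))"


section \<open>Algebras and Frobenius traces\<close>

record ('o, 'm) algebra_in =
  aobj :: "'o"
  amul :: "'m"
  aone :: "'m"

definition is_algebra :: "('o, 'm, 'k, 'z) moncat_scheme \<Rightarrow> ('o, 'm) algebra_in \<Rightarrow> bool" where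
  "is_algebra C A \<longleftrightarrow> aobj A \<in> obj C \<and>
     amul A \<in> hom C (aobj A \<otimes>\<^sub>o\<^bsub>C\<^esub> aobj A) (aobj A) \<and>
     aone A \<in> hom C (one C) (aobj A) \<and>
     amul A \<cdot>\<^bsub>C\<^esub> (amul A \<otimes>\<^bsub>C\<^esub> ide C (aobj A)) = amul A \<cdot>\<^bsub>C\<^esub> (ide C (aobj A) \<otimes>\<^bsub>C\<^esub> amul A) \<and>
     amul A \<cdot>\<^bsub>C\<^esub> (aone A \<otimes>\<^bsub>C\<^esub> ide C (aobj A)) = ide C (aobj A) \<and>
     amul A \<cdot>\<^bsub>C\<^esub> (ide C (aobj A) \<otimes>\<^bsub>C\<^esub> aone A) = ide C (aobj A)"

text \<open>
  The algebra \<open>A\<^sup>\<or>\<^sup>\<or>\<close>; by strictness of the duality \<open>(A \<otimes> A)\<^sup>\<or>\<^sup>\<or> = A\<^sup>\<or>\<^sup>\<or> \<otimes> A\<^sup>\<or>\<^sup>\<or>\<close>.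
\<close>

definition lldual_algebra ::
  "('o, 'm, 'k, 'z) moncat_scheme \<Rightarrow> ('o, 'm) algebra_in \<Rightarrow> ('o, 'm) algebra_in" where
  "lldual_algebra C A =
     \<lparr>aobj = ldual C (ldual C (aobj A)),
      amul = ldual_arr C (ldual_arr C (amul A)),
      aone = ldual_arr C (ldual_arr C (aone A))\<rparr>"

definition frobenius_map ::
  "('o, 'm, 'k, 'z) moncat_scheme \<Rightarrow> 'o \<Rightarrow> ('o, 'm) algebra_in \<Rightarrow> 'm \<Rightarrow> 'm" where
  "frobenius_map C I A l =
     (let iI = ide C (ldual C I); iA = ide C (aobj A); iA' = ide C (ldual C (aobj A)) in
      (ev C I \<otimes>\<^bsub>C\<^esub> iA') \<cdot>\<^bsub>C\<^esub>
      (iI \<otimes>\<^bsub>C\<^esub> (l \<cdot>\<^bsub>C\<^esub> amul A) \<otimes>\<^bsub>C\<^esub> iA') \<cdot>\<^bsub>C\<^esub>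
      (iI \<otimes>\<^bsub>C\<^esub> iA \<otimes>\<^bsub>C\<^esub> coev C (aobj A)))"

definition frobenius_trace ::
  "('o, 'm, 'k, 'z) moncat_scheme \<Rightarrow> 'o \<Rightarrow> ('o, 'm) algebra_in \<Rightarrow> 'm \<Rightarrow> bool" where
  "frobenius_trace C I A l \<longleftrightarrow> l \<in> hom C (aobj A) I \<and> is_iso C (frobenius_map C I A l)"

definition nakayama_iso ::
  "('o, 'm, 'k, 'z) moncat_scheme \<Rightarrow> 'o \<Rightarrow> ('o, 'm) algebra_in \<Rightarrow> 'm \<Rightarrow> 'm" where
  "nakayama_iso C I A l =
     (inv_arr C (frobenius_map C I A l) \<otimes>\<^bsub>C\<^esub> ide C (ldual C (ldual C I))) \<cdot>\<^bsub>C\<^esub>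
     ldual_arr C (frobenius_map C I A l)"


section \<open>Module categories\<close>

record ('c, 'd, 'o, 'm, 'k) modcat = "('o, 'm, 'k) lincat" +
  act_obj :: "'c \<Rightarrow> 'o \<Rightarrow> 'o" (infixr "\<triangleright>\<^sub>o\<index>" 70)
  act_arr :: "'d \<Rightarrow> 'm \<Rightarrow> 'm" (infixr "\<triangleright>\<index>" 70)

definition act_func ::
  "('c, 'd, 'k, 'z) moncat_scheme \<Rightarrow> ('c, 'd, 'o, 'm, 'k, 'y) modcat_scheme \<Rightarrow> 'c \<Rightarrow> ('o, 'm, 'o, 'm) func" where
  "act_func C \<M> X = \<lparr>fobj = (\<lambda>M. X \<triangleright>\<^sub>o\<^bsub>\<M>\<^esub> M), farr = (\<lambda>f. ide C X \<triangleright>\<^bsub>\<M>\<^esub> f)\<rparr>"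

definition act_on_func ::
  "('c, 'd, 'o, 'm, 'k, 'y) modcat_scheme \<Rightarrow> 'o \<Rightarrow> ('c, 'd, 'o, 'm) func" where
  "act_on_func \<M> M = \<lparr>fobj = (\<lambda>X. X \<triangleright>\<^sub>o\<^bsub>\<M>\<^esub> M), farr = (\<lambda>f. f \<triangleright>\<^bsub>\<M>\<^esub> ide \<M> M)\<rparr>"

locale finite_module_category =
  C: finite_multitensor_category C + M: finite_abelian_category \<M>
  for C :: "('c, 'd, 'k::field, 'z) moncat_scheme"
    and \<M> :: "('c, 'd, 'o, 'm, 'k, 'y) modcat_scheme" +
  assumes act_obj: "X \<in> obj C \<Longrightarrow> M \<in> obj \<M> \<Longrightarrow> X \<triangleright>\<^sub>o\<^bsub>\<M>\<^esub> M \<in> obj \<M>"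
    and act_hom: "f \<in> hom C X X' \<Longrightarrow> g \<in> hom \<M> M M' \<Longrightarrow>
      f \<triangleright>\<^bsub>\<M>\<^esub> g \<in> hom \<M> (X \<triangleright>\<^sub>o\<^bsub>\<M>\<^esub> M) (X' \<triangleright>\<^sub>o\<^bsub>\<M>\<^esub> M')"
    and act_ide: "X \<in> obj C \<Longrightarrow> M \<in> obj \<M> \<Longrightarrow>
      ide C X \<triangleright>\<^bsub>\<M>\<^esub> ide \<M> M = ide \<M> (X \<triangleright>\<^sub>o\<^bsub>\<M>\<^esub> M)"
    and act_cmp: "f \<in> hom C X X' \<Longrightarrow> f' \<in> hom C X' X'' \<Longrightarrow> g \<in> hom \<M> M M' \<Longrightarrow> g' \<in> hom \<M> M' M'' \<Longrightarrow>
      (f' \<cdot>\<^bsub>C\<^esub> f) \<triangleright>\<^bsub>\<M>\<^esub> (g' \<cdot>\<^bsub>\<M>\<^esub> g) = (f' \<triangleright>\<^bsub>\<M>\<^esub> g') \<cdot>\<^bsub>\<M>\<^esub> (f \<triangleright>\<^bsub>\<M>\<^esub> g)"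
    and act_obj_tobj: "X \<in> obj C \<Longrightarrow> Y \<in> obj C \<Longrightarrow> M \<in> obj \<M> \<Longrightarrow>
      (X \<otimes>\<^sub>o\<^bsub>C\<^esub> Y) \<triangleright>\<^sub>o\<^bsub>\<M>\<^esub> M = X \<triangleright>\<^sub>o\<^bsub>\<M>\<^esub> (Y \<triangleright>\<^sub>o\<^bsub>\<M>\<^esub> M)"
    and act_arr_tarr: "f \<in> arr C \<Longrightarrow> f' \<in> arr C \<Longrightarrow> g \<in> arr \<M> \<Longrightarrow>
      (f \<otimes>\<^bsub>C\<^esub> f') \<triangleright>\<^bsub>\<M>\<^esub> g = f \<triangleright>\<^bsub>\<M>\<^esub> (f' \<triangleright>\<^bsub>\<M>\<^esub> g)"
    and act_obj_one: "M \<in> obj \<M> \<Longrightarrow> one C \<triangleright>\<^sub>o\<^bsub>\<M>\<^esub> M = M"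
    and act_arr_one: "g \<in> arr \<M> \<Longrightarrow> ide C (one C) \<triangleright>\<^bsub>\<M>\<^esub> g = g"
    and act_add_left: "f \<in> hom C X X' \<Longrightarrow> f' \<in> hom C X X' \<Longrightarrow> g \<in> arr \<M> \<Longrightarrow>
      (f \<oplus>\<^bsub>C\<^esub> f') \<triangleright>\<^bsub>\<M>\<^esub> g = (f \<triangleright>\<^bsub>\<M>\<^esub> g) \<oplus>\<^bsub>\<M>\<^esub> (f' \<triangleright>\<^bsub>\<M>\<^esub> g)"
    and act_add_right: "f \<in> arr C \<Longrightarrow> g \<in> hom \<M> M M' \<Longrightarrow> g' \<in> hom \<M> M M' \<Longrightarrow>
      f \<triangleright>\<^bsub>\<M>\<^esub> (g \<oplus>\<^bsub>\<M>\<^esub> g') = (f \<triangleright>\<^bsub>\<M>\<^esub> g) \<oplus>\<^bsub>\<M>\<^esub> (f \<triangleright>\<^bsub>\<M>\<^esub> g')"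
    and act_scl_left: "f \<in> arr C \<Longrightarrow> g \<in> arr \<M> \<Longrightarrow> scl C c f \<triangleright>\<^bsub>\<M>\<^esub> g = scl \<M> c (f \<triangleright>\<^bsub>\<M>\<^esub> g)"
    and act_scl_right: "f \<in> arr C \<Longrightarrow> g \<in> arr \<M> \<Longrightarrow> f \<triangleright>\<^bsub>\<M>\<^esub> scl \<M> c g = scl \<M> c (f \<triangleright>\<^bsub>\<M>\<^esub> g)"
    and act_right_exact: "X \<in> obj C \<Longrightarrow> right_exact \<M> \<M> (act_func C \<M> X)"
    and act_on_right_exact: "M \<in> obj \<M> \<Longrightarrow> right_exact C \<M> (act_on_func \<M> M)"


section \<open>Modules over a monad\<close>

definition monad_module ::
  "('o, 'm, 'k, 'z) lincat_scheme \<Rightarrow> ('o, 'm, 'o, 'm) func \<Rightarrow> ('o \<Rightarrow> 'm) \<Rightarrow> ('o \<Rightarrow> 'm) \<Rightarrow> 'o \<times> 'm \<Rightarrow> bool" where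
  "monad_module C T mu eta p \<longleftrightarrow> (case p of (M, a) \<Rightarrow> M \<in> obj C \<and> a \<in> hom C (fobj T M) M \<and>
     a \<cdot>\<^bsub>C\<^esub> farr T a = a \<cdot>\<^bsub>C\<^esub> mu M \<and> a \<cdot>\<^bsub>C\<^esub> eta M = ide C M)"

definition monad_module_arrow ::
  "('o, 'm, 'k, 'z) lincat_scheme \<Rightarrow> ('o, 'm, 'o, 'm) func \<Rightarrow> ('o \<Rightarrow> 'm) \<Rightarrow> ('o \<Rightarrow> 'm) \<Rightarrow>
   ('o \<times> 'm) \<times> 'm \<times> ('o \<times> 'm) \<Rightarrow> bool" where
  "monad_module_arrow C T mu eta t \<longleftrightarrow> (case t of (p, f, q) \<Rightarrow>
     monad_module C T mu eta p \<and> monad_module C T mu eta q \<and> f \<in> hom C (fst p) (fst q) \<and>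
     f \<cdot>\<^bsub>C\<^esub> snd p = snd q \<cdot>\<^bsub>C\<^esub> farr T f)"

definition monad_module_cat ::
  "('o, 'm, 'k, 'z) lincat_scheme \<Rightarrow> ('o, 'm, 'o, 'm) func \<Rightarrow> ('o \<Rightarrow> 'm) \<Rightarrow> ('o \<Rightarrow> 'm) \<Rightarrow>
   ('o \<times> 'm, ('o \<times> 'm) \<times> 'm \<times> ('o \<times> 'm), 'k) lincat" where
  "monad_module_cat C T mu eta =
     \<lparr>obj = Collect (monad_module C T mu eta),
      arr = Collect (monad_module_arrow C T mu eta),
      src = fst,
      tgt = (\<lambda>t. snd (snd t)),
      ide = (\<lambda>p. (p, ide C (fst p), p)),
      cmp = (\<lambda>t s. (fst s, fst (snd t) \<cdot>\<^bsub>C\<^esub> fst (snd s), snd (snd t))),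
      add = (\<lambda>s t. (fst s, fst (snd s) \<oplus>\<^bsub>C\<^esub> fst (snd t), snd (snd s))),
      zer = (\<lambda>p q. (p, zer C (fst p) (fst q), q)),
      scl = (\<lambda>c t. (fst t, scl C c (fst (snd t)), snd (snd t)))\<rparr>"

definition alg_module_cat ::
  "('c, 'd, 'k, 'z) moncat_scheme \<Rightarrow> ('c, 'd, 'o, 'm, 'k, 'y) modcat_scheme \<Rightarrow> ('c, 'd) algebra_in \<Rightarrow>
   ('o \<times> 'm, ('o \<times> 'm) \<times> 'm \<times> ('o \<times> 'm), 'k) lincat" where
  "alg_module_cat C \<M> A = monad_module_cat \<M> (act_func C \<M> (aobj A))
     (\<lambda>M. amul A \<triangleright>\<^bsub>\<M>\<^esub> ide \<M> M) (\<lambda>M. aone A \<triangleright>\<^bsub>\<M>\<^esub> ide \<M> M)"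


section \<open>The two functors\<close>

definition twisted_action ::
  "('c, 'd, 'k, 'z) moncat_scheme \<Rightarrow> ('c, 'd, 'o, 'm, 'k, 'y) modcat_scheme \<Rightarrow>
   'c \<Rightarrow> ('c, 'd) algebra_in \<Rightarrow> 'd \<Rightarrow> 'o \<times> 'm \<Rightarrow> 'm" where
  "twisted_action C \<M> I A l p =
     (let iI = ide C (ldual C I); iA = ide C (aobj A); iM = ide \<M> (fst p) in
      (iI \<triangleright>\<^bsub>\<M>\<^esub> snd p) \<cdot>\<^bsub>\<M>\<^esub>
      (iI \<triangleright>\<^bsub>\<M>\<^esub> iA \<triangleright>\<^bsub>\<M>\<^esub> ev C (ldual C I) \<triangleright>\<^bsub>\<M>\<^esub> iM) \<cdot>\<^bsub>\<M>\<^esub>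
      (nakayama_iso C I A l \<triangleright>\<^bsub>\<M>\<^esub> iI \<triangleright>\<^bsub>\<M>\<^esub> iM))"

definition twist_func ::
  "('c, 'd, 'k, 'z) moncat_scheme \<Rightarrow> ('c, 'd, 'o, 'm, 'k, 'y) modcat_scheme \<Rightarrow>
   'c \<Rightarrow> ('c, 'd) algebra_in \<Rightarrow> 'd \<Rightarrow>
   ('o \<times> 'm, ('o \<times> 'm) \<times> 'm \<times> ('o \<times> 'm), 'o \<times> 'm, ('o \<times> 'm) \<times> 'm \<times> ('o \<times> 'm)) func" where
  "twist_func C \<M> I A l =
     (let F = (\<lambda>p. (ldual C I \<triangleright>\<^sub>o\<^bsub>\<M>\<^esub> fst p, twisted_action C \<M> I A l p)) in
      \<lparr>fobj = F,
       farr = (\<lambda>(p, f, q). (F p, ide C (ldual C I) \<triangleright>\<^bsub>\<M>\<^esub> f, F q))\<rparr>)"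

text \<open>
  The isomorphism \<open>X \<triangleright> N M \<rightarrow> N (X\<^sup>\<or>\<^sup>\<or> \<triangleright> M)\<close>: the canonical arrow for the adjunctions
  \<open>X\<^sup>\<or>\<^sup>\<or> \<triangleright> - \<stileturn> X\<^sup>\<or> \<triangleright> - \<stileturn> X \<triangleright> -\<close>, the first with unit \<open>coev\<close> of \<open>X\<^sup>\<or>\<close>, the second
  with counit \<open>ev\<close> of \<open>X\<close>.
\<close>

definition nak_act_iso ::
  "('c, 'd, 'k::field, 'z) moncat_scheme \<Rightarrow> ('c, 'd, 'o, 'm, 'k, 'y) modcat_scheme \<Rightarrow>
   ('o, 'm, 'k) copow \<Rightarrow> ('o, 'm, 'o, 'm) func \<Rightarrow> ('o \<Rightarrow> 'o \<Rightarrow> 'm) \<Rightarrow> 'c \<Rightarrow> 'o \<Rightarrow> 'm" where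
  "nak_act_iso C \<M> cp N i X M =
     nak_phi \<M> cp N i \<M> cp N i
       (act_func C \<M> (ldual C (ldual C X))) (act_func C \<M> (ldual C X)) (act_func C \<M> X)
       (\<lambda>M. coev C (ldual C X) \<triangleright>\<^bsub>\<M>\<^esub> ide \<M> M)
       (\<lambda>M. ev C X \<triangleright>\<^bsub>\<M>\<^esub> ide \<M> M) M"

definition nak_lift_func ::
  "('c, 'd, 'k::field, 'z) moncat_scheme \<Rightarrow> ('c, 'd, 'o, 'm, 'k, 'y) modcat_scheme \<Rightarrow>
   ('o, 'm, 'k) copow \<Rightarrow> ('o, 'm, 'o, 'm) func \<Rightarrow> ('o \<Rightarrow> 'o \<Rightarrow> 'm) \<Rightarrow> ('c, 'd) algebra_in \<Rightarrow>
   ('o \<times> 'm, ('o \<times> 'm) \<times> 'm \<times> ('o \<times> 'm), 'o \<times> 'm, ('o \<times> 'm) \<times> 'm \<times> ('o \<times> 'm)) func" where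
  "nak_lift_func C \<M> cp N i A =
     (let F = (\<lambda>p. (fobj N (fst p), farr N (snd p) \<cdot>\<^bsub>\<M>\<^esub> nak_act_iso C \<M> cp N i (aobj A) (fst p))) in
      \<lparr>fobj = F,
       farr = (\<lambda>(p, f, q). (F p, farr N f, F q))\<rparr>)"

end

theory Submission
  imports Defs
begin

text \<open>
  Write \<open>F = A \<triangleright> -\<close> for the free module functor and \<open>U\<close> for the functor forgetting the action, so
  that \<open>F \<stileturn> U\<close>.  That the Frobenius map \<open>\<phi> : I\<^sup>\<or> \<otimes> A \<rightarrow> A\<^sup>\<or>\<close> is invertible says that
  \<open>I\<^sup>\<or> \<otimes> A\<close> is a left dual of \<open>A\<close>, with the pairing \<open>\<kappa>\<close> that sends \<open>I\<^sup>\<or> \<otimes> A \<otimes> A\<close> to \<open>1\<close>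
  through multiplication and trace.  The copairing \<open>\<delta> : 1 \<rightarrow> A \<otimes> I\<^sup>\<or> \<otimes> A\<close> satisfies the Casimir
  identity (\<open>casimir\<close>), and this makes \<open>G = I\<^sup>\<or> \<triangleright> U\<close> left adjoint to \<open>F\<close>: there is a chain of
  adjunctions \<open>G \<stileturn> F \<stileturn> U\<close>.

  A coend \<open>\<integral>\<^sup>Y Hom(M, Y)\<^sup>* \<otimes> Y\<close> is the same as a universal natural family of linear maps
  \<open>Hom(M, Y)\<^sup>* \<rightarrow> Hom(Y, N M)\<close> (\<open>dual_coend\<close>).  For a module \<open>p\<close> and an object \<open>Z\<close> of \<open>\<M>\<close>, the chain of
  adjunctions identifies natural families \<open>Hom(G p, Y)\<^sup>* = Hom(p, F Y)\<^sup>* \<rightarrow> Hom(Y, Z)\<close>, indexed by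
  objects \<open>Y\<close>, with natural families \<open>Hom(p, q)\<^sup>* \<rightarrow> Hom(U q, Z)\<close>, indexed by modules \<open>q\<close>.  Hence
  \<open>N (G p)\<close> carries a universal family \<open>mod_coend\<close> of the second kind.

  It remains to see the action.  The action of \<open>A\<close> on \<open>N (G p)\<close> in the theorem is built from the
  action of \<open>A\<^sup>\<or>\<^sup>\<or>\<close> on \<open>G p\<close> defined by the Nakayama isomorphism.  In terms of the corresponding coaction of
  \<open>A\<^sup>\<or>\<close>, the Nakayama isomorphism disappears, and the coaction becomes \<open>\<phi>\<close> after the unit of
  \<open>G \<stileturn> F\<close> (\<open>twisted_action_eq\<close>).  With this formula and the Casimir identity the members of the
  universal family are linear (\<open>frobenius_balance\<close>, \<open>mod_coend_hom\<close>).  As \<open>A \<triangleright> -\<close> has a right adjoint,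
  it preserves universal families, so linearity of an arrow out of \<open>N (G p)\<close> can be tested on
  the family, and the family is universal among modules too (\<open>mod_coend_universal\<close>).  Since modules have copowers
  (\<open>Mod_has_copowers\<close>), the family is a Nakayama coend, and coends are unique up to
  natural isomorphism.
\<close>

section \<open>Finite-dimensional function spaces and hom-finiteness\<close>

lemma fscale_apply: "fscale c v x = c * v x"
  by (simp add: fscale_def)

text \<open>
  A finite-dimensional space of functions is determined by its values at finitely many points,
  because one more spanning vector costs at most one more point.
\<close>

lemma span_separated:
  fixes B :: "('x \<Rightarrow> 'k::field) set"
  assumes "finite B"
  shows "\<exists>S. finite S \<and> (\<forall>v\<in>fun_vs.span B. (\<forall>x\<in>S. v x = 0) \<longrightarrow> v = 0)"
  using assms
proof (induction B rule: finite_induct)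
  case empty
  then show ?case by (auto intro: exI[of _ "{}"])
next
  case (insert b B)
  then obtain S where S: "finite S" "\<And>v. v \<in> fun_vs.span B \<Longrightarrow> (\<forall>x\<in>S. v x = 0) \<Longrightarrow> v = 0"
    by blast
  show ?case
  proof (cases "\<exists>v\<in>fun_vs.span (insert b B). (\<forall>x\<in>S. v x = 0) \<and> v \<noteq> 0")
    case False
    then show ?thesis using S(1) by blast
  next
    case True
    then obtain v0 where v0: "v0 \<in> fun_vs.span (insert b B)" "\<forall>x\<in>S. v0 x = 0" "v0 \<noteq> 0" by auto
    then obtain x where x: "v0 x \<noteq> 0" by (auto simp: fun_eq_iff)
    obtain c where c: "v0 - fscale c b \<in> fun_vs.span B"
      using v0(1) unfolding fun_vs.span_insert by blast
    have c0: "c \<noteq> 0"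
    proof
      assume "c = 0"
      then have "v0 \<in> fun_vs.span B" using c by (simp add: fun_vs.scale_zero_left)
      then show False using S(2) v0 by blast
    qed
    have "v = 0" if v: "v \<in> fun_vs.span (insert b B)" "\<forall>y\<in>insert x S. v y = 0" for v
    proof -
      obtain d where d: "v - fscale d b \<in> fun_vs.span B"
        using v(1) unfolding fun_vs.span_insert by blast
      let ?w = "fscale c v - fscale d v0"
      have "fscale c (v - fscale d b) - fscale d (v0 - fscale c b) = ?w"
        by (auto simp: fun_eq_iff fscale_apply algebra_simps)
      then have "?w \<in> fun_vs.span B"
        using c d by (metis fun_vs.span_diff fun_vs.span_scale)
      moreover have "\<forall>y\<in>S. ?w y = 0" using v(2) v0(2) by (simp add: fscale_apply)
      ultimately have w: "?w = 0" using S(2) by blast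
      then have "?w x = 0" unfolding w by simp
      then have "d = 0" using v(2) x by (simp add: fscale_apply)
      then have "fscale c v y = 0" for y using fun_cong[OF w, of y] by (simp add: fscale_apply)
      then have "\<And>y. c * v y = 0" by (simp add: fscale_apply)
      then show "v = 0" using c0 by (auto simp: fun_eq_iff)
    qed
    then show ?thesis using S(1) finite_insert by blast
  qed
qed

text \<open>
  Conversely, the functions in a space that vanish at one more point form a subspace of
  codimension at most one.
\<close>

lemma separated_imp_fd_space:
  fixes V :: "('x \<Rightarrow> 'k::field) set"
  assumes "finite S" and "fun_vs.subspace V" and "\<And>v. v \<in> V \<Longrightarrow> (\<forall>x\<in>S. v x = 0) \<Longrightarrow> v = 0"
  shows "fd_space V"
  using assms
proof (induction S arbitrary: V rule: finite_induct)
  case empty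
  then have "V = {0}" using fun_vs.subspace_0[OF empty.prems(1)] by blast
  then have "V = fun_vs.span {}" by simp
  then show ?case unfolding fd_space_def by blast
next
  case (insert x S)
  let ?V0 = "{v \<in> V. v x = 0}"
  have sub0: "fun_vs.subspace ?V0"
    using insert.prems(1) unfolding fun_vs.subspace_def by (auto simp: fscale_apply)
  have "fd_space ?V0" by (rule insert.IH[OF sub0]) (use insert.prems(2) in auto)
  then obtain B where B: "finite B" "?V0 = fun_vs.span B" by (auto simp: fd_space_def)
  show ?case
  proof (cases "?V0 = V")
    case True
    then show ?thesis using B by (auto simp: fd_space_def)
  next
    case False
    then obtain v1 where v1: "v1 \<in> V" "v1 x \<noteq> 0" by auto
    have "V = fun_vs.span (insert v1 B)"
    proof
      show "fun_vs.span (insert v1 B) \<subseteq> V"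
        using v1 B fun_vs.span_superset by (intro fun_vs.span_minimal insert.prems(1)) blast
      show "V \<subseteq> fun_vs.span (insert v1 B)"
      proof
        fix v assume v: "v \<in> V"
        have "v - fscale (v x / v1 x) v1 \<in> ?V0"
          using v v1 fun_vs.subspace_diff[OF insert.prems(1)] fun_vs.subspace_scale[OF insert.prems(1)]
          by (simp add: fscale_apply)
        then show "v \<in> fun_vs.span (insert v1 B)"
          unfolding fun_vs.span_insert B(2) by auto
      qed
    qed
    then show ?thesis using B(1) unfolding fd_space_def by blast
  qed
qed

lemma fd_space_subspace: "fd_space V \<Longrightarrow> fun_vs.subspace V"
  by (auto simp: fd_space_def)

context linear_category
begin

lemma hom_objs: "f \<in> hom C X Y \<Longrightarrow> X \<in> obj C" "f \<in> hom C X Y \<Longrightarrow> Y \<in> obj C"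
  using src_obj tgt_obj by (auto simp: hom_def)

lemma add_left_cancel:
  assumes "f \<in> hom C X Y" "g \<in> hom C X Y" "h \<in> hom C X Y" "f \<oplus> g = f \<oplus> h"
  shows "g = h"
proof -
  obtain e where e: "e \<in> hom C X Y" "f \<oplus> e = zer C X Y" using add_inv assms(1) by blast
  have *: "e \<oplus> (f \<oplus> k) = k" if k: "k \<in> hom C X Y" for k
  proof -
    have z: "zer C X Y \<in> hom C X Y" using zer_hom[OF hom_objs[OF k]] .
    have "e \<oplus> (f \<oplus> k) = (f \<oplus> e) \<oplus> k"
      using add_assoc[OF e(1) assms(1) k] add_comm[OF e(1) assms(1)] by simp
    also have "\<dots> = k \<oplus> zer C X Y" unfolding e(2) by (rule add_comm[OF z k])
    also have "\<dots> = k" by (rule add_zer[OF k])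
    finally show ?thesis .
  qed
  show ?thesis using *[OF assms(2)] *[OF assms(3)] assms(4) by metis
qed

lemma scl_zero: "f \<in> hom C X Y \<Longrightarrow> scl C 0 f = zer C X Y"
proof -
  assume f: "f \<in> hom C X Y"
  have "scl C 0 f \<oplus> scl C 0 f = scl C 0 f" using scl_add_left[OF f, of 0 0] by (metis add_0)
  also have "\<dots> = scl C 0 f \<oplus> zer C X Y" by (rule add_zer[OF scl_hom[OF f], symmetric])
  finally show ?thesis by (rule add_left_cancel[OF scl_hom[OF f] scl_hom[OF f] zer_hom[OF hom_objs[OF f]]])
qed

lemma scl_zer:
  assumes "X \<in> obj C" "Y \<in> obj C"
  shows "scl C c (zer C X Y) = zer C X Y"
  using scl_scl[OF zer_hom[OF assms], of c 0] scl_zero[OF zer_hom[OF assms]] by simp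

lemma cmp_zer_left:
  assumes f: "f \<in> hom C X Y" and Z: "Z \<in> obj C"
  shows "zer C Y Z \<cdot> f = zer C X Z"
proof -
  have z: "zer C Y Z \<in> hom C Y Z" using zer_hom[OF hom_objs(2)[OF f] Z] .
  have "zer C Y Z \<cdot> f = scl C 0 (zer C Y Z) \<cdot> f" using scl_zero[OF z] by simp
  also have "\<dots> = zer C X Z" using cmp_scl_left[OF f z] scl_zero[OF cmp_hom[OF f z]] by simp
  finally show ?thesis .
qed

lemma cmp_zer_right:
  assumes g: "g \<in> hom C Y Z" and X: "X \<in> obj C"
  shows "g \<cdot> zer C X Y = zer C X Z"
proof -
  have z: "zer C X Y \<in> hom C X Y" using zer_hom[OF X hom_objs(1)[OF g]] .
  have "g \<cdot> zer C X Y = g \<cdot> scl C 0 (zer C X Y)" using scl_zero[OF z] by simp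
  also have "\<dots> = zer C X Z" using cmp_scl_right[OF z g] scl_zero[OF cmp_hom[OF z g]] by simp
  finally show ?thesis .
qed

lemma eq_if_diff_zer:
  assumes "f \<in> hom C X Y" "g \<in> hom C X Y" "f \<oplus> scl C (-1) g = zer C X Y"
  shows "f = g"
proof -
  have "g \<oplus> scl C (-1) g = zer C X Y"
    using scl_add_left[OF assms(2), of 1 "-1"] assms(2) by (simp add: scl_one scl_zero)
  then have "scl C (-1) g \<oplus> f = scl C (-1) g \<oplus> g"
    using assms by (metis add_comm scl_hom)
  then show ?thesis using assms by (meson add_left_cancel scl_hom)
qed

lemma hom_dual_zer: "\<xi> \<in> hom_dual C X Y \<Longrightarrow> X \<in> obj C \<Longrightarrow> Y \<in> obj C \<Longrightarrow> \<xi> (zer C X Y) = 0"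
  using scl_zer[of X Y 0] zer_hom[of X Y] unfolding hom_dual_def by (metis (mono_tags, lifting) mem_Collect_eq mult_zero_left)

end

text \<open>
  Hom-spaces are tested for finite dimension by finitely many functionals without common zero,
  because this condition passes at once to subspaces and along faithful linear functors.
\<close>

definition hom_finite :: "('o, 'm, 'k::field, 'z) lincat_scheme \<Rightarrow> bool" where
  "hom_finite C \<longleftrightarrow> (\<forall>X\<in>obj C. \<forall>Y\<in>obj C. \<exists>\<Phi>. finite \<Phi> \<and> \<Phi> \<subseteq> hom_dual C X Y \<and>
     (\<forall>f\<in>hom C X Y. (\<forall>\<xi>\<in>\<Phi>. \<xi> f = 0) \<longrightarrow> f = zer C X Y))"

lemma hom_dual_subspace: "fun_vs.subspace (hom_dual C X Y)"
  by (auto simp: fun_vs.subspace_def hom_dual_def fscale_def algebra_simps)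

text \<open>
  Finitely many separating functionals embed a hom-space into a finite-dimensional function space,
  so it is spanned by finitely many arrows; these arrows are points that separate its functionals.
\<close>

lemma (in linear_category) hom_dual_fd:
  assumes "hom_finite C" "X \<in> obj C" "Y \<in> obj C"
  shows "fd_space (hom_dual C X Y)"
proof -
  obtain \<Phi> where \<Phi>: "finite \<Phi>" "\<Phi> \<subseteq> hom_dual C X Y"
      "\<And>f. f \<in> hom C X Y \<Longrightarrow> (\<forall>\<xi>\<in>\<Phi>. \<xi> f = 0) \<Longrightarrow> f = zer C X Y"
    using assms(1)[unfolded hom_finite_def, rule_format, OF assms(2,3)] by metis
  \<comment> \<open>an arrow is encoded by its values under the separating functionals\<close>
  define T where "T f = (\<lambda>\<xi>. if \<xi> \<in> \<Phi> then \<xi> f else 0)" for f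
  have Tadd: "T (f \<oplus> g) = T f + T g" if "f \<in> hom C X Y" "g \<in> hom C X Y" for f g
    using that \<Phi>(2) by (auto simp: T_def fun_eq_iff hom_dual_def)
  have Tscl: "T (scl C c f) = fscale c (T f)" if "f \<in> hom C X Y" for c f
    using that \<Phi>(2) by (auto simp: T_def fun_eq_iff hom_dual_def fscale_def)
  have Tzer: "T (zer C X Y) = 0"
    using Tscl[OF zer_hom, of 0] assms by (simp add: scl_zer)
  have Tinj: "f = zer C X Y" if "f \<in> hom C X Y" "T f = 0" for f
    using \<Phi>(3)[OF that(1)] that(2) by (auto simp: T_def fun_eq_iff split: if_splits)
  have "fun_vs.subspace (T ` hom C X Y)"
    unfolding fun_vs.subspace_def using assms Tadd Tscl Tzer
    by (auto intro: zer_hom add_hom scl_hom simp flip: Tadd Tscl)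
  then have "fd_space (T ` hom C X Y)"
    by (rule separated_imp_fd_space[OF \<Phi>(1)]) (auto simp: T_def fun_eq_iff)
  then obtain B where B: "finite B" "T ` hom C X Y = fun_vs.span B" by (auto simp: fd_space_def)
  then obtain F where F: "F \<subseteq> hom C X Y" "finite F" "B = T ` F"
    by (metis finite_subset_image fun_vs.span_superset)
  show ?thesis
  proof (rule separated_imp_fd_space[OF F(2) hom_dual_subspace])
    fix \<xi> assume \<xi>: "\<xi> \<in> hom_dual C X Y" and van: "\<forall>f\<in>F. \<xi> f = 0"
    have "\<forall>f\<in>hom C X Y. T f = v \<longrightarrow> \<xi> f = 0" if "v \<in> fun_vs.span B" for v
      using that
    proof (induction rule: fun_vs.span_induct_alt)
      case base
      then show ?case using Tinj hom_dual_zer[OF \<xi>] assms by blast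
    next
      case (step c b w)
      show ?case
      proof (intro ballI impI)
        fix f assume f: "f \<in> hom C X Y" "T f = fscale c b + w"
        obtain f0 where f0: "f0 \<in> F" "T f0 = b" using step F by auto
        have "b \<in> fun_vs.span B" using step(1) by (simp add: fun_vs.span_base)
        then have "w \<in> fun_vs.span B"
          using f B(2) by (metis add_diff_cancel_left' fun_vs.span_diff fun_vs.span_scale imageI)
        then obtain f1 where f1: "f1 \<in> hom C X Y" "T f1 = w" using B by (metis imageE)
        have h0: "f0 \<in> hom C X Y" using f0 F by auto
        let ?g = "scl C c f0 \<oplus> f1"
        have g: "?g \<in> hom C X Y" using h0 f1 by (intro add_hom scl_hom)
        have "T (f \<oplus> scl C (-1) ?g) = T f - T ?g"
          using f g by (simp add: Tadd Tscl scl_hom)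
        also have "\<dots> = 0" using h0 f1 f f0 by (simp add: Tadd Tscl scl_hom)
        finally have "f = ?g"
          by (intro eq_if_diff_zer[OF f(1) g] Tinj[OF add_hom[OF f(1) scl_hom[OF g]]])
        moreover have "\<xi> ?g = c * \<xi> f0 + \<xi> f1"
          using \<xi> h0 f1 scl_hom by (auto simp: hom_dual_def)
        ultimately show "\<xi> f = 0" using van f0 f1 step by auto
      qed
    qed
    then have "\<forall>f\<in>hom C X Y. \<xi> f = 0" using B(2) by blast
    then show "\<xi> = 0" using \<xi> by (auto simp: hom_dual_def fun_eq_iff)
  qed
qed

text \<open>
  A linear map is determined by its matrix entries.  The rows are indexed by points that separate the
  target space, which saves choosing a basis there.
\<close>

lemma fdmod_hom_separated:
  fixes B :: "'k::field fdalg"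
  assumes "U \<in> obj (fdmod_cat B)" "U' \<in> obj (fdmod_cat B)"
  shows "\<exists>D. finite D \<and> (\<forall>f\<in>hom (fdmod_cat B) U U'. \<forall>g\<in>hom (fdmod_cat B) U U'.
    (\<forall>(b, n)\<in>D. fst (snd f) b n = fst (snd g) b n) \<longrightarrow> f = g)"
proof -
  have "fd_space (fst U)" "fd_space (fst U')"
    using assms by (auto simp: fdmod_cat_def fd_module_def split: prod.splits)
  then obtain E S where E: "finite E" "fst U = fun_vs.span E"
    and S: "finite S" "\<And>v. v \<in> fst U' \<Longrightarrow> (\<forall>x\<in>S. v x = 0) \<Longrightarrow> v = 0"
    using span_separated unfolding fd_space_def by metis
  have subU': "fun_vs.subspace (fst U')" using \<open>fd_space (fst U')\<close> fd_space_subspace by blast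
  show ?thesis
  proof (intro exI[of _ "E \<times> S"] conjI ballI impI)
    show "finite (E \<times> S)" using E S by simp
    fix f g assume fg: "f \<in> hom (fdmod_cat B) U U'" "g \<in> hom (fdmod_cat B) U U'"
      and eq: "\<forall>(b, n)\<in>E \<times> S. fst (snd f) b n = fst (snd g) b n"
    define T T' where "T = fst (snd f)" "T' = fst (snd g)"
    have f: "f = (U, T, U')" and g: "g = (U, T', U')"
      using fg by (auto simp: hom_def fdmod_cat_def T_T'_def prod_eq_iff)
    have lin: "linear_on (fst U) (fst U') T" "linear_on (fst U) (fst U') T'"
      and off: "\<And>v. v \<notin> fst U \<Longrightarrow> T v = T' v"
      using fg unfolding f g by (auto simp: hom_def fdmod_cat_def fdmod_arrow_def)
    have "v \<in> fun_vs.span E \<and> T v = T' v" if "v \<in> fun_vs.span E" for v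
      using that
    proof (induction rule: fun_vs.span_induct_alt)
      case base
      have "T (fscale 0 0) = fscale 0 (T 0)" "T' (fscale 0 0) = fscale 0 (T' 0)"
        using lin E fun_vs.span_zero unfolding linear_on_def by blast+
      then have "T 0 = 0" "T' 0 = 0" by simp_all
      then show ?case using fun_vs.span_zero by metis
    next
      case (step c b w)
      have mem: "b \<in> fst U" "w \<in> fst U" "fscale c b \<in> fst U"
        using step E by (simp_all add: fun_vs.span_base fun_vs.span_scale)
      have "fscale c b + w \<in> fun_vs.span E" using mem E by (simp add: fun_vs.span_add)
      have "T b - T' b \<in> fst U'"
        using lin mem subU' unfolding linear_on_def by (simp add: fun_vs.subspace_diff)
      then have "T b - T' b = 0" using S(2) eq step(1) by (fastforce simp: T_T'_def)
      then have "T b = T' b" by simp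
      then have "T (fscale c b + w) = T' (fscale c b + w)"
        using lin mem step unfolding linear_on_def by simp
      then show ?case using \<open>fscale c b + w \<in> fun_vs.span E\<close> by blast
    qed
    then have "T = T'" using off E by (auto simp: fun_eq_iff)
    then show "f = g" using f g by simp
  qed
qed

text \<open>
  An equivalence is faithful, so the matrix entries of the image of an arrow are functionals
  that separate arrows.
\<close>

lemma (in finite_abelian_category) hom_finite: "hom_finite C"
  unfolding hom_finite_def
proof (intro ballI)
  fix X Y assume XY: "X \<in> obj C" "Y \<in> obj C"
  obtain B where "linearly_equivalent C (fdmod_cat B)" using equivalent_fdmod by blast
  then obtain F G where F: "is_linear_functor C (fdmod_cat B) F"
    and GF: "nat_isomorphic C C (comp_func G F) id_func"
    unfolding linearly_equivalent_def by blast
  obtain \<alpha> where \<alpha>: "\<And>X. X \<in> obj C \<Longrightarrow> \<alpha> X \<in> hom C (fobj G (fobj F X)) X \<and> is_iso C (\<alpha> X)"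
    and nat: "\<And>X Y f. f \<in> hom C X Y \<Longrightarrow> \<alpha> Y \<cdot> farr G (farr F f) = f \<cdot> \<alpha> X"
    using GF unfolding nat_isomorphic_def comp_func_def id_func_def by fastforce
  have faithful: "f = g"
    if fg: "f \<in> hom C X Y" "g \<in> hom C X Y" and eq: "farr F f = farr F g" for f g
  proof -
    obtain \<beta> where \<beta>: "inverse_arrows C (\<alpha> X) \<beta>" using \<alpha>[OF XY(1)] by (auto simp: is_iso_def)
    have ah: "\<alpha> X \<in> hom C (fobj G (fobj F X)) X" using \<alpha>[OF XY(1)] by blast
    then have bh: "\<beta> \<in> hom C X (fobj G (fobj F X))" and ab: "\<alpha> X \<cdot> \<beta> = ide C X"
      using \<beta> by (auto simp: inverse_arrows_def hom_def)
    have *: "k = (k \<cdot> \<alpha> X) \<cdot> \<beta>" if "k \<in> hom C X Y" for k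
      using cmp_assoc[OF bh ah that] cmp_ide_right[OF that] ab by simp
    have "f \<cdot> \<alpha> X = g \<cdot> \<alpha> X" using nat[OF fg(1)] nat[OF fg(2)] eq by simp
    then show ?thesis using *[OF fg(1)] *[OF fg(2)] by simp
  qed
  have Fob: "fobj F X \<in> obj (fdmod_cat B)" "fobj F Y \<in> obj (fdmod_cat B)"
    using F XY by (auto simp: is_linear_functor_def is_functor_def)
  have Fhom: "farr F f \<in> hom (fdmod_cat B) (fobj F X) (fobj F Y)" if "f \<in> hom C X Y" for f
    using F that by (auto simp: is_linear_functor_def is_functor_def)
  obtain D where D: "finite D" "\<And>f g. f \<in> hom (fdmod_cat B) (fobj F X) (fobj F Y) \<Longrightarrow>
      g \<in> hom (fdmod_cat B) (fobj F X) (fobj F Y) \<Longrightarrow>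
      (\<forall>(b, n)\<in>D. fst (snd f) b n = fst (snd g) b n) \<Longrightarrow> f = g"
    using fdmod_hom_separated[OF Fob] by blast
  define val where "val f d = fst (snd (farr F f)) (fst d) (snd d)" for f d
  have val_add: "val (f \<oplus> g) d = val f d + val g d" if "f \<in> hom C X Y" "g \<in> hom C X Y" for f g d
    using F that by (auto simp: is_linear_functor_def val_def fdmod_cat_def)
  have val_scl: "val (scl C c f) d = c * val f d" if "f \<in> hom C X Y" for c f d
    using F that by (auto simp: is_linear_functor_def val_def fdmod_cat_def fscale_apply)
  have val_zer: "val (zer C X Y) d = 0" for d
    using val_scl[OF zer_hom[OF XY], of 0 d] scl_zer[OF XY] by simp
  define \<Phi> where "\<Phi> = (\<lambda>d f. if f \<in> hom C X Y then val f d else 0) ` D"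
  show "\<exists>\<Phi>. finite \<Phi> \<and> \<Phi> \<subseteq> hom_dual C X Y \<and>
     (\<forall>f\<in>hom C X Y. (\<forall>\<xi>\<in>\<Phi>. \<xi> f = 0) \<longrightarrow> f = zer C X Y)"
  proof (intro exI[of _ \<Phi>] conjI ballI impI)
    show "finite \<Phi>" using D(1) by (simp add: \<Phi>_def)
    show "\<Phi> \<subseteq> hom_dual C X Y"
      by (auto simp: \<Phi>_def hom_dual_def val_add val_scl add_hom scl_hom)
    fix f assume f: "f \<in> hom C X Y" and van: "\<forall>\<xi>\<in>\<Phi>. \<xi> f = 0"
    have "val f d = val (zer C X Y) d" if "d \<in> D" for d
      using van f that by (auto simp: \<Phi>_def val_zer)
    then have "farr F f = farr F (zer C X Y)"
      by (intro D(2) Fhom f zer_hom XY) (auto simp: val_def)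
    then show "f = zer C X Y" using faithful f zer_hom[OF XY] by blast
  qed
qed

section \<open>The Nakayama coend without copowers\<close>

text \<open>
  By the adjunction defining copowers, a dinatural transformation
  \<open>Hom(M, X)\<^sup>* \<otimes> X \<rightarrow> Z\<close> is the same as a family of linear maps
  \<open>Hom(M, X)\<^sup>* \<rightarrow> Hom(X, Z)\<close> that is natural in \<open>X\<close>.  In this form the coend can be
  compared across categories with different copowers.  Below, \<open>j M X \<xi>\<close> is the universal dinatural
  transformation at \<open>M\<close> and \<open>X\<close>, restricted to the copy of \<open>X\<close> that belongs to the functional \<open>\<xi>\<close>.
\<close>

definition dual_family ::
  "('o, 'm, 'k::field, 'z) lincat_scheme \<Rightarrow> 'o \<Rightarrow> 'o \<Rightarrow> ('o \<Rightarrow> ('m \<Rightarrow> 'k) \<Rightarrow> 'm) \<Rightarrow> bool" where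
  "dual_family C M Z k \<longleftrightarrow>
     (\<forall>X\<in>obj C. linear_into_hom C (hom_dual C M X) X Z (k X)) \<and>
     (\<forall>X X'. \<forall>g\<in>hom C X X'. \<forall>\<xi>\<in>hom_dual C M X'.
        k X (hom_transpose C M X (\<lambda>f. g \<cdot>\<^bsub>C\<^esub> f) \<xi>) = k X' \<xi> \<cdot>\<^bsub>C\<^esub> g)"

definition dual_coend ::
  "('o, 'm, 'k::field, 'z) lincat_scheme \<Rightarrow> ('o, 'm, 'o, 'm) func \<Rightarrow>
   ('o \<Rightarrow> 'o \<Rightarrow> ('m \<Rightarrow> 'k) \<Rightarrow> 'm) \<Rightarrow> bool" where
  "dual_coend C N j \<longleftrightarrow> is_functor C C N \<and>
     (\<forall>M\<in>obj C. dual_family C M (fobj N M) (j M) \<and>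
        (\<forall>Z\<in>obj C. \<forall>k. dual_family C M Z k \<longrightarrow>
           (\<exists>!h. h \<in> hom C (fobj N M) Z \<and>
              (\<forall>X\<in>obj C. \<forall>\<xi>\<in>hom_dual C M X. h \<cdot>\<^bsub>C\<^esub> j M X \<xi> = k X \<xi>)))) \<and>
     (\<forall>M M'. \<forall>f\<in>hom C M M'. \<forall>X\<in>obj C. \<forall>\<xi>\<in>hom_dual C M X.
        farr N f \<cdot>\<^bsub>C\<^esub> j M X \<xi> = j M' X (hom_transpose C M' X (\<lambda>g. g \<cdot>\<^bsub>C\<^esub> f) \<xi>))"

lemma dual_coend_functor: "dual_coend C N j \<Longrightarrow> is_functor C C N"
  and dual_coend_obj: "dual_coend C N j \<Longrightarrow> M \<in> obj C \<Longrightarrow> fobj N M \<in> obj C"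
  and dual_coend_arr: "dual_coend C N j \<Longrightarrow> f \<in> hom C M M' \<Longrightarrow> farr N f \<in> hom C (fobj N M) (fobj N M')"
  by (simp_all add: dual_coend_def is_functor_def)

lemma dual_coend_family: "dual_coend C N j \<Longrightarrow> M \<in> obj C \<Longrightarrow> dual_family C M (fobj N M) (j M)"
  by (simp add: dual_coend_def)

lemma dual_coend_universal:
  "dual_coend C N j \<Longrightarrow> M \<in> obj C \<Longrightarrow> Z \<in> obj C \<Longrightarrow> dual_family C M Z k \<Longrightarrow>
   \<exists>!h. h \<in> hom C (fobj N M) Z \<and> (\<forall>X\<in>obj C. \<forall>\<xi>\<in>hom_dual C M X. h \<cdot>\<^bsub>C\<^esub> j M X \<xi> = k X \<xi>)"
  by (simp add: dual_coend_def)

lemma dual_coend_natural: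
  "dual_coend C N j \<Longrightarrow> f \<in> hom C M M' \<Longrightarrow> X \<in> obj C \<Longrightarrow> \<xi> \<in> hom_dual C M X \<Longrightarrow>
   farr N f \<cdot>\<^bsub>C\<^esub> j M X \<xi> = j M' X (hom_transpose C M' X (\<lambda>g. g \<cdot>\<^bsub>C\<^esub> f) \<xi>)"
  by (simp add: dual_coend_def)

definition linear_between ::
  "('o, 'm, 'k, 'z) lincat_scheme \<Rightarrow> 'o \<Rightarrow> 'o \<Rightarrow> ('p, 'n, 'k, 'y) lincat_scheme \<Rightarrow> 'p \<Rightarrow> 'p \<Rightarrow>
   ('m \<Rightarrow> 'n) \<Rightarrow> bool" where
  "linear_between C X Y D X' Y' T \<longleftrightarrow>
     (\<forall>f\<in>hom C X Y. T f \<in> hom D X' Y') \<and>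
     (\<forall>f\<in>hom C X Y. \<forall>g\<in>hom C X Y. T (f \<oplus>\<^bsub>C\<^esub> g) = T f \<oplus>\<^bsub>D\<^esub> T g) \<and>
     (\<forall>c. \<forall>f\<in>hom C X Y. T (scl C c f) = scl D c (T f))"

lemma hom_transpose_linear:
  assumes C: "linear_category C" and T: "linear_between C X Y D X' Y' T"
  shows "linear_on (hom_dual D X' Y') (hom_dual C X Y) (hom_transpose C X Y T)"
  unfolding linear_on_def
proof (intro conjI ballI allI)
  fix \<xi> \<zeta> c
  assume \<xi>: "\<xi> \<in> hom_dual D X' Y'"
  show "hom_transpose C X Y T \<xi> \<in> hom_dual C X Y"
    using T \<xi> linear_category.add_hom[OF C] linear_category.scl_hom[OF C]
    by (auto simp: hom_dual_def hom_transpose_def linear_between_def)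
  show "hom_transpose C X Y T (\<xi> + \<zeta>) = hom_transpose C X Y T \<xi> + hom_transpose C X Y T \<zeta>"
    by (auto simp: hom_transpose_def fun_eq_iff)
  show "hom_transpose C X Y T (fscale c \<xi>) = fscale c (hom_transpose C X Y T \<xi>)"
    by (auto simp: hom_transpose_def fun_eq_iff fscale_def)
qed

lemma hom_transpose_apply: "f \<in> hom C X Y \<Longrightarrow> hom_transpose C X Y T \<xi> f = \<xi> (T f)"
  by (simp add: hom_transpose_def)

lemma hom_transpose_comp:
  "(\<And>f. f \<in> hom C X Y \<Longrightarrow> T f \<in> hom D X' Y') \<Longrightarrow>
   hom_transpose C X Y T (hom_transpose D X' Y' S \<xi>) = hom_transpose C X Y (\<lambda>f. S (T f)) \<xi>"
  by (auto simp: hom_transpose_def fun_eq_iff)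

lemma hom_transpose_cong:
  "(\<And>f. f \<in> hom C X Y \<Longrightarrow> T f = S f) \<Longrightarrow> hom_transpose C X Y T \<xi> = hom_transpose C X Y S \<xi>"
  by (auto simp: hom_transpose_def fun_eq_iff)

lemma hom_transpose_ident:
  "\<xi> \<in> hom_dual C X Y \<Longrightarrow> (\<And>f. f \<in> hom C X Y \<Longrightarrow> T f = f) \<Longrightarrow> hom_transpose C X Y T \<xi> = \<xi>"
  by (auto simp: hom_transpose_def hom_dual_def fun_eq_iff)

lemma linear_into_hom_comp:
  assumes "linear_on V W T" "linear_into_hom C W X Y g"
  shows "linear_into_hom C V X Y (\<lambda>v. g (T v))"
  using assms unfolding linear_on_def linear_into_hom_def by auto

lemma linear_on_ident: "linear_on V V (\<lambda>v. v)"
  by (auto simp: linear_on_def)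

context linear_category
begin

lemma linear_between_post: "g \<in> hom C X Y \<Longrightarrow> linear_between C M X C M Y (\<lambda>f. g \<cdot> f)"
  by (auto simp: linear_between_def cmp_hom cmp_add_right cmp_scl_right)

lemma linear_between_pre: "f \<in> hom C M M' \<Longrightarrow> linear_between C M' X C M X (\<lambda>g. g \<cdot> f)"
  by (auto simp: linear_between_def cmp_hom cmp_add_left cmp_scl_left)

lemma linear_into_hom_post:
  assumes "linear_into_hom C V X Y e" "h \<in> hom C Y Z" shows "linear_into_hom C V X Z (\<lambda>v. h \<cdot> e v)"
  unfolding linear_into_hom_def
  using assms cmp_add_right[of _ X Y _ h Z] cmp_scl_right[of _ X Y h Z] cmp_hom[of _ X Y h Z]
  by (auto simp: linear_into_hom_def)

lemma linear_into_hom_pre: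
  assumes "linear_into_hom C V Y Z e" "h \<in> hom C X Y" shows "linear_into_hom C V X Z (\<lambda>v. e v \<cdot> h)"
  unfolding linear_into_hom_def
  using assms cmp_add_left[of h X Y _ Z] cmp_scl_left[of h X Y _ Z] cmp_hom[of h X Y _ Z]
  by (auto simp: linear_into_hom_def)

lemma copower_induced:
  assumes "is_copower C V X P e" "Y \<in> obj C" "linear_into_hom C V X Y g"
  shows "copower_induced C V P e Y g \<in> hom C P Y"
    and "v \<in> V \<Longrightarrow> copower_induced C V P e Y g \<cdot> e v = g v"
proof -
  have "\<exists>!h. h \<in> hom C P Y \<and> (\<forall>v\<in>V. h \<cdot> e v = g v)"
    using assms unfolding is_copower_def by blast
  from theI'[OF this] show "copower_induced C V P e Y g \<in> hom C P Y"
    and "v \<in> V \<Longrightarrow> copower_induced C V P e Y g \<cdot> e v = g v"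
    unfolding copower_induced_def by blast+
qed

lemma copower_ext:
  assumes "is_copower C V X P e" "h \<in> hom C P Y" "h' \<in> hom C P Y"
    and "\<And>v. v \<in> V \<Longrightarrow> h \<cdot> e v = h' \<cdot> e v"
  shows "h = h'"
proof -
  have "linear_into_hom C V X P e" using assms(1) by (simp add: is_copower_def)
  then have "linear_into_hom C V X Y (\<lambda>v. h \<cdot> e v)" using assms(2) by (rule linear_into_hom_post)
  then have "\<exists>!k. k \<in> hom C P Y \<and> (\<forall>v\<in>V. k \<cdot> e v = h \<cdot> e v)"
    using assms(1) hom_objs(2)[OF assms(2)] unfolding is_copower_def by blast
  then show ?thesis using assms(2-4) by metis
qed

lemma is_copower_obj: "is_copower C V X P e \<Longrightarrow> P \<in> obj C"
  and is_copower_lin: "is_copower C V X P e \<Longrightarrow> linear_into_hom C V X P e"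
  by (auto simp: is_copower_def)

lemma copower_map:
  assumes "is_copower C V X (cpobj cp V X) (cpunit cp V X)"
    and "is_copower C W Y (cpobj cp W Y) (cpunit cp W Y)"
    and "linear_on V W T" "g \<in> hom C X Y"
  shows "copower_map C cp V X W Y T g \<in> hom C (cpobj cp V X) (cpobj cp W Y)"
    and "v \<in> V \<Longrightarrow> copower_map C cp V X W Y T g \<cdot> cpunit cp V X v = cpunit cp W Y (T v) \<cdot> g"
proof -
  have "linear_into_hom C V X (cpobj cp W Y) (\<lambda>v. cpunit cp W Y (T v) \<cdot> g)"
    by (intro linear_into_hom_pre[OF linear_into_hom_comp[OF assms(3) is_copower_lin[OF assms(2)]] assms(4)])
  from copower_induced[OF assms(1) is_copower_obj[OF assms(2)] this]
  show "copower_map C cp V X W Y T g \<in> hom C (cpobj cp V X) (cpobj cp W Y)"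
    and "v \<in> V \<Longrightarrow> copower_map C cp V X W Y T g \<cdot> cpunit cp V X v = cpunit cp W Y (T v) \<cdot> g"
    unfolding copower_map_def by blast+
qed

lemma copower_of_hom_dual:
  assumes "hom_finite C" "has_copowers C cp" "M \<in> obj C" "X \<in> obj C" "Y \<in> obj C"
  shows "is_copower C (hom_dual C M X) Y (cpobj cp (hom_dual C M X) Y) (cpunit cp (hom_dual C M X) Y)"
  using assms hom_dual_fd unfolding has_copowers_def by blast

lemma copower_arrow_eq:
  assumes "is_copower C V X P e" "a \<in> hom C P Q" "b \<in> hom C Q Z" "a' \<in> hom C P Q'" "b' \<in> hom C Q' Z"
  shows "b \<cdot> a = b' \<cdot> a' \<longleftrightarrow> (\<forall>v\<in>V. b \<cdot> (a \<cdot> e v) = b' \<cdot> (a' \<cdot> e v))"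
proof -
  have e: "e v \<in> hom C X P" if "v \<in> V" for v
    using is_copower_lin[OF assms(1)] that by (auto simp: linear_into_hom_def)
  have "b \<cdot> a = b' \<cdot> a' \<longleftrightarrow> (\<forall>v\<in>V. (b \<cdot> a) \<cdot> e v = (b' \<cdot> a') \<cdot> e v)"
    using copower_ext[OF assms(1) cmp_hom[OF assms(2,3)] cmp_hom[OF assms(4,5)]] by auto
  also have "\<dots> \<longleftrightarrow> (\<forall>v\<in>V. b \<cdot> (a \<cdot> e v) = b' \<cdot> (a' \<cdot> e v))"
    using cmp_assoc[OF e assms(2,3)] cmp_assoc[OF e assms(4,5)] by auto
  finally show ?thesis .
qed

text \<open>
  Arrows out of a copower are determined by their composites with its unit; on these composites the
  two legs of the dinaturality square are the two sides of the naturality condition.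
\<close>

lemma dinatural_iff_dual_family:
  assumes fin: "hom_finite C" "has_copowers C cp" and M: "M \<in> obj C"
    and i: "\<And>X. X \<in> obj C \<Longrightarrow> i X \<in> hom C (cpobj cp (hom_dual C M X) X) Z"
  shows "nak_dinatural C cp M Z i \<longleftrightarrow>
    dual_family C M Z (\<lambda>X \<xi>. i X \<cdot> cpunit cp (hom_dual C M X) X \<xi>)"
proof -
  note cop = copower_of_hom_dual[OF fin M]
  have lin: "linear_into_hom C (hom_dual C M X) X Z (\<lambda>\<xi>. i X \<cdot> cpunit cp (hom_dual C M X) X \<xi>)"
    if "X \<in> obj C" for X
    by (rule linear_into_hom_post[OF is_copower_lin[OF cop[OF that that]] i[OF that]])
  have "i X \<cdot> copower_map C cp (hom_dual C M X') X (hom_dual C M X) X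
                 (hom_transpose C M X (\<lambda>f. g \<cdot> f)) (ide C X) =
        i X' \<cdot> copower_map C cp (hom_dual C M X') X (hom_dual C M X') X' (\<lambda>\<xi>. \<xi>) g \<longleftrightarrow>
        (\<forall>\<xi>\<in>hom_dual C M X'.
          i X \<cdot> cpunit cp (hom_dual C M X) X (hom_transpose C M X (\<lambda>f. g \<cdot> f) \<xi>) =
          (i X' \<cdot> cpunit cp (hom_dual C M X') X' \<xi>) \<cdot> g)"
    if g: "g \<in> hom C X X'" for X X' g
  proof -
    note X = hom_objs[OF g]
    let ?T = "hom_transpose C M X (\<lambda>f. g \<cdot> f)"
    have T: "linear_on (hom_dual C M X') (hom_dual C M X) ?T"
      by (rule hom_transpose_linear[OF linear_category_axioms linear_between_post[OF g]])
    note m1 = copower_map[OF cop[OF X(2) X(1)] cop[OF X(1) X(1)] T ide_hom[OF X(1)]]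
    note m2 = copower_map[OF cop[OF X(2) X(1)] cop[OF X(2) X(2)] linear_on_ident g]
    have u: "cpunit cp (hom_dual C M X) X (?T \<xi>) \<in> hom C X (cpobj cp (hom_dual C M X) X)"
      "cpunit cp (hom_dual C M X') X' \<xi> \<in> hom C X' (cpobj cp (hom_dual C M X') X')"
      if "\<xi> \<in> hom_dual C M X'" for \<xi>
      using that T is_copower_lin[OF cop[OF X(1) X(1)]] is_copower_lin[OF cop[OF X(2) X(2)]]
      unfolding linear_into_hom_def linear_on_def by blast+
    show ?thesis
      unfolding copower_arrow_eq[OF cop[OF X(2) X(1)] m1(1) i[OF X(1)] m2(1) i[OF X(2)]]
      by (intro ball_cong refl)
        (simp only: m1(2) m2(2) cmp_ide_right[OF u(1)] cmp_assoc[OF g u(2) i[OF X(2)]])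
  qed
  then show ?thesis
    unfolding nak_dinatural_def dual_family_def using i lin by auto
qed


lemma dual_transport_post:
  assumes "g \<in> hom C X X'" "\<xi> \<in> hom_dual C M X'"
  shows "hom_transpose C M X (\<lambda>f. g \<cdot> f) \<xi> \<in> hom_dual C M X"
  using hom_transpose_linear[OF linear_category_axioms linear_between_post[OF assms(1)]] assms(2)
  by (auto simp: linear_on_def)

lemma dual_transport_pre:
  assumes "f \<in> hom C M M'" "\<xi> \<in> hom_dual C M X"
  shows "hom_transpose C M' X (\<lambda>g. g \<cdot> f) \<xi> \<in> hom_dual C M' X"
  using hom_transpose_linear[OF linear_category_axioms linear_between_pre[OF assms(1)]] assms(2)
  by (auto simp: linear_on_def)

lemma linear_into_hom_cong:
  assumes "fun_vs.subspace V" "\<And>v. v \<in> V \<Longrightarrow> g v = g' v"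
  shows "linear_into_hom C V X Y g \<longleftrightarrow> linear_into_hom C V X Y g'"
  using assms fun_vs.subspace_add[OF assms(1)] fun_vs.subspace_scale[OF assms(1)]
  unfolding linear_into_hom_def by auto

lemma dual_family_cong:
  assumes "\<And>X \<xi>. X \<in> obj C \<Longrightarrow> \<xi> \<in> hom_dual C M X \<Longrightarrow> k X \<xi> = k' X \<xi>"
  shows "dual_family C M Z k \<longleftrightarrow> dual_family C M Z k'"
proof -
  have "linear_into_hom C (hom_dual C M X) X Z (k X) \<longleftrightarrow> linear_into_hom C (hom_dual C M X) X Z (k' X)"
    if "X \<in> obj C" for X
    using assms[OF that] by (intro linear_into_hom_cong hom_dual_subspace)
  moreover have "k X (hom_transpose C M X (\<lambda>f. g \<cdot> f) \<xi>) = k' X (hom_transpose C M X (\<lambda>f. g \<cdot> f) \<xi>)"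
    "k X' \<xi> = k' X' \<xi>" if "g \<in> hom C X X'" "\<xi> \<in> hom_dual C M X'" for X X' g \<xi>
    using assms[OF hom_objs(1)[OF that(1)] dual_transport_post[OF that]] assms[OF hom_objs(2)[OF that(1)] that(2)]
    by auto
  ultimately show ?thesis unfolding dual_family_def by auto
qed

lemma dual_family_hom:
  "dual_family C M Z k \<Longrightarrow> X \<in> obj C \<Longrightarrow> \<xi> \<in> hom_dual C M X \<Longrightarrow> k X \<xi> \<in> hom C X Z"
  by (auto simp: dual_family_def linear_into_hom_def)

lemma coend_action_iff:
  assumes fin: "hom_finite C" "has_copowers C cp" and f: "f \<in> hom C M M'" and X: "X \<in> obj C"
    and a: "a \<in> hom C (cpobj cp (hom_dual C M X) X) Z" and b: "b \<in> hom C (cpobj cp (hom_dual C M' X) X) Z'"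
    and n: "n \<in> hom C Z Z'"
  shows "n \<cdot> a = b \<cdot> copower_map C cp (hom_dual C M X) X (hom_dual C M' X) X
                 (hom_transpose C M' X (\<lambda>g. g \<cdot> f)) (ide C X) \<longleftrightarrow>
    (\<forall>\<xi>\<in>hom_dual C M X. n \<cdot> (a \<cdot> cpunit cp (hom_dual C M X) X \<xi>) =
       b \<cdot> cpunit cp (hom_dual C M' X) X (hom_transpose C M' X (\<lambda>g. g \<cdot> f) \<xi>))"
proof -
  note cop = copower_of_hom_dual[OF fin _ X X]
  note M = hom_objs[OF f]
  have T: "linear_on (hom_dual C M X) (hom_dual C M' X) (hom_transpose C M' X (\<lambda>g. g \<cdot> f))"
    by (rule hom_transpose_linear[OF linear_category_axioms linear_between_pre[OF f]])
  note m = copower_map[OF cop[OF M(1)] cop[OF M(2)] T ide_hom[OF X]]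
  have u: "cpunit cp (hom_dual C M' X) X (hom_transpose C M' X (\<lambda>g. g \<cdot> f) \<xi>)
      \<in> hom C X (cpobj cp (hom_dual C M' X) X)" if "\<xi> \<in> hom_dual C M X" for \<xi>
    using that T is_copower_lin[OF cop[OF M(2)]] unfolding linear_into_hom_def linear_on_def by blast
  show ?thesis
    unfolding copower_arrow_eq[OF cop[OF M(1)] a n m(1) b]
    by (intro ball_cong refl) (simp only: m(2) cmp_ide_right[OF u])
qed

text \<open>
  Each defining condition of the coend translates separately.  In the universal property, families
  are turned into dinatural transformations by the universal property of the copowers.
\<close>

lemma nakayama_coend_iff_dual_coend:
  assumes fin: "hom_finite C" and cp: "has_copowers C cp" and N: "is_functor C C N"
    and i: "\<And>M X. M \<in> obj C \<Longrightarrow> X \<in> obj C \<Longrightarrow> i M X \<in> hom C (cpobj cp (hom_dual C M X) X) (fobj N M)"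
  shows "nakayama_coend C cp N i \<longleftrightarrow>
    dual_coend C N (\<lambda>M X \<xi>. i M X \<cdot> cpunit cp (hom_dual C M X) X \<xi>)"
proof -
  note cop = copower_of_hom_dual[OF fin cp]
  let ?un = "\<lambda>M X. cpunit cp (hom_dual C M X) X"
  have fam: "nak_dinatural C cp M Z k \<longleftrightarrow> dual_family C M Z (\<lambda>X \<xi>. k X \<cdot> ?un M X \<xi>)"
    if "M \<in> obj C" "\<And>X. X \<in> obj C \<Longrightarrow> k X \<in> hom C (cpobj cp (hom_dual C M X) X) Z" for M Z k
    by (rule dinatural_iff_dual_family[OF fin cp that])
  have mediating: "(h \<in> hom C (fobj N M) Z \<and> (\<forall>X\<in>obj C. h \<cdot> i M X = k X)) \<longleftrightarrow>
      (h \<in> hom C (fobj N M) Z \<and>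
        (\<forall>X\<in>obj C. \<forall>\<xi>\<in>hom_dual C M X. h \<cdot> (i M X \<cdot> ?un M X \<xi>) = k X \<cdot> ?un M X \<xi>))"
    if M: "M \<in> obj C" and Z: "Z \<in> obj C"
      and k: "\<And>X. X \<in> obj C \<Longrightarrow> k X \<in> hom C (cpobj cp (hom_dual C M X) X) Z" for M Z k h
  proof (intro conj_cong refl ball_cong)
    fix X assume h: "h \<in> hom C (fobj N M) Z" and X: "X \<in> obj C"
    have un: "?un M X \<xi> \<in> hom C X (cpobj cp (hom_dual C M X) X)" if "\<xi> \<in> hom_dual C M X" for \<xi>
      using is_copower_lin[OF cop[OF M X X]] that unfolding linear_into_hom_def by blast
    have "h \<cdot> i M X = ide C Z \<cdot> k X \<longleftrightarrow>
        (\<forall>\<xi>\<in>hom_dual C M X. h \<cdot> (i M X \<cdot> ?un M X \<xi>) = ide C Z \<cdot> (k X \<cdot> ?un M X \<xi>))"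
      by (rule copower_arrow_eq[OF cop[OF M X X] i[OF M X] h k[OF X] ide_hom[OF Z]])
    then show "h \<cdot> i M X = k X \<longleftrightarrow>
        (\<forall>\<xi>\<in>hom_dual C M X. h \<cdot> (i M X \<cdot> ?un M X \<xi>) = k X \<cdot> ?un M X \<xi>)"
      using cmp_ide_left[OF k[OF X]] cmp_ide_left[OF cmp_hom[OF un k[OF X]]] by simp
  qed
  have univ: "(\<forall>k. nak_dinatural C cp M Z k \<longrightarrow>
        (\<exists>!h. h \<in> hom C (fobj N M) Z \<and> (\<forall>X\<in>obj C. h \<cdot> i M X = k X))) \<longleftrightarrow>
      (\<forall>k. dual_family C M Z k \<longrightarrow> (\<exists>!h. h \<in> hom C (fobj N M) Z \<and>
        (\<forall>X\<in>obj C. \<forall>\<xi>\<in>hom_dual C M X. h \<cdot> (i M X \<cdot> ?un M X \<xi>) = k X \<xi>)))"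
    (is "?L \<longleftrightarrow> ?R") if M: "M \<in> obj C" and Z: "Z \<in> obj C" for M Z
  proof
    assume L: ?L
    show ?R
    proof (intro allI impI)
      fix k assume k: "dual_family C M Z k"
      \<comment> \<open>a family is the restriction of the arrows that it induces on the copowers\<close>
      define kk where "kk X = copower_induced C (hom_dual C M X) (cpobj cp (hom_dual C M X) X) (?un M X) Z (k X)"
        for X
      have lin: "linear_into_hom C (hom_dual C M X) X Z (k X)" if "X \<in> obj C" for X
        using k that by (auto simp: dual_family_def)
      have kk: "kk X \<in> hom C (cpobj cp (hom_dual C M X) X) Z" if "X \<in> obj C" for X
        unfolding kk_def by (rule copower_induced(1)[OF cop[OF M that that] Z lin[OF that]])
      have kk_un: "kk X \<cdot> ?un M X \<xi> = k X \<xi>" if "X \<in> obj C" "\<xi> \<in> hom_dual C M X" for X \<xi>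
        unfolding kk_def by (rule copower_induced(2)[OF cop[OF M that(1,1)] Z lin[OF that(1)] that(2)])
      have "dual_family C M Z (\<lambda>X \<xi>. kk X \<cdot> ?un M X \<xi>)"
        by (rule iffD2[OF dual_family_cong[where k'=k] k]) (rule kk_un)
      then have ex: "\<exists>!h. h \<in> hom C (fobj N M) Z \<and> (\<forall>X\<in>obj C. h \<cdot> i M X = kk X)"
        using L fam[where k=kk, OF M kk] by blast
      have "(h \<in> hom C (fobj N M) Z \<and> (\<forall>X\<in>obj C. h \<cdot> i M X = kk X)) \<longleftrightarrow>
          (h \<in> hom C (fobj N M) Z \<and>
            (\<forall>X\<in>obj C. \<forall>\<xi>\<in>hom_dual C M X. h \<cdot> (i M X \<cdot> ?un M X \<xi>) = k X \<xi>))" for h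
        unfolding mediating[where k=kk and h=h, OF M Z kk, simplified] using kk_un by simp
      then show "\<exists>!h. h \<in> hom C (fobj N M) Z \<and>
          (\<forall>X\<in>obj C. \<forall>\<xi>\<in>hom_dual C M X. h \<cdot> (i M X \<cdot> ?un M X \<xi>) = k X \<xi>)"
        using ex by simp
    qed
  next
    assume R: ?R
    show ?L
    proof (intro allI impI)
      fix k assume din: "nak_dinatural C cp M Z k"
      then have k: "\<And>X. X \<in> obj C \<Longrightarrow> k X \<in> hom C (cpobj cp (hom_dual C M X) X) Z"
        by (simp add: nak_dinatural_def)
      have "dual_family C M Z (\<lambda>X \<xi>. k X \<cdot> ?un M X \<xi>)" using fam[where k=k, OF M k] din by blast
      then have ex: "\<exists>!h. h \<in> hom C (fobj N M) Z \<and>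
          (\<forall>X\<in>obj C. \<forall>\<xi>\<in>hom_dual C M X. h \<cdot> (i M X \<cdot> ?un M X \<xi>) = k X \<cdot> ?un M X \<xi>)"
        by (rule R[rule_format])
      have eq: "(h \<in> hom C (fobj N M) Z \<and> (\<forall>X\<in>obj C. h \<cdot> i M X = k X)) \<longleftrightarrow>
          (h \<in> hom C (fobj N M) Z \<and>
            (\<forall>X\<in>obj C. \<forall>\<xi>\<in>hom_dual C M X. h \<cdot> (i M X \<cdot> ?un M X \<xi>) = k X \<cdot> ?un M X \<xi>))" for h
        by (rule mediating[OF M Z k])
      show "\<exists>!h. h \<in> hom C (fobj N M) Z \<and> (\<forall>X\<in>obj C. h \<cdot> i M X = k X)"
        unfolding eq by (rule ex)
    qed
  qed
  have nat: "farr N f \<cdot> i M X = i M' X \<cdot> copower_map C cp (hom_dual C M X) X (hom_dual C M' X) X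
        (hom_transpose C M' X (\<lambda>g. g \<cdot> f)) (ide C X) \<longleftrightarrow>
      (\<forall>\<xi>\<in>hom_dual C M X. farr N f \<cdot> (i M X \<cdot> ?un M X \<xi>) =
        i M' X \<cdot> ?un M' X (hom_transpose C M' X (\<lambda>g. g \<cdot> f) \<xi>))"
    if f: "f \<in> hom C M M'" and X: "X \<in> obj C" for M M' f X
  proof -
    have "farr N f \<in> hom C (fobj N M) (fobj N M')" using N f by (auto simp: is_functor_def)
    then show ?thesis using coend_action_iff[OF fin cp f X i i] hom_objs[OF f] X by blast
  qed
  show ?thesis
    unfolding nakayama_coend_def dual_coend_def using cp N i by (simp add: fam univ nat cong: ball_cong)
qed

lemma nakayama_coend_imp_dual_coend:
  assumes fin: "hom_finite C" and N: "nakayama_coend C cp N i"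
  shows "dual_coend C N (\<lambda>M X \<xi>. i M X \<cdot> cpunit cp (hom_dual C M X) X \<xi>)"
proof -
  have *: "has_copowers C cp" "is_functor C C N"
    and i: "\<And>M X. M \<in> obj C \<Longrightarrow> X \<in> obj C \<Longrightarrow> i M X \<in> hom C (cpobj cp (hom_dual C M X) X) (fobj N M)"
    using N unfolding nakayama_coend_def nak_dinatural_def by auto
  show ?thesis using nakayama_coend_iff_dual_coend[where i=i, OF fin * i] N by blast
qed

lemma dual_coend_imp_nakayama_coend:
  assumes fin: "hom_finite C" and cp: "has_copowers C cp" and N: "dual_coend C N j"
  shows "\<exists>i. nakayama_coend C cp N i"
proof -
  define i where "i M X = copower_induced C (hom_dual C M X) (cpobj cp (hom_dual C M X) X)
      (cpunit cp (hom_dual C M X) X) (fobj N M) (j M X)" for M X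
  have lin: "linear_into_hom C (hom_dual C M X) X (fobj N M) (j M X)" if "M \<in> obj C" "X \<in> obj C" for M X
    using dual_coend_family[OF N that(1)] that(2) by (auto simp: dual_family_def)
  note ci = copower_induced[OF copower_of_hom_dual[OF fin cp] dual_coend_obj[OF N] lin]
  have i: "i M X \<in> hom C (cpobj cp (hom_dual C M X) X) (fobj N M)" if "M \<in> obj C" "X \<in> obj C" for M X
    unfolding i_def using that by (intro ci(1))
  have ij: "i M X \<cdot> cpunit cp (hom_dual C M X) X \<xi> = j M X \<xi>"
    if "M \<in> obj C" "X \<in> obj C" "\<xi> \<in> hom_dual C M X" for M X \<xi>
    unfolding i_def using that by (intro ci(2))
  have "dual_coend C N (\<lambda>M X \<xi>. i M X \<cdot> cpunit cp (hom_dual C M X) X \<xi>)"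
    unfolding dual_coend_def
  proof (intro conjI ballI allI impI)
    show "is_functor C C N" by (rule dual_coend_functor[OF N])
    show "dual_family C M (fobj N M) (\<lambda>X \<xi>. i M X \<cdot> cpunit cp (hom_dual C M X) X \<xi>)"
      if "M \<in> obj C" for M
      by (rule iffD2[OF dual_family_cong dual_coend_family[OF N that]]) (rule ij[OF that])
    show "\<exists>!h. h \<in> hom C (fobj N M) Z \<and>
        (\<forall>X\<in>obj C. \<forall>\<xi>\<in>hom_dual C M X. h \<cdot> (i M X \<cdot> cpunit cp (hom_dual C M X) X \<xi>) = k X \<xi>)"
      if "M \<in> obj C" "Z \<in> obj C" "dual_family C M Z k" for M Z k
      using dual_coend_universal[OF N that] ij[OF that(1)] by simp
    show "farr N f \<cdot> (i M X \<cdot> cpunit cp (hom_dual C M X) X \<xi>) =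
        i M' X \<cdot> cpunit cp (hom_dual C M' X) X (hom_transpose C M' X (\<lambda>g. g \<cdot> f) \<xi>)"
      if "f \<in> hom C M M'" "X \<in> obj C" "\<xi> \<in> hom_dual C M X" for M M' f X \<xi>
      using dual_coend_natural[OF N that] ij[OF hom_objs(1)[OF that(1)] that(2,3)]
        ij[OF hom_objs(2)[OF that(1)] that(2) dual_transport_pre[OF that(1,3)]] by simp
  qed
  then show ?thesis
    using nakayama_coend_iff_dual_coend[where i=i, OF fin cp dual_coend_functor[OF N] i] by blast
qed

lemma dual_coend_ext:
  assumes N: "dual_coend C N j" and M: "M \<in> obj C"
    and h: "h \<in> hom C (fobj N M) Z" "h' \<in> hom C (fobj N M) Z"
    and eq: "\<And>X \<xi>. X \<in> obj C \<Longrightarrow> \<xi> \<in> hom_dual C M X \<Longrightarrow> h \<cdot> j M X \<xi> = h' \<cdot> j M X \<xi>"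
  shows "h = h'"
proof -
  have j: "dual_family C M (fobj N M) (j M)" using N M unfolding dual_coend_def by blast
  have "dual_family C M Z (\<lambda>X \<xi>. h \<cdot> j M X \<xi>)" unfolding dual_family_def
  proof (intro conjI ballI allI impI)
    fix X assume "X \<in> obj C"
    then show "linear_into_hom C (hom_dual C M X) X Z (\<lambda>\<xi>. h \<cdot> j M X \<xi>)"
      using linear_into_hom_post[OF _ h(1)] j unfolding dual_family_def by blast
  next
    fix X X' g \<xi> assume g: "g \<in> hom C X X'" and \<xi>: "\<xi> \<in> hom_dual C M X'"
    show "h \<cdot> j M X (hom_transpose C M X (\<lambda>f. g \<cdot> f) \<xi>) = (h \<cdot> j M X' \<xi>) \<cdot> g"
      using cmp_assoc[OF g dual_family_hom[OF j hom_objs(2)[OF g] \<xi>] h(1)] j g \<xi>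
      unfolding dual_family_def by simp
  qed
  then have "\<exists>!u. u \<in> hom C (fobj N M) Z \<and>
      (\<forall>X\<in>obj C. \<forall>\<xi>\<in>hom_dual C M X. u \<cdot> j M X \<xi> = h \<cdot> j M X \<xi>)"
    using N M hom_objs(2)[OF h(1)] unfolding dual_coend_def by blast
  then show ?thesis using h eq by metis
qed

lemma dual_coend_unique:
  assumes N: "dual_coend C N j" and N': "dual_coend C N' j'"
  shows "nat_isomorphic C C N N'"
proof -
  have comparison: "\<exists>\<alpha>. \<forall>M\<in>obj C. \<alpha> M \<in> hom C (fobj N M) (fobj N' M) \<and>
      (\<forall>X\<in>obj C. \<forall>\<xi>\<in>hom_dual C M X. \<alpha> M \<cdot> j M X \<xi> = j' M X \<xi>)"
    if "dual_coend C N j" "dual_coend C N' j'" for N j N' j'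
  proof (intro bchoice ballI)
    fix M assume M: "M \<in> obj C"
    show "\<exists>a. a \<in> hom C (fobj N M) (fobj N' M) \<and>
        (\<forall>X\<in>obj C. \<forall>\<xi>\<in>hom_dual C M X. a \<cdot> j M X \<xi> = j' M X \<xi>)"
      using dual_coend_universal[OF that(1) M dual_coend_obj[OF that(2) M] dual_coend_family[OF that(2) M]]
      by blast
  qed
  obtain \<alpha> where \<alpha>: "\<And>M. M \<in> obj C \<Longrightarrow> \<alpha> M \<in> hom C (fobj N M) (fobj N' M)"
    "\<And>M X \<xi>. M \<in> obj C \<Longrightarrow> X \<in> obj C \<Longrightarrow> \<xi> \<in> hom_dual C M X \<Longrightarrow> \<alpha> M \<cdot> j M X \<xi> = j' M X \<xi>"
    using comparison[OF N N'] by blast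
  obtain \<beta> where \<beta>: "\<And>M. M \<in> obj C \<Longrightarrow> \<beta> M \<in> hom C (fobj N' M) (fobj N M)"
    "\<And>M X \<xi>. M \<in> obj C \<Longrightarrow> X \<in> obj C \<Longrightarrow> \<xi> \<in> hom_dual C M X \<Longrightarrow> \<beta> M \<cdot> j' M X \<xi> = j M X \<xi>"
    using comparison[OF N' N] by blast
  have jh: "j M X \<xi> \<in> hom C X (fobj N M)" "j' M X \<xi> \<in> hom C X (fobj N' M)"
    if "M \<in> obj C" "X \<in> obj C" "\<xi> \<in> hom_dual C M X" for M X \<xi>
    using dual_family_hom[OF dual_coend_family[OF N]] dual_family_hom[OF dual_coend_family[OF N']] that
    by blast+
  note NF = dual_coend_functor[OF N] dual_coend_functor[OF N']
  have ob: "fobj N M \<in> obj C" "fobj N' M \<in> obj C" if "M \<in> obj C" for M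
    using dual_coend_obj[OF N that] dual_coend_obj[OF N' that] .
  have inv: "\<beta> M \<cdot> \<alpha> M = ide C (fobj N M)" if M: "M \<in> obj C" for M
  proof (rule dual_coend_ext[OF N M cmp_hom[OF \<alpha>(1)[OF M] \<beta>(1)[OF M]] ide_hom[OF ob(1)[OF M]]])
    fix X \<xi> assume X: "X \<in> obj C" "\<xi> \<in> hom_dual C M X"
    show "(\<beta> M \<cdot> \<alpha> M) \<cdot> j M X \<xi> = ide C (fobj N M) \<cdot> j M X \<xi>"
      using cmp_assoc[OF jh(1)[OF M X] \<alpha>(1)[OF M] \<beta>(1)[OF M]] \<alpha>(2)[OF M X] \<beta>(2)[OF M X]
        cmp_ide_left[OF jh(1)[OF M X]] by simp
  qed
  have inv': "\<alpha> M \<cdot> \<beta> M = ide C (fobj N' M)" if M: "M \<in> obj C" for M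
  proof (rule dual_coend_ext[OF N' M cmp_hom[OF \<beta>(1)[OF M] \<alpha>(1)[OF M]] ide_hom[OF ob(2)[OF M]]])
    fix X \<xi> assume X: "X \<in> obj C" "\<xi> \<in> hom_dual C M X"
    show "(\<alpha> M \<cdot> \<beta> M) \<cdot> j' M X \<xi> = ide C (fobj N' M) \<cdot> j' M X \<xi>"
      using cmp_assoc[OF jh(2)[OF M X] \<beta>(1)[OF M] \<alpha>(1)[OF M]] \<alpha>(2)[OF M X] \<beta>(2)[OF M X]
        cmp_ide_left[OF jh(2)[OF M X]] by simp
  qed
  have iso: "is_iso C (\<alpha> M)" if M: "M \<in> obj C" for M
    unfolding is_iso_def inverse_arrows_def
    using \<alpha>(1)[OF M] \<beta>(1)[OF M] inv[OF M] inv'[OF M]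
    by (intro exI[of _ "\<beta> M"]) (auto simp: hom_def)
  have nat: "\<alpha> M' \<cdot> farr N f = farr N' f \<cdot> \<alpha> M" if f: "f \<in> hom C M M'" for M M' f
  proof -
    note M = hom_objs[OF f]
    have Nf: "farr N f \<in> hom C (fobj N M) (fobj N M')" "farr N' f \<in> hom C (fobj N' M) (fobj N' M')"
      using dual_coend_arr[OF N f] dual_coend_arr[OF N' f] .
    show ?thesis
    proof (rule dual_coend_ext[OF N M(1) cmp_hom[OF Nf(1) \<alpha>(1)[OF M(2)]] cmp_hom[OF \<alpha>(1)[OF M(1)] Nf(2)]])
      fix X \<xi> assume X: "X \<in> obj C" "\<xi> \<in> hom_dual C M X"
      let ?\<xi>' = "hom_transpose C M' X (\<lambda>g. g \<cdot> f) \<xi>"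
      have "(\<alpha> M' \<cdot> farr N f) \<cdot> j M X \<xi> = \<alpha> M' \<cdot> (farr N f \<cdot> j M X \<xi>)"
        by (rule cmp_assoc[OF jh(1)[OF M(1) X] Nf(1) \<alpha>(1)[OF M(2)]])
      also have "farr N f \<cdot> j M X \<xi> = j M' X ?\<xi>'"
        by (rule dual_coend_natural[OF N f X])
      also have "\<alpha> M' \<cdot> \<dots> = j' M' X ?\<xi>'" by (rule \<alpha>(2)[OF M(2) X(1) dual_transport_pre[OF f X(2)]])
      also have "\<dots> = farr N' f \<cdot> j' M X \<xi>" by (rule dual_coend_natural[OF N' f X, symmetric])
      also have "\<dots> = farr N' f \<cdot> (\<alpha> M \<cdot> j M X \<xi>)" using \<alpha>(2)[OF M(1) X] by simp
      also have "\<dots> = (farr N' f \<cdot> \<alpha> M) \<cdot> j M X \<xi>"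
        by (rule cmp_assoc[OF jh(1)[OF M(1) X] \<alpha>(1)[OF M(1)] Nf(2), symmetric])
      finally show "(\<alpha> M' \<cdot> farr N f) \<cdot> j M X \<xi> = (farr N' f \<cdot> \<alpha> M) \<cdot> j M X \<xi>" .
    qed
  qed
  show ?thesis unfolding nat_isomorphic_def using NF \<alpha>(1) iso nat by blast
qed

end

section \<open>Calculus of components in a module category\<close>

context linear_category
begin

lemma arr_hom: "f \<in> arr C \<Longrightarrow> f \<in> hom C (src C f) (tgt C f)"
  by (simp add: hom_def)

lemma homD: "f \<in> hom C X Y \<Longrightarrow> f \<in> arr C" "f \<in> hom C X Y \<Longrightarrow> src C f = X" "f \<in> hom C X Y \<Longrightarrow> tgt C f = Y"
  by (simp_all add: hom_def)

lemma homI: "f \<in> arr C \<Longrightarrow> src C f = X \<Longrightarrow> tgt C f = Y \<Longrightarrow> f \<in> hom C X Y"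
  by (simp add: hom_def)

lemma typing:
  "f \<in> arr C \<Longrightarrow> g \<in> arr C \<Longrightarrow> src C g = tgt C f \<Longrightarrow> g \<cdot> f \<in> arr C"
  "f \<in> arr C \<Longrightarrow> g \<in> arr C \<Longrightarrow> src C g = tgt C f \<Longrightarrow> src C (g \<cdot> f) = src C f"
  "f \<in> arr C \<Longrightarrow> g \<in> arr C \<Longrightarrow> src C g = tgt C f \<Longrightarrow> tgt C (g \<cdot> f) = tgt C g"
  "X \<in> obj C \<Longrightarrow> ide C X \<in> arr C"
  "X \<in> obj C \<Longrightarrow> src C (ide C X) = X"
  "X \<in> obj C \<Longrightarrow> tgt C (ide C X) = X"
  using cmp_hom[of f "src C f" "tgt C f" g "tgt C g"] ide_hom[of X] by (auto simp: hom_def)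

lemma assoc: "f \<in> arr C \<Longrightarrow> g \<in> arr C \<Longrightarrow> h \<in> arr C \<Longrightarrow> src C g = tgt C f \<Longrightarrow> src C h = tgt C g \<Longrightarrow>
    (h \<cdot> g) \<cdot> f = h \<cdot> (g \<cdot> f)"
  by (rule cmp_assoc[of _ "src C f" "tgt C f" _ "tgt C g" _ "tgt C h"]) (auto simp: hom_def)

lemma ide_cmp: "f \<in> arr C \<Longrightarrow> tgt C f = X \<Longrightarrow> ide C X \<cdot> f = f"
  "f \<in> arr C \<Longrightarrow> src C f = X \<Longrightarrow> f \<cdot> ide C X = f"
  using cmp_ide_left[OF arr_hom] cmp_ide_right[OF arr_hom] by auto

end

context strict_monoidal_linear_category
begin

lemma tensor_typing:
  "f \<in> arr C \<Longrightarrow> g \<in> arr C \<Longrightarrow> f \<otimes> g \<in> arr C"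
  "f \<in> arr C \<Longrightarrow> g \<in> arr C \<Longrightarrow> src C (f \<otimes> g) = src C f \<otimes>\<^sub>o src C g"
  "f \<in> arr C \<Longrightarrow> g \<in> arr C \<Longrightarrow> tgt C (f \<otimes> g) = tgt C f \<otimes>\<^sub>o tgt C g"
  using tarr_hom[OF arr_hom arr_hom] by (auto simp: hom_def)

end

context strict_rigid_linear_category
begin

lemma dual_typing:
  "X \<in> obj C \<Longrightarrow> ev C X \<in> arr C" "X \<in> obj C \<Longrightarrow> src C (ev C X) = ldual C X \<otimes>\<^sub>o X"
  "X \<in> obj C \<Longrightarrow> tgt C (ev C X) = one C"
  "X \<in> obj C \<Longrightarrow> coev C X \<in> arr C" "X \<in> obj C \<Longrightarrow> src C (coev C X) = one C"
  "X \<in> obj C \<Longrightarrow> tgt C (coev C X) = X \<otimes>\<^sub>o ldual C X"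
  "X \<in> obj C \<Longrightarrow> evr C X \<in> arr C" "X \<in> obj C \<Longrightarrow> src C (evr C X) = X \<otimes>\<^sub>o rdual C X"
  "X \<in> obj C \<Longrightarrow> tgt C (evr C X) = one C"
  "X \<in> obj C \<Longrightarrow> coevr C X \<in> arr C" "X \<in> obj C \<Longrightarrow> src C (coevr C X) = one C"
  "X \<in> obj C \<Longrightarrow> tgt C (coevr C X) = rdual C X \<otimes>\<^sub>o X"
  using ev_hom coev_hom evr_hom coevr_hom by (auto simp: hom_def)

lemma ldual_arr_typing:
  assumes "f \<in> arr C"
  shows "ldual_arr C f \<in> arr C" "src C (ldual_arr C f) = ldual C (tgt C f)"
    "tgt C (ldual_arr C f) = ldual C (src C f)"
  using assms src_obj[OF assms] tgt_obj[OF assms]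
  by (simp_all add: ldual_arr_def Let_def typing tensor_typing dual_typing ldual_obj tobj_obj tobj_one tobj_assoc one_obj)

end

text \<open>
  A string diagram in \<open>C\<close>, acting on an object of \<open>\<M>\<close>, is a composite of arrows
  \<open>X\<^sub>1 \<rhd> \<dots> \<rhd> X\<^sub>n \<rhd> (f \<star> M)\<close>, where \<open>X \<rhd> -\<close> is the functor given by \<open>X\<close> and \<open>f \<star> M\<close> is the
  component at \<open>M\<close> of the natural transformation given by \<open>f\<close>.  Wires to the right of \<open>f\<close> are absorbed into \<open>M\<close>,
  and the interchange law becomes naturality.  The rules collected in \<open>calc\<close> bring every
  expression into this form, with composition nested to the right; sources and targets are computed
  instead of being matched, so that the typing conditions can be discharged by the simplifier.
\<close>

context finite_module_category
begin

abbreviation comp (infixr "\<bullet>" 65) where "g \<bullet> f \<equiv> g \<cdot>\<^bsub>\<M>\<^esub> f"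
abbreviation whisker (infixr "\<rhd>" 70) where "X \<rhd> h \<equiv> ide C X \<triangleright>\<^bsub>\<M>\<^esub> h"
abbreviation component (infixr "\<star>" 70) where "f \<star> M \<equiv> f \<triangleright>\<^bsub>\<M>\<^esub> ide \<M> M"
abbreviation act (infixr "\<odot>" 70) where "X \<odot> M \<equiv> X \<triangleright>\<^sub>o\<^bsub>\<M>\<^esub> M"

lemma act_typing:
  "f \<in> arr C \<Longrightarrow> h \<in> arr \<M> \<Longrightarrow> f \<triangleright>\<^bsub>\<M>\<^esub> h \<in> arr \<M>"
  "f \<in> arr C \<Longrightarrow> h \<in> arr \<M> \<Longrightarrow> src \<M> (f \<triangleright>\<^bsub>\<M>\<^esub> h) = src C f \<odot> src \<M> h"
  "f \<in> arr C \<Longrightarrow> h \<in> arr \<M> \<Longrightarrow> tgt \<M> (f \<triangleright>\<^bsub>\<M>\<^esub> h) = tgt C f \<odot> tgt \<M> h"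
  using act_hom[OF C.arr_hom M.arr_hom] by (auto simp: hom_def)

lemmas objects = C.tobj_obj C.one_obj C.ldual_obj C.rdual_obj act_obj C.src_obj C.tgt_obj M.src_obj M.tgt_obj
  C.tobj_one C.tobj_assoc act_obj_tobj act_obj_one C.ldual_one C.rdual_one C.rdual_ldual

lemmas types = M.typing C.typing C.tensor_typing C.dual_typing C.ldual_arr_typing act_typing

lemma whisker_comp:
  "X \<in> obj C \<Longrightarrow> f \<in> arr \<M> \<Longrightarrow> g \<in> arr \<M> \<Longrightarrow> src \<M> g = tgt \<M> f \<Longrightarrow> X \<rhd> (g \<bullet> f) = (X \<rhd> g) \<bullet> (X \<rhd> f)"
  using act_cmp[OF C.ide_hom C.ide_hom M.homI M.homI] C.cmp_ide_left[OF C.ide_hom] by metis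

lemma component_comp:
  "M \<in> obj \<M> \<Longrightarrow> f \<in> arr C \<Longrightarrow> g \<in> arr C \<Longrightarrow> src C g = tgt C f \<Longrightarrow>
    (g \<cdot>\<^bsub>C\<^esub> f) \<star> M = (g \<star> M) \<bullet> (f \<star> M)"
  using act_cmp[OF C.homI C.homI M.ide_hom M.ide_hom] M.cmp_ide_left[OF M.ide_hom] by metis

lemma whisker_tensor: "X \<in> obj C \<Longrightarrow> Y \<in> obj C \<Longrightarrow> h \<in> arr \<M> \<Longrightarrow> (X \<otimes>\<^sub>o\<^bsub>C\<^esub> Y) \<rhd> h = X \<rhd> (Y \<rhd> h)"
  by (simp add: C.tarr_ide[symmetric] act_arr_tarr types)

lemma naturality:
  assumes "f \<in> arr C" "h \<in> arr \<M>"
  shows "(f \<star> tgt \<M> h) \<bullet> (src C f \<rhd> h) = (tgt C f \<rhd> h) \<bullet> (f \<star> src \<M> h)"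
proof -
  note f = C.arr_hom[OF assms(1)] and h = M.arr_hom[OF assms(2)]
  note XY = C.hom_objs[OF f] and MN = M.hom_objs[OF h]
  show ?thesis
    using act_cmp[OF C.ide_hom[OF XY(1)] f h M.ide_hom[OF MN(2)]]
      act_cmp[OF f C.ide_hom[OF XY(2)] M.ide_hom[OF MN(1)] h]
    by (simp add: C.cmp_ide_left[OF f] C.cmp_ide_right[OF f] M.cmp_ide_left[OF h] M.cmp_ide_right[OF h])
qed

lemmas calc = objects types M.assoc M.ide_cmp whisker_comp component_comp whisker_tensor
  act_arr_tarr act_ide act_arr_one

text \<open>
  In the normal form, an equation between composites can also occur in front of further factors or under
  functors \<open>X \<rhd> -\<close>.  Combining the next two rules turns it into a rewrite rule for these positions.
\<close>

lemma precomp: "g \<bullet> f = k \<Longrightarrow> f \<in> arr \<M> \<Longrightarrow> g \<in> arr \<M> \<Longrightarrow> x \<in> arr \<M> \<Longrightarrow> src \<M> g = tgt \<M> f \<Longrightarrow>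
    src \<M> f = tgt \<M> x \<Longrightarrow> g \<bullet> (f \<bullet> x) = k \<bullet> x"
  by (metis M.assoc)

lemma whisk: "g \<bullet> f = k \<Longrightarrow> f \<in> arr \<M> \<Longrightarrow> g \<in> arr \<M> \<Longrightarrow> src \<M> g = tgt \<M> f \<Longrightarrow> X \<in> obj C \<Longrightarrow>
   (X \<rhd> g) \<bullet> (X \<rhd> f) = X \<rhd> k"
  by (metis whisker_comp)

lemma ev_zigzag:
  assumes "X \<in> obj C" "M \<in> obj \<M>"
  shows "(X \<rhd> (ev C X \<star> M)) \<bullet> (coev C X \<star> (X \<odot> M)) = ide \<M> (X \<odot> M)"
    "(ev C X \<star> (ldual C X \<odot> M)) \<bullet> (ldual C X \<rhd> (coev C X \<star> M)) = ide \<M> (ldual C X \<odot> M)"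
    "(evr C X \<star> (X \<odot> M)) \<bullet> (X \<rhd> (coevr C X \<star> M)) = ide \<M> (X \<odot> M)"
    "(rdual C X \<rhd> (evr C X \<star> M)) \<bullet> (coevr C X \<star> (rdual C X \<odot> M)) = ide \<M> (rdual C X \<odot> M)"
  using arg_cong[OF C.ldual_zigzag1[OF assms(1)], of "\<lambda>f. f \<star> M"]
    arg_cong[OF C.ldual_zigzag2[OF assms(1)], of "\<lambda>f. f \<star> M"]
    arg_cong[OF C.rdual_zigzag1[OF assms(1)], of "\<lambda>f. f \<star> M"]
    arg_cong[OF C.rdual_zigzag2[OF assms(1)], of "\<lambda>f. f \<star> M"] assms
  by (simp_all add: calc)

lemma ldual_arr_component:
  assumes "f \<in> hom C X Y" "M \<in> obj \<M>"
  shows "ldual_arr C f \<star> M = (ev C Y \<star> (ldual C X \<odot> M)) \<bullet> (ldual C Y \<rhd> (f \<star> (ldual C X \<odot> M))) \<bullet>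
    (ldual C Y \<rhd> (coev C X \<star> M))"
  using C.homD[OF assms(1)] C.hom_objs[OF assms(1)] assms(2)
  by (simp add: ldual_arr_def Let_def calc)

text \<open>
  Sliding an arrow around an evaluation or a coevaluation turns it into its transpose.
\<close>

lemma dual_ev:
  assumes f: "f \<in> hom C X Y" and M: "M \<in> obj \<M>"
  shows "(ev C X \<star> M) \<bullet> (ldual_arr C f \<star> (X \<odot> M)) = (ev C Y \<star> M) \<bullet> (ldual C Y \<rhd> (f \<star> M))"
proof -
  note [simp] = calc C.homD[OF f] C.hom_objs[OF f] M
  have n1: "(ev C X \<star> M) \<bullet> (ev C Y \<star> (ldual C X \<odot> X \<odot> M)) =
      (ev C Y \<star> M) \<bullet> (ldual C Y \<rhd> (Y \<rhd> (ev C X \<star> M)))"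
    using naturality[of "ev C Y" "ev C X \<star> M"] by simp
  have n2: "(Y \<rhd> (ev C X \<star> M)) \<bullet> (f \<star> (ldual C X \<odot> X \<odot> M)) = (f \<star> M) \<bullet> (X \<rhd> (ev C X \<star> M))"
    using naturality[of f "ev C X \<star> M"] by simp
  show ?thesis
    using ev_zigzag(1)[of X M]
    by (simp add: ldual_arr_component[OF f] precomp[OF n1] precomp[OF whisk[OF n2]] whisk[OF ev_zigzag(1)])
qed

lemma dual_coev:
  assumes f: "f \<in> hom C X Y" and M: "M \<in> obj \<M>"
  shows "(f \<star> (ldual C X \<odot> M)) \<bullet> (coev C X \<star> M) = (Y \<rhd> (ldual_arr C f \<star> M)) \<bullet> (coev C Y \<star> M)"
proof -
  note [simp] = calc C.homD[OF f] C.hom_objs[OF f] M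
  note n1 = naturality[of "coev C Y" "coev C X \<star> M", simplified]
  note n2 = naturality[of "coev C Y" "f \<star> (ldual C X \<odot> M)", simplified]
  show ?thesis
    by (simp add: ldual_arr_component[OF f] n1[symmetric] precomp[OF n2[symmetric]] precomp[OF ev_zigzag(1)])
qed

end

section \<open>Modules over the double dual of an algebra\<close>

lemma alg_module_iff:
  "(M, a) \<in> obj (alg_module_cat C \<M> B) \<longleftrightarrow> M \<in> obj \<M> \<and>
     a \<in> hom \<M> (aobj B \<triangleright>\<^sub>o\<^bsub>\<M>\<^esub> M) M \<and>
     a \<cdot>\<^bsub>\<M>\<^esub> (ide C (aobj B) \<triangleright>\<^bsub>\<M>\<^esub> a) = a \<cdot>\<^bsub>\<M>\<^esub> (amul B \<triangleright>\<^bsub>\<M>\<^esub> ide \<M> M) \<and>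
     a \<cdot>\<^bsub>\<M>\<^esub> (aone B \<triangleright>\<^bsub>\<M>\<^esub> ide \<M> M) = ide \<M> M"
  by (auto simp: alg_module_cat_def monad_module_cat_def monad_module_def act_func_def)

lemma alg_module_hom_iff:
  "(p, f, q) \<in> hom (alg_module_cat C \<M> B) p' q' \<longleftrightarrow> p = p' \<and> q = q' \<and>
     p \<in> obj (alg_module_cat C \<M> B) \<and> q \<in> obj (alg_module_cat C \<M> B) \<and>
     f \<in> hom \<M> (fst p) (fst q) \<and>
     f \<cdot>\<^bsub>\<M>\<^esub> snd p = snd q \<cdot>\<^bsub>\<M>\<^esub> (ide C (aobj B) \<triangleright>\<^bsub>\<M>\<^esub> f)"
  by (auto simp: hom_def alg_module_cat_def monad_module_cat_def monad_module_arrow_def act_func_def)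

locale module_category_with_algebra = finite_module_category C \<M>
  for C :: "('c, 'd, 'k::field, 'z) moncat_scheme"
    and \<M> :: "('c, 'd, 'o, 'm, 'k, 'y) modcat_scheme" +
  fixes A :: "('c, 'd) algebra_in"
  assumes algebra: "is_algebra C A"
begin

abbreviation "\<A> \<equiv> aobj A"
abbreviation "dA \<equiv> ldual C (aobj A)"
abbreviation "ddA \<equiv> ldual C (ldual C (aobj A))"
abbreviation "mul \<equiv> amul A"
abbreviation "un \<equiv> aone A"
abbreviation "dmul \<equiv> ldual_arr C (amul A)"
abbreviation "dun \<equiv> ldual_arr C (aone A)"
abbreviation "ddmul \<equiv> ldual_arr C (ldual_arr C (amul A))"
abbreviation "ddun \<equiv> ldual_arr C (ldual_arr C (aone A))"

lemma algebra_typing [simp]: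
  "\<A> \<in> obj C" "mul \<in> arr C" "src C mul = \<A> \<otimes>\<^sub>o\<^bsub>C\<^esub> \<A>" "tgt C mul = \<A>"
  "un \<in> arr C" "src C un = one C" "tgt C un = \<A>"
  using algebra by (auto simp: is_algebra_def hom_def)

lemma dmul_hom: "dmul \<in> hom C dA (dA \<otimes>\<^sub>o\<^bsub>C\<^esub> dA)" and dun_hom: "dun \<in> hom C dA (one C)"
  by (auto intro!: C.homI simp: calc C.ldual_tobj)

lemma ddmul_hom: "ddmul \<in> hom C (ddA \<otimes>\<^sub>o\<^bsub>C\<^esub> ddA) ddA" and ddun_hom: "ddun \<in> hom C (one C) ddA"
  by (auto intro!: C.homI simp: calc C.ldual_tobj)

lemmas alg_calc = calc C.homD[OF dmul_hom] C.homD[OF dun_hom] C.homD[OF ddmul_hom] C.homD[OF ddun_hom]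

lemma algebra_laws:
  "mul \<cdot>\<^bsub>C\<^esub> (mul \<otimes>\<^bsub>C\<^esub> ide C \<A>) = mul \<cdot>\<^bsub>C\<^esub> (ide C \<A> \<otimes>\<^bsub>C\<^esub> mul)"
  "mul \<cdot>\<^bsub>C\<^esub> (un \<otimes>\<^bsub>C\<^esub> ide C \<A>) = ide C \<A>"
  "mul \<cdot>\<^bsub>C\<^esub> (ide C \<A> \<otimes>\<^bsub>C\<^esub> un) = ide C \<A>"
  using algebra by (simp_all add: is_algebra_def)

lemma mul_assoc: "M \<in> obj \<M> \<Longrightarrow> (mul \<star> M) \<bullet> (\<A> \<rhd> (mul \<star> M)) = (mul \<star> M) \<bullet> (mul \<star> (\<A> \<odot> M))"
  using arg_cong[OF algebra_laws(1), of "\<lambda>f. f \<star> M"] by (simp add: calc)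

lemma mul_unit:
  assumes "M \<in> obj \<M>"
  shows "(mul \<star> M) \<bullet> (un \<star> (\<A> \<odot> M)) = ide \<M> (\<A> \<odot> M)"
    "(mul \<star> M) \<bullet> (\<A> \<rhd> (un \<star> M)) = ide \<M> (\<A> \<odot> M)"
  using arg_cong[OF algebra_laws(2), of "\<lambda>f. f \<star> M"] arg_cong[OF algebra_laws(3), of "\<lambda>f. f \<star> M"] assms
  by (simp_all add: calc)

abbreviation Mod where "Mod \<equiv> alg_module_cat C \<M> A"
abbreviation ddMod where "ddMod \<equiv> alg_module_cat C \<M> (lldual_algebra C A)"

lemma lldual_algebra_simps: "aobj (lldual_algebra C A) = ddA" "amul (lldual_algebra C A) = ddmul"
  "aone (lldual_algebra C A) = ddun"
  by (simp_all add: lldual_algebra_def)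

lemma ModD:
  assumes "(M, a) \<in> obj Mod"
  shows "M \<in> obj \<M>" "a \<in> arr \<M>" "src \<M> a = \<A> \<odot> M" "tgt \<M> a = M"
    "a \<bullet> (\<A> \<rhd> a) = a \<bullet> (mul \<star> M)" "a \<bullet> (un \<star> M) = ide \<M> M"
  using assms by (auto simp: alg_module_iff hom_def)

lemma ModI:
  assumes "M \<in> obj \<M>" "a \<in> arr \<M>" "src \<M> a = \<A> \<odot> M" "tgt \<M> a = M"
    "a \<bullet> (\<A> \<rhd> a) = a \<bullet> (mul \<star> M)" "a \<bullet> (un \<star> M) = ide \<M> M"
  shows "(M, a) \<in> obj Mod"
  using assms by (auto simp: alg_module_iff hom_def)

lemma ddModD:
  assumes "(M, a) \<in> obj ddMod"
  shows "M \<in> obj \<M>" "a \<in> arr \<M>" "src \<M> a = ddA \<odot> M" "tgt \<M> a = M"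
    "a \<bullet> (ddA \<rhd> a) = a \<bullet> (ddmul \<star> M)" "a \<bullet> (ddun \<star> M) = ide \<M> M"
  using assms by (auto simp: alg_module_iff hom_def lldual_algebra_simps)

lemma ddModI:
  assumes "M \<in> obj \<M>" "a \<in> arr \<M>" "src \<M> a = ddA \<odot> M" "tgt \<M> a = M"
    "a \<bullet> (ddA \<rhd> a) = a \<bullet> (ddmul \<star> M)" "a \<bullet> (ddun \<star> M) = ide \<M> M"
  shows "(M, a) \<in> obj ddMod"
  using assms by (auto simp: alg_module_iff hom_def lldual_algebra_simps)

text \<open>
  As \<open>A\<^sup>\<or>\<^sup>\<or> \<triangleright> -\<close> is left adjoint to \<open>A\<^sup>\<or> \<triangleright> -\<close>, an action of \<open>A\<^sup>\<or>\<^sup>\<or>\<close> amounts to a coaction of the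
  coalgebra \<open>A\<^sup>\<or>\<close>, whose structure arrows are the transposes \<open>dmul\<close> and \<open>dun\<close>.  The computations below use
  coactions, which avoids double transposes.
\<close>

definition coaction :: "'o \<Rightarrow> 'm \<Rightarrow> 'm" where
  "coaction M a = (dA \<rhd> a) \<bullet> (coev C dA \<star> M)"

lemma coaction_typing:
  assumes "(M, a) \<in> obj ddMod"
  shows "coaction M a \<in> arr \<M>" "src \<M> (coaction M a) = M" "tgt \<M> (coaction M a) = dA \<odot> M"
  using ddModD[OF assms] by (simp_all add: coaction_def calc)

lemma coaction_comodule:
  assumes a: "(M, a) \<in> obj ddMod"
  shows "(dA \<rhd> coaction M a) \<bullet> coaction M a = (dmul \<star> M) \<bullet> coaction M a"
    and "(dun \<star> M) \<bullet> coaction M a = ide \<M> M"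
proof -
  note [simp] = alg_calc
  note a' [simp] = ddModD(1-4)[OF a]
  note c = dual_coev[OF dmul_hom a'(1), simplified]
  note n1 = naturality[of "coev C dA" a, simplified]
  note n2 = naturality[of dmul a, simplified]
  note n3 = naturality[of dun a, simplified]
  have cc: "coev C (dA \<otimes>\<^sub>o\<^bsub>C\<^esub> dA) \<star> M = (dA \<rhd> (coev C dA \<star> (ddA \<odot> M))) \<bullet> (coev C dA \<star> M)"
    by (simp add: C.coev_tobj)
  show "(dA \<rhd> coaction M a) \<bullet> coaction M a = (dmul \<star> M) \<bullet> coaction M a"
    unfolding coaction_def
    by (simp add: precomp[OF n2] c cc precomp[OF whisk[OF n1]] whisk[OF n1] precomp[OF whisk[OF whisk[OF ddModD(5)[OF a]]]])
  note d = dual_coev[OF dun_hom a'(1), simplified]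
  show "(dun \<star> M) \<bullet> coaction M a = ide \<M> M"
    unfolding coaction_def
    by (simp add: precomp[OF n3] d C.coev_one ddModD(6)[OF a])
qed

lemma comodule_imp_module:
  assumes N: "N \<in> obj \<M>" and b: "b \<in> arr \<M>" "src \<M> b = N" "tgt \<M> b = dA \<odot> N"
    and coassoc: "(dA \<rhd> b) \<bullet> b = (dmul \<star> N) \<bullet> b" and counit: "(dun \<star> N) \<bullet> b = ide \<M> N"
  defines "a \<equiv> (ev C dA \<star> N) \<bullet> (ddA \<rhd> b)"
  shows "(N, a) \<in> obj ddMod" and "coaction N a = b"
proof -
  note [simp] = alg_calc N b
  note n1 = naturality[of "ev C dA" b, simplified]
  note n2 = naturality[of ddmul b, simplified]
  note n3 = naturality[of ddun b, simplified]
  note n4 = naturality[of "coev C dA" b, simplified]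
  note e = dual_ev[OF dmul_hom N, simplified]
  note e1 = dual_ev[OF dun_hom N, simplified]
  have ee: "ev C (dA \<otimes>\<^sub>o\<^bsub>C\<^esub> dA) \<star> N = (ev C dA \<star> N) \<bullet> (ddA \<rhd> (ev C dA \<star> (dA \<odot> N)))"
    by (simp add: C.ev_tobj)
  have a_types [simp]: "a \<in> arr \<M>" "src \<M> a = ddA \<odot> N" "tgt \<M> a = N" by (simp_all add: a_def)
  show "(N, a) \<in> obj ddMod"
  proof (rule ddModI)
    show "a \<bullet> (ddA \<rhd> a) = a \<bullet> (ddmul \<star> N)"
      unfolding a_def
      by (simp add: n2[symmetric] precomp[OF e] ee C.ldual_tobj precomp[OF whisk[OF n1[symmetric]]] whisk[OF whisk[OF coassoc]])
    show "a \<bullet> (ddun \<star> N) = ide \<M> N"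
      unfolding a_def by (simp add: n3[symmetric] precomp[OF e1] C.ev_one counit)
  qed simp_all
  show "coaction N a = b"
    unfolding coaction_def a_def by (simp add: n4[symmetric] precomp[OF ev_zigzag(1)])
qed

end

section \<open>The Frobenius copairing\<close>

text \<open>
  Since \<open>\<phi>\<close> is invertible, the duality between \<open>A\<^sup>\<or>\<close> and \<open>A\<close> can be transported to \<open>I\<^sup>\<or> \<otimes> A\<close>: it
  becomes the pairing \<open>\<kappa>\<close> with copairing \<open>\<delta>\<close>.  The counit \<open>\<epsilon>\<close> is the Frobenius trace, read as an arrow
  \<open>I\<^sup>\<or> \<otimes> A \<rightarrow> 1\<close>.
\<close>

locale frobenius_algebra = module_category_with_algebra C \<M> A
  for C :: "('c, 'd, 'k::field, 'z) moncat_scheme"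
    and \<M> :: "('c, 'd, 'o, 'm, 'k, 'y) modcat_scheme"
    and A :: "('c, 'd) algebra_in" +
  fixes I :: 'c and l :: 'd
  assumes I_obj [simp]: "I \<in> obj C" and trace: "frobenius_trace C I A l"
begin

abbreviation "dI \<equiv> ldual C I"
abbreviation "\<phi> \<equiv> frobenius_map C I A l"
abbreviation "\<psi> \<equiv> inv_arr C (frobenius_map C I A l)"

lemma l_typing [simp]: "l \<in> arr C" "src C l = \<A>" "tgt C l = I"
  using trace by (auto simp: frobenius_trace_def hom_def)

lemma phi_hom: "\<phi> \<in> hom C (dI \<otimes>\<^sub>o\<^bsub>C\<^esub> \<A>) dA"
  by (rule C.homI) (simp_all add: frobenius_map_def Let_def calc)

lemma psi_inverse:
  shows psi_hom: "\<psi> \<in> hom C dA (dI \<otimes>\<^sub>o\<^bsub>C\<^esub> \<A>)"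
    and "\<psi> \<cdot>\<^bsub>C\<^esub> \<phi> = ide C (dI \<otimes>\<^sub>o\<^bsub>C\<^esub> \<A>)" and "\<phi> \<cdot>\<^bsub>C\<^esub> \<psi> = ide C dA"
proof -
  obtain g where g: "inverse_arrows C \<phi> g" using trace by (auto simp: frobenius_trace_def is_iso_def)
  have uniq: "g' = g" if "inverse_arrows C \<phi> g'" for g'
  proof -
    have h: "g \<in> hom C dA (dI \<otimes>\<^sub>o\<^bsub>C\<^esub> \<A>)" "g' \<in> hom C dA (dI \<otimes>\<^sub>o\<^bsub>C\<^esub> \<A>)"
      "g' \<cdot>\<^bsub>C\<^esub> \<phi> = ide C (dI \<otimes>\<^sub>o\<^bsub>C\<^esub> \<A>)" "\<phi> \<cdot>\<^bsub>C\<^esub> g = ide C dA"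
      using g that C.homD[OF phi_hom] by (auto simp: inverse_arrows_def)
    show ?thesis
      using C.cmp_assoc[OF h(1) phi_hom h(2)] h C.cmp_ide_left[OF h(1)] C.cmp_ide_right[OF h(2)] by simp
  qed
  have "inverse_arrows C \<phi> \<psi>"
    unfolding inv_arr_def by (rule theI[of _ g]) (use g uniq in blast)+
  then show "\<psi> \<in> hom C dA (dI \<otimes>\<^sub>o\<^bsub>C\<^esub> \<A>)"
    and "\<psi> \<cdot>\<^bsub>C\<^esub> \<phi> = ide C (dI \<otimes>\<^sub>o\<^bsub>C\<^esub> \<A>)" and "\<phi> \<cdot>\<^bsub>C\<^esub> \<psi> = ide C dA"
    using C.homD[OF phi_hom] by (auto simp: inverse_arrows_def)
qed

lemmas phi_psi_typing [simp] = C.homD[OF phi_hom] C.homD[OF psi_hom]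

lemma phi_psi:
  assumes "M \<in> obj \<M>"
  shows "(\<psi> \<star> M) \<bullet> (\<phi> \<star> M) = ide \<M> (dI \<odot> \<A> \<odot> M)" "(\<phi> \<star> M) \<bullet> (\<psi> \<star> M) = ide \<M> (dA \<odot> M)"
  using arg_cong[OF psi_inverse(2), of "\<lambda>f. f \<star> M"] arg_cong[OF psi_inverse(3), of "\<lambda>f. f \<star> M"] assms
  by (simp_all add: calc)

definition \<kappa> where "\<kappa> = ev C \<A> \<cdot>\<^bsub>C\<^esub> (\<phi> \<otimes>\<^bsub>C\<^esub> ide C \<A>)"
definition \<delta> where "\<delta> = (ide C \<A> \<otimes>\<^bsub>C\<^esub> \<psi>) \<cdot>\<^bsub>C\<^esub> coev C \<A>"
definition \<epsilon> where "\<epsilon> = ev C I \<cdot>\<^bsub>C\<^esub> (ide C dI \<otimes>\<^bsub>C\<^esub> l)"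

lemma pairing_typing [simp]:
  "\<kappa> \<in> arr C" "src C \<kappa> = dI \<otimes>\<^sub>o\<^bsub>C\<^esub> \<A> \<otimes>\<^sub>o\<^bsub>C\<^esub> \<A>" "tgt C \<kappa> = one C"
  "\<delta> \<in> arr C" "src C \<delta> = one C" "tgt C \<delta> = \<A> \<otimes>\<^sub>o\<^bsub>C\<^esub> dI \<otimes>\<^sub>o\<^bsub>C\<^esub> \<A>"
  "\<epsilon> \<in> arr C" "src C \<epsilon> = dI \<otimes>\<^sub>o\<^bsub>C\<^esub> \<A>" "tgt C \<epsilon> = one C"
  by (simp_all add: \<kappa>_def \<delta>_def \<epsilon>_def calc)

lemma pairing_components:
  assumes "M \<in> obj \<M>"
  shows "\<kappa> \<star> M = (ev C \<A> \<star> M) \<bullet> (\<phi> \<star> (\<A> \<odot> M))"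
    "\<delta> \<star> M = (\<A> \<rhd> (\<psi> \<star> M)) \<bullet> (coev C \<A> \<star> M)"
    "\<epsilon> \<star> M = (ev C I \<star> M) \<bullet> (dI \<rhd> (l \<star> M))"
  using assms by (simp_all add: \<kappa>_def \<delta>_def \<epsilon>_def calc)

text \<open>
  The Frobenius map bends the second leg of the pairing up; the evaluation in \<open>\<kappa>\<close> bends it
  down again.
\<close>

lemma kappa_eq:
  assumes [simp]: "M \<in> obj \<M>"
  shows "\<kappa> \<star> M = (\<epsilon> \<star> M) \<bullet> (dI \<rhd> (mul \<star> M))"
proof -
  note [simp] = alg_calc
  have phi: "\<phi> \<star> N = (ev C I \<star> (dA \<odot> N)) \<bullet> (dI \<rhd> (l \<star> (dA \<odot> N))) \<bullet> (dI \<rhd> (mul \<star> (dA \<odot> N))) \<bullet>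
      (dI \<rhd> (\<A> \<rhd> (coev C \<A> \<star> N)))" if "N \<in> obj \<M>" for N
    using that by (simp add: frobenius_map_def Let_def)
  note n1 = naturality[of "ev C I" "ev C \<A> \<star> M", simplified]
  note n2 = naturality[of l "ev C \<A> \<star> M", simplified]
  note n3 = naturality[of mul "ev C \<A> \<star> M", simplified]
  show ?thesis
    by (simp add: pairing_components phi precomp[OF n1[symmetric]] precomp[OF whisk[OF n2[symmetric]]]
        precomp[OF whisk[OF n3[symmetric]]] whisk[OF whisk[OF ev_zigzag(1)]])
qed

lemma copairing:
  assumes [simp]: "M \<in> obj \<M>"
  shows "(\<A> \<rhd> (\<kappa> \<star> M)) \<bullet> (\<delta> \<star> (\<A> \<odot> M)) = ide \<M> (\<A> \<odot> M)"
    and "(\<kappa> \<star> (dI \<odot> \<A> \<odot> M)) \<bullet> (dI \<rhd> (\<A> \<rhd> (\<delta> \<star> M))) = ide \<M> (dI \<odot> \<A> \<odot> M)"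
proof -
  note [simp] = alg_calc
  show "(\<A> \<rhd> (\<kappa> \<star> M)) \<bullet> (\<delta> \<star> (\<A> \<odot> M)) = ide \<M> (\<A> \<odot> M)"
    by (simp add: pairing_components precomp[OF whisk[OF phi_psi(2)]] ev_zigzag(1))
  note n1 = naturality[of \<phi> "\<A> \<rhd> (\<psi> \<star> M)", simplified]
  note n2 = naturality[of \<phi> "coev C \<A> \<star> M", simplified]
  note n3 = naturality[of "ev C \<A>" "\<psi> \<star> M", simplified]
  show "(\<kappa> \<star> (dI \<odot> \<A> \<odot> M)) \<bullet> (dI \<rhd> (\<A> \<rhd> (\<delta> \<star> M))) = ide \<M> (dI \<odot> \<A> \<odot> M)"
    by (simp add: pairing_components precomp[OF n1] n2 precomp[OF n3] precomp[OF ev_zigzag(2)] phi_psi(1))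
qed

lemma kappa_assoc:
  assumes [simp]: "M \<in> obj \<M>"
  shows "(\<kappa> \<star> M) \<bullet> (dI \<rhd> (mul \<star> (\<A> \<odot> M))) = (\<kappa> \<star> M) \<bullet> (dI \<rhd> (\<A> \<rhd> (mul \<star> M)))"
  by (simp add: kappa_eq alg_calc whisk[OF mul_assoc])

lemma kappa_unit:
  assumes [simp]: "M \<in> obj \<M>"
  shows "(\<kappa> \<star> M) \<bullet> (dI \<rhd> (un \<star> (\<A> \<odot> M))) = \<epsilon> \<star> M"
    and "(\<kappa> \<star> M) \<bullet> (dI \<rhd> (\<A> \<rhd> (un \<star> M))) = \<epsilon> \<star> M"
  by (simp_all add: kappa_eq alg_calc whisk[OF mul_unit(1)] whisk[OF mul_unit(2)])

text \<open>
  Both sides agree because \<open>\<kappa>\<close> is associative: insert the cancelling pair of the copairing \<open>\<delta>\<close> and \<open>\<kappa>\<close> in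
  front of the right side, move the multiplication to the other argument of \<open>\<kappa>\<close>, and cancel the
  other pair.
\<close>

lemma casimir:
  assumes [simp]: "M \<in> obj \<M>"
  shows "(mul \<star> (dI \<odot> \<A> \<odot> M)) \<bullet> (\<A> \<rhd> (\<delta> \<star> M)) = (\<A> \<rhd> (dI \<rhd> (mul \<star> M))) \<bullet> (\<delta> \<star> (\<A> \<odot> M))"
proof -
  note [simp] = alg_calc
  let ?K = "dI \<odot> \<A> \<odot> M"
  note n1 = naturality[of mul "\<delta> \<star> M", simplified]
  note n2 = naturality[of \<delta> "\<A> \<rhd> (\<delta> \<star> M)", simplified]
  note n3 = naturality[of \<delta> "mul \<star> ?K", simplified]
  have "(\<A> \<rhd> (dI \<rhd> (mul \<star> M))) \<bullet> (\<delta> \<star> (\<A> \<odot> M)) =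
      (\<A> \<rhd> (\<kappa> \<star> ?K)) \<bullet> (\<A> \<rhd> (dI \<rhd> (\<A> \<rhd> (\<delta> \<star> M)))) \<bullet> (\<A> \<rhd> (dI \<rhd> (mul \<star> M))) \<bullet> (\<delta> \<star> (\<A> \<odot> M))"
    by (simp add: precomp[OF whisk[OF copairing(2)]])
  also have "\<dots> = (\<A> \<rhd> (\<kappa> \<star> ?K)) \<bullet> (\<A> \<rhd> (dI \<rhd> (mul \<star> (\<A> \<odot> ?K)))) \<bullet>
      (\<A> \<rhd> (dI \<rhd> (\<A> \<rhd> (\<A> \<rhd> (\<delta> \<star> M))))) \<bullet> (\<delta> \<star> (\<A> \<odot> M))"
    by (simp add: precomp[OF whisk[OF whisk[OF n1]]])
  also have "\<dots> = (\<A> \<rhd> (\<kappa> \<star> ?K)) \<bullet> (\<A> \<rhd> (dI \<rhd> (\<A> \<rhd> (mul \<star> ?K)))) \<bullet>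
      (\<A> \<rhd> (dI \<rhd> (\<A> \<rhd> (\<A> \<rhd> (\<delta> \<star> M))))) \<bullet> (\<delta> \<star> (\<A> \<odot> M))"
    by (simp add: precomp[OF whisk[OF kappa_assoc]])
  also have "\<dots> = (mul \<star> ?K) \<bullet> (\<A> \<rhd> (\<delta> \<star> M))"
    by (simp add: n2[symmetric] precomp[OF n3[symmetric]] precomp[OF copairing(1)])
  finally show ?thesis ..
qed

text \<open>
  Through \<open>\<phi>\<close>, the comultiplication of \<open>A\<^sup>\<or>\<close> is the multiplication of \<open>A\<close> with one argument bent.  This is
  associativity of \<open>\<kappa>\<close> once more, because \<open>\<phi>\<close> is \<open>\<kappa>\<close> with one argument bent.
\<close>

lemma dmul_phi:
  assumes [simp]: "M \<in> obj \<M>"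
  shows "(\<phi> \<star> (dA \<odot> M)) \<bullet> (dI \<rhd> (mul \<star> (dA \<odot> M))) \<bullet> (dI \<rhd> (\<A> \<rhd> (coev C \<A> \<star> M))) =
    (dmul \<star> M) \<bullet> (\<phi> \<star> M)"
proof -
  note [simp] = alg_calc
  have mulhom: "mul \<in> hom C (\<A> \<otimes>\<^sub>o\<^bsub>C\<^esub> \<A>) \<A>" by (simp add: hom_def)
  have dm: "dmul \<star> M = (ev C \<A> \<star> (dA \<odot> dA \<odot> M)) \<bullet> (dA \<rhd> (mul \<star> (dA \<odot> dA \<odot> M))) \<bullet>
     (dA \<rhd> (\<A> \<rhd> (coev C \<A> \<star> (dA \<odot> M)))) \<bullet> (dA \<rhd> (coev C \<A> \<star> M))"
    using ldual_arr_component[OF mulhom assms] by (simp add: C.ldual_tobj C.coev_tobj)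
  note n1 = naturality[of \<phi> "coev C \<A> \<star> M", simplified]
  note n2 = naturality[of \<phi> "\<A> \<rhd> (coev C \<A> \<star> (dA \<odot> M))", simplified]
  note n3 = naturality[of \<phi> "mul \<star> (dA \<odot> dA \<odot> M)", simplified]
  note n4 = naturality[of mul "coev C \<A> \<star> (dA \<odot> M)", simplified]
  note n5 = naturality[of \<phi> "coev C \<A> \<star> (dA \<odot> M)", simplified]
  have kap: "(ev C \<A> \<star> (dA \<odot> dA \<odot> M)) \<bullet> (\<phi> \<star> (\<A> \<odot> dA \<odot> dA \<odot> M)) = \<kappa> \<star> (dA \<odot> dA \<odot> M)"
    by (simp add: pairing_components)
  have "(dmul \<star> M) \<bullet> (\<phi> \<star> M) = (\<kappa> \<star> (dA \<odot> dA \<odot> M)) \<bullet> (dI \<rhd> (\<A> \<rhd> (mul \<star> (dA \<odot> dA \<odot> M)))) \<bullet>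
     (dI \<rhd> (\<A> \<rhd> (\<A> \<rhd> (coev C \<A> \<star> (dA \<odot> M))))) \<bullet> (dI \<rhd> (\<A> \<rhd> (coev C \<A> \<star> M)))"
    by (simp add: dm n1[symmetric] precomp[OF n2[symmetric]] precomp[OF n3[symmetric]] precomp[OF kap])
  also have "\<dots> = (\<kappa> \<star> (dA \<odot> dA \<odot> M)) \<bullet> (dI \<rhd> (mul \<star> (\<A> \<odot> dA \<odot> dA \<odot> M))) \<bullet>
     (dI \<rhd> (\<A> \<rhd> (\<A> \<rhd> (coev C \<A> \<star> (dA \<odot> M))))) \<bullet> (dI \<rhd> (\<A> \<rhd> (coev C \<A> \<star> M)))"
    by (simp add: precomp[OF kappa_assoc])
  also have "\<dots> = (\<kappa> \<star> (dA \<odot> dA \<odot> M)) \<bullet> (dI \<rhd> (\<A> \<rhd> (coev C \<A> \<star> (dA \<odot> M)))) \<bullet>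
      (dI \<rhd> (mul \<star> (dA \<odot> M))) \<bullet> (dI \<rhd> (\<A> \<rhd> (coev C \<A> \<star> M)))"
    by (simp add: precomp[OF whisk[OF n4]])
  also have "\<dots> = (\<phi> \<star> (dA \<odot> M)) \<bullet> (dI \<rhd> (mul \<star> (dA \<odot> M))) \<bullet> (dI \<rhd> (\<A> \<rhd> (coev C \<A> \<star> M)))"
    by (simp add: pairing_components precomp[OF n5] precomp[OF ev_zigzag(2)])
  finally show ?thesis ..
qed

lemma dun_phi:
  assumes [simp]: "M \<in> obj \<M>"
  shows "(dun \<star> M) \<bullet> (\<phi> \<star> M) = \<epsilon> \<star> M"
proof -
  note [simp] = alg_calc
  have unhom: "un \<in> hom C (one C) \<A>" by (simp add: hom_def)
  have du: "dun \<star> M = (ev C \<A> \<star> M) \<bullet> (dA \<rhd> (un \<star> M))"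
    using ldual_arr_component[OF unhom assms] by (simp add: C.coev_one)
  note n1 = naturality[of \<phi> "un \<star> M", simplified]
  have "(dun \<star> M) \<bullet> (\<phi> \<star> M) = (\<kappa> \<star> M) \<bullet> (dI \<rhd> (\<A> \<rhd> (un \<star> M)))"
    by (simp add: du n1[symmetric] pairing_components)
  then show ?thesis by (simp add: kappa_unit)
qed

end

section \<open>Twisting modules by the Frobenius trace\<close>

lemma alg_module_cat_simps:
  "ide (alg_module_cat C \<M> B) p = (p, ide \<M> (fst p), p)"
  "cmp (alg_module_cat C \<M> B) t s = (fst s, fst (snd t) \<cdot>\<^bsub>\<M>\<^esub> fst (snd s), snd (snd t))"
  "add (alg_module_cat C \<M> B) s t = (fst s, fst (snd s) \<oplus>\<^bsub>\<M>\<^esub> fst (snd t), snd (snd s))"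
  "zer (alg_module_cat C \<M> B) p q = (p, zer \<M> (fst p) (fst q), q)"
  "scl (alg_module_cat C \<M> B) c t = (fst t, scl \<M> c (fst (snd t)), snd (snd t))"
  by (simp_all add: alg_module_cat_def monad_module_cat_def)

lemma alg_module_homE:
  assumes "t \<in> hom (alg_module_cat C \<M> B) p q"
  obtains f where "t = (p, f, q)" "p \<in> obj (alg_module_cat C \<M> B)" "q \<in> obj (alg_module_cat C \<M> B)"
    "f \<in> hom \<M> (fst p) (fst q)" "f \<cdot>\<^bsub>\<M>\<^esub> snd p = snd q \<cdot>\<^bsub>\<M>\<^esub> (ide C (aobj B) \<triangleright>\<^bsub>\<M>\<^esub> f)"
  using assms that alg_module_hom_iff by (metis prod_cases3)

text \<open>
  Both functors of the theorem act on underlying objects and arrows through a functor from \<open>\<M>\<close> to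
  itself; what differs is the action that they put on its values.
\<close>

lemma lifted_functor:
  assumes G: "is_functor \<M> \<M> G"
    and ob: "\<And>M a. (M, a) \<in> obj (alg_module_cat C \<M> B) \<Longrightarrow>
      (fobj G M, \<sigma> (M, a)) \<in> obj (alg_module_cat C \<M> B')"
    and ar: "\<And>M a M' a' f. ((M, a), f, (M', a')) \<in> hom (alg_module_cat C \<M> B) (M, a) (M', a') \<Longrightarrow>
      farr G f \<cdot>\<^bsub>\<M>\<^esub> \<sigma> (M, a) = \<sigma> (M', a') \<cdot>\<^bsub>\<M>\<^esub> (ide C (aobj B') \<triangleright>\<^bsub>\<M>\<^esub> farr G f)"
  defines "F \<equiv> \<lambda>p. (fobj G (fst p), \<sigma> p)"
  shows "is_functor (alg_module_cat C \<M> B) (alg_module_cat C \<M> B')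
    \<lparr>fobj = F, farr = (\<lambda>(p, f, q). (F p, farr G f, F q))\<rparr>"
proof -
  let ?B = "alg_module_cat C \<M> B" and ?B' = "alg_module_cat C \<M> B'"
  have F: "F p \<in> obj ?B'" if "p \<in> obj ?B" for p using ob[of "fst p" "snd p"] that by (simp add: F_def)
  have hm: "(F p, farr G f, F q) \<in> hom ?B' (F p) (F q)" if t: "(p, f, q) \<in> hom ?B p q" for p f q
  proof -
    have pq: "p \<in> obj ?B" "q \<in> obj ?B" "f \<in> hom \<M> (fst p) (fst q)"
      using t by (simp_all add: alg_module_hom_iff)
    have "farr G f \<in> hom \<M> (fobj G (fst p)) (fobj G (fst q))" using pq(3) G by (auto simp: is_functor_def)
    then show ?thesis
      using F[OF pq(1)] F[OF pq(2)] ar[of "fst p" "snd p" f "fst q" "snd q"] t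
      by (simp add: alg_module_hom_iff F_def)
  qed
  show ?thesis unfolding is_functor_def
  proof (intro conjI ballI allI, unfold func.simps)
    show "F p \<in> obj ?B'" if "p \<in> obj ?B" for p by (rule F[OF that])
    show "(case t of (p, f, q) \<Rightarrow> (F p, farr G f, F q)) \<in> hom ?B' (F p) (F q)"
      if t: "t \<in> hom ?B p q" for p q t
    proof -
      obtain f where f: "t = (p, f, q)" using t by (rule alg_module_homE)
      show ?thesis using hm t unfolding f by simp
    qed
    show "(case ide ?B p of (p, f, q) \<Rightarrow> (F p, farr G f, F q)) = ide ?B' (F p)" if "p \<in> obj ?B" for p
    proof -
      have "fst p \<in> obj \<M>" using that by (cases p) (simp add: alg_module_iff)
      then show ?thesis using G by (simp add: is_functor_def alg_module_cat_simps F_def)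
    qed
    fix p q r t s assume s: "s \<in> hom ?B p q" and t: "t \<in> hom ?B q r"
    obtain f where f: "s = (p, f, q)" "f \<in> hom \<M> (fst p) (fst q)" using s by (rule alg_module_homE)
    obtain g where g: "t = (q, g, r)" "g \<in> hom \<M> (fst q) (fst r)" using t by (rule alg_module_homE)
    have "farr G (g \<cdot>\<^bsub>\<M>\<^esub> f) = farr G g \<cdot>\<^bsub>\<M>\<^esub> farr G f" using f g G unfolding is_functor_def by blast
    then show "(case t \<cdot>\<^bsub>?B\<^esub> s of (p, f, q) \<Rightarrow> (F p, farr G f, F q)) =
        (case t of (p, f, q) \<Rightarrow> (F p, farr G f, F q)) \<cdot>\<^bsub>?B'\<^esub> (case s of (p, f, q) \<Rightarrow> (F p, farr G f, F q))"
      by (simp add: alg_module_cat_simps f(1) g(1))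
  qed
qed

lemma (in finite_module_category) act_func_functor:
  "X \<in> obj C \<Longrightarrow> is_functor \<M> \<M> (act_func C \<M> X)"
  by (auto simp: is_functor_def act_func_def hom_def calc)

lemma (in module_category_with_algebra) free_module: "N \<in> obj \<M> \<Longrightarrow> (\<A> \<odot> N, mul \<star> N) \<in> obj Mod"
  by (rule ModI) (simp_all add: calc mul_assoc mul_unit)

context frobenius_algebra
begin

text \<open>
  The unit at a module \<open>(M, a)\<close> of the adjunction between \<open>(M, a) \<mapsto> I\<^sup>\<or> \<triangleright> M\<close> and the free module
  functor; its counit is \<open>\<epsilon>\<close>.
\<close>

definition frob_unit :: "'o \<Rightarrow> 'm \<Rightarrow> 'm" where
  "frob_unit M a = (\<A> \<rhd> (dI \<rhd> a)) \<bullet> (\<delta> \<star> M)"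

lemma frob_unit_typing:
  assumes "(M, a) \<in> obj Mod"
  shows "frob_unit M a \<in> arr \<M>" "src \<M> (frob_unit M a) = M" "tgt \<M> (frob_unit M a) = \<A> \<odot> dI \<odot> M"
  using ModD[OF assms] by (simp_all add: frob_unit_def calc)

text \<open>
  This is where the Casimir identity enters: multiplication on the first leg of \<open>\<delta>\<close> can be moved to the
  last leg, where it acts on \<open>M\<close>.
\<close>

lemma frob_unit_linear:
  assumes a: "(M, a) \<in> obj Mod"
  shows "frob_unit M a \<bullet> a = (mul \<star> (dI \<odot> M)) \<bullet> (\<A> \<rhd> frob_unit M a)"
proof -
  note [simp] = alg_calc
  note a' [simp] = ModD(1-4)[OF a]
  note n1 = naturality[of mul "dI \<rhd> a", simplified]
  note n2 = naturality[of \<delta> a, simplified]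
  show ?thesis
    unfolding frob_unit_def
    by (simp add: n2 precomp[OF n1] casimir precomp[OF whisk[OF whisk[OF ModD(5)[OF a]]]])
qed

lemma frob_unit_naturality:
  assumes f: "((M, a), f, (M', a')) \<in> hom Mod (M, a) (M', a')"
  shows "(\<A> \<rhd> (dI \<rhd> f)) \<bullet> frob_unit M a = frob_unit M' a' \<bullet> f"
proof -
  have ma: "(M, a) \<in> obj Mod" "(M', a') \<in> obj Mod" and fh: "f \<in> hom \<M> M M'"
    and eq: "f \<bullet> a = a' \<bullet> (\<A> \<rhd> f)" using f by (auto simp: alg_module_hom_iff)
  note [simp] = alg_calc M.homD[OF fh] ModD(1-4)[OF ma(1)] ModD(1-4)[OF ma(2)]
  note n = naturality[of \<delta> f, simplified]
  show ?thesis unfolding frob_unit_def by (simp add: n precomp[OF whisk[OF whisk[OF eq]]])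
qed

lemma frob_triangle_module:
  assumes a: "(M, a) \<in> obj Mod"
  shows "(\<epsilon> \<star> (dI \<odot> M)) \<bullet> (dI \<rhd> frob_unit M a) = ide \<M> (dI \<odot> M)"
proof -
  note [simp] = alg_calc
  note a' [simp] = ModD(1-4)[OF a]
  note n1 = naturality[of \<epsilon> "dI \<rhd> a", simplified]
  note n2 = naturality[of un "\<delta> \<star> M", simplified]
  have "(\<epsilon> \<star> (dI \<odot> \<A> \<odot> M)) \<bullet> (dI \<rhd> (\<delta> \<star> M)) = dI \<rhd> (un \<star> M)"
    by (simp add: kappa_unit(1)[symmetric] whisk[OF n2] precomp[OF copairing(2)])
  then show ?thesis
    unfolding frob_unit_def by (simp add: precomp[OF n1] whisk[OF ModD(6)[OF a]])
qed

lemma frob_triangle_free: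
  assumes [simp]: "N \<in> obj \<M>"
  shows "(\<A> \<rhd> (\<epsilon> \<star> N)) \<bullet> frob_unit (\<A> \<odot> N) (mul \<star> N) = ide \<M> (\<A> \<odot> N)"
proof -
  note [simp] = alg_calc
  note n1 = naturality[of mul "\<epsilon> \<star> N", simplified]
  note n2 = naturality[of \<delta> "un \<star> N", simplified]
  have "(\<A> \<rhd> (\<epsilon> \<star> N)) \<bullet> (\<delta> \<star> N) = un \<star> N"
    by (simp add: kappa_unit(2)[symmetric] n2[symmetric] precomp[OF copairing(1)])
  note eu = this
  show ?thesis
    unfolding frob_unit_def
    by (simp add: casimir[symmetric] precomp[OF n1[symmetric]] whisk[OF eu] mul_unit)
qed

text \<open>
  By linearity of the unit, a second copairing, inserted behind the first one, can be moved in front of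
  it, where multiplication joins the two.
\<close>

lemma frob_unit_iterate:
  assumes a: "(M, a) \<in> obj Mod"
  shows "(\<A> \<rhd> (dI \<rhd> frob_unit M a)) \<bullet> frob_unit M a =
    (mul \<star> (dI \<odot> \<A> \<odot> dI \<odot> M)) \<bullet> (\<A> \<rhd> (\<delta> \<star> (dI \<odot> M))) \<bullet> frob_unit M a"
proof -
  note [simp] = alg_calc frob_unit_typing[OF a]
  note a' [simp] = ModD(1-4)[OF a]
  note n = naturality[of \<delta> "frob_unit M a", simplified]
  have "(\<A> \<rhd> (dI \<rhd> frob_unit M a)) \<bullet> frob_unit M a =
      (\<A> \<rhd> (dI \<rhd> frob_unit M a)) \<bullet> (\<A> \<rhd> (dI \<rhd> a)) \<bullet> (\<delta> \<star> M)"
    by (simp add: frob_unit_def)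
  also have "\<dots> = (\<A> \<rhd> (dI \<rhd> (mul \<star> (dI \<odot> M)))) \<bullet> (\<A> \<rhd> (dI \<rhd> (\<A> \<rhd> frob_unit M a))) \<bullet> (\<delta> \<star> M)"
    by (simp add: precomp[OF whisk[OF whisk[OF frob_unit_linear[OF a]]]])
  also have "\<dots> = (mul \<star> (dI \<odot> \<A> \<odot> dI \<odot> M)) \<bullet> (\<A> \<rhd> (\<delta> \<star> (dI \<odot> M))) \<bullet> frob_unit M a"
    by (simp add: n[symmetric] precomp[OF casimir[symmetric]])
  finally show ?thesis .
qed

text \<open>
  The coaction of \<open>A\<^sup>\<or>\<close> on \<open>I\<^sup>\<or> \<triangleright> M\<close> that corresponds to the twisted action of \<open>A\<^sup>\<or>\<^sup>\<or>\<close>; the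
  correspondence is established in \<open>twisted_action_eq\<close>.
\<close>

definition twist_coaction :: "'o \<Rightarrow> 'm \<Rightarrow> 'm" where
  "twist_coaction M a = (\<phi> \<star> (dI \<odot> M)) \<bullet> (dI \<rhd> frob_unit M a)"

lemma twist_coaction_typing:
  assumes "(M, a) \<in> obj Mod"
  shows "twist_coaction M a \<in> arr \<M>" "src \<M> (twist_coaction M a) = dI \<odot> M"
    "tgt \<M> (twist_coaction M a) = dA \<odot> dI \<odot> M"
  using ModD[OF assms] frob_unit_typing[OF assms] by (simp_all add: twist_coaction_def calc)

lemma twist_coaction_comodule:
  assumes a: "(M, a) \<in> obj Mod"
  shows "(dA \<rhd> twist_coaction M a) \<bullet> twist_coaction M a = (dmul \<star> (dI \<odot> M)) \<bullet> twist_coaction M a"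
    and "(dun \<star> (dI \<odot> M)) \<bullet> twist_coaction M a = ide \<M> (dI \<odot> M)"
proof -
  note [simp] = alg_calc frob_unit_typing[OF a]
  note a' [simp] = ModD(1-4)[OF a]
  let ?N = "dI \<odot> M"
  note n1 = naturality[of \<phi> "dI \<rhd> frob_unit M a", simplified]
  note n2 = naturality[of mul "\<psi> \<star> ?N", simplified]
  note n3 = naturality[of \<phi> "\<phi> \<star> ?N", simplified]
  note n4 = naturality[of mul "\<phi> \<star> ?N", simplified]
  have "(dA \<rhd> twist_coaction M a) \<bullet> twist_coaction M a =
      (dA \<rhd> (\<phi> \<star> ?N)) \<bullet> (\<phi> \<star> (dI \<odot> \<A> \<odot> ?N)) \<bullet> (dI \<rhd> (mul \<star> (dI \<odot> \<A> \<odot> ?N))) \<bullet>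
      (dI \<rhd> (\<A> \<rhd> (\<delta> \<star> ?N))) \<bullet> (dI \<rhd> frob_unit M a)"
    unfolding twist_coaction_def by (simp add: precomp[OF n1[symmetric]] whisk[OF frob_unit_iterate[OF a]])
  also have "\<dots> = (\<phi> \<star> (dA \<odot> ?N)) \<bullet> (dI \<rhd> (mul \<star> (dA \<odot> ?N))) \<bullet> (dI \<rhd> (\<A> \<rhd> (coev C \<A> \<star> ?N))) \<bullet>
      (dI \<rhd> frob_unit M a)"
    by (simp add: precomp[OF n3[symmetric]] precomp[OF whisk[OF n4[symmetric]]] pairing_components(2)
        precomp[OF whisk[OF whisk[OF whisk[OF phi_psi(2)]]]])
  also have "\<dots> = (dmul \<star> ?N) \<bullet> twist_coaction M a"
    unfolding twist_coaction_def using precomp[OF dmul_phi[of ?N], of "dI \<rhd> frob_unit M a"] by simp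
  finally show "(dA \<rhd> twist_coaction M a) \<bullet> twist_coaction M a = (dmul \<star> ?N) \<bullet> twist_coaction M a" .
  show "(dun \<star> ?N) \<bullet> twist_coaction M a = ide \<M> ?N"
    unfolding twist_coaction_def by (simp add: precomp[OF dun_phi] frob_triangle_module[OF a])
qed

text \<open>
  The Nakayama isomorphism consists of the transpose of \<open>\<phi>\<close> and the inverse of \<open>\<phi>\<close>.  The transpose
  is traded for \<open>\<phi>\<close> itself by sliding it around an evaluation, and the inverse is absorbed by the
  copairing \<open>\<delta>\<close>.
\<close>

lemma twisted_action_eq:
  assumes a: "(M, a) \<in> obj Mod"
  shows "twisted_action C \<M> I A l (M, a) = (ev C dA \<star> (dI \<odot> M)) \<bullet> (ddA \<rhd> twist_coaction M a)"
proof -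
  note [simp] = alg_calc C.ldual_tobj
  note a' [simp] = ModD(1-4)[OF a]
  note n1 = naturality[of \<phi> "dI \<rhd> a", simplified]
  note n2 = naturality[of \<phi> "\<psi> \<star> M", simplified]
  note n3 = naturality[of "ev C dA" "dI \<rhd> a", simplified]
  note n4 = naturality[of "ev C dA" "\<psi> \<star> M", simplified]
  note e = dual_ev[OF phi_hom, of "dA \<odot> M", simplified]
  note n5 = naturality[of "ldual_arr C \<phi>" "dI \<rhd> (coev C \<A> \<star> M)", simplified]
  note n6 = naturality[of "ev C dI" "coev C \<A> \<star> M", simplified]
  note n7 = naturality[of \<psi> "ev C dI \<star> M", simplified]
  have ee: "ev C (dI \<otimes>\<^sub>o\<^bsub>C\<^esub> \<A>) \<star> (dA \<odot> M) = (ev C \<A> \<star> (dA \<odot> M)) \<bullet> (dA \<rhd> (ev C dI \<star> (\<A> \<odot> dA \<odot> M)))"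
    by (simp add: C.ev_tobj)
  have "(ev C dA \<star> (dI \<odot> M)) \<bullet> (ddA \<rhd> twist_coaction M a) =
     (dI \<rhd> a) \<bullet> (\<psi> \<star> M) \<bullet> (ev C dA \<star> (dA \<odot> M)) \<bullet> (ddA \<rhd> (\<phi> \<star> (dA \<odot> M))) \<bullet>
     (ddA \<rhd> (dI \<rhd> (coev C \<A> \<star> M)))"
    unfolding twist_coaction_def frob_unit_def
    by (simp add: pairing_components(2) precomp[OF whisk[OF n1]] precomp[OF whisk[OF n2]] precomp[OF n3] precomp[OF n4])
  also have "\<dots> = (dI \<rhd> a) \<bullet> (\<psi> \<star> M) \<bullet> (dA \<rhd> (ev C dI \<star> M)) \<bullet> (ldual_arr C \<phi> \<star> (dI \<odot> M))"
    by (simp add: precomp[OF e[symmetric]] n5 ee precomp[OF whisk[OF n6]] precomp[OF ev_zigzag(2)])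
  also have "\<dots> = twisted_action C \<M> I A l (M, a)"
    by (simp add: twisted_action_def nakayama_iso_def Let_def precomp[OF n7])
  finally show ?thesis ..
qed

lemma twisted_module:
  assumes a: "(M, a) \<in> obj Mod"
  shows "(dI \<odot> M, twisted_action C \<M> I A l (M, a)) \<in> obj ddMod"
    and "coaction (dI \<odot> M) (twisted_action C \<M> I A l (M, a)) = twist_coaction M a"
  using comodule_imp_module[OF act_obj[OF C.ldual_obj[OF I_obj] ModD(1)[OF a]] twist_coaction_typing[OF a]
      twist_coaction_comodule[OF a]]
  by (simp_all add: twisted_action_eq[OF a])

lemma twist_functor: "is_functor Mod ddMod (twist_func C \<M> I A l)"
proof -
  have "is_functor Mod ddMod
    \<lparr>fobj = (\<lambda>p. (fobj (act_func C \<M> dI) (fst p), twisted_action C \<M> I A l p)),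
     farr = (\<lambda>(p, f, q). ((fobj (act_func C \<M> dI) (fst p), twisted_action C \<M> I A l p),
       farr (act_func C \<M> dI) f, (fobj (act_func C \<M> dI) (fst q), twisted_action C \<M> I A l q)))\<rparr>"
  proof (rule lifted_functor[OF act_func_functor])
    show "dI \<in> obj C" by (simp add: calc)
    show "(fobj (act_func C \<M> dI) M, twisted_action C \<M> I A l (M, a)) \<in> obj ddMod"
      if "(M, a) \<in> obj Mod" for M a using twisted_module(1)[OF that] by (simp add: act_func_def)
    fix M a M' a' f assume f: "((M, a), f, (M', a')) \<in> hom Mod (M, a) (M', a')"
    then have ma: "(M, a) \<in> obj Mod" "(M', a') \<in> obj Mod" and fh: "f \<in> hom \<M> M M'"
      by (auto simp: alg_module_hom_iff)
    note [simp] = alg_calc M.homD[OF fh] ModD(1-4)[OF ma(1)] ModD(1-4)[OF ma(2)]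
      frob_unit_typing[OF ma(1)] frob_unit_typing[OF ma(2)]
    note n1 = naturality[of "ev C dA" "dI \<rhd> f", simplified]
    note n2 = naturality[of \<phi> "dI \<rhd> f", simplified]
    show "farr (act_func C \<M> dI) f \<bullet> twisted_action C \<M> I A l (M, a) =
       twisted_action C \<M> I A l (M', a') \<bullet> (aobj (lldual_algebra C A) \<rhd> farr (act_func C \<M> dI) f)"
      by (simp add: act_func_def lldual_algebra_simps twisted_action_eq ma twist_coaction_def
          precomp[OF n1[symmetric]] precomp[OF whisk[OF n2[symmetric]]] whisk[OF whisk[OF frob_unit_naturality[OF f]]])
  qed
  then show ?thesis by (simp add: twist_func_def act_func_def Let_def)
qed

text \<open>
  The second copairing produced by \<open>frob_unit_iterate\<close> contains the inverse of \<open>\<phi>\<close>, which cancels the \<open>\<phi>\<close> of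
  the coaction; the coevaluation that remains straightens against the evaluation.  This identity makes the
  universal family on modules linear.
\<close>

lemma frobenius_balance:
  assumes a: "(M, a) \<in> obj Mod" and X [simp]: "X \<in> obj \<M>" and f: "f \<in> hom \<M> (dI \<odot> M) (\<A> \<odot> X)"
  shows "(\<A> \<rhd> ((ev C \<A> \<star> X) \<bullet> (dA \<rhd> f) \<bullet> twist_coaction M a)) \<bullet> frob_unit M a =
    (mul \<star> X) \<bullet> (\<A> \<rhd> f) \<bullet> frob_unit M a"
proof -
  note [simp] = alg_calc M.homD[OF f] frob_unit_typing[OF a]
  note a' [simp] = ModD(1-4)[OF a]
  let ?N = "dI \<odot> M"
  note n1 = naturality[of mul "\<phi> \<star> ?N", simplified]
  note n2 = naturality[of mul "dA \<rhd> f", simplified]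
  note n3 = naturality[of mul "ev C \<A> \<star> X", simplified]
  note n4 = naturality[of "coev C \<A>" f, simplified]
  show ?thesis
    by (simp add: twist_coaction_def frob_unit_iterate[OF a] pairing_components(2)
        precomp[OF n1[symmetric]] precomp[OF n2[symmetric]] precomp[OF n3[symmetric]]
        precomp[OF whisk[OF whisk[OF phi_psi(2)]]] precomp[OF whisk[OF n4[symmetric]]] precomp[OF whisk[OF ev_zigzag(1)]])
qed

end

section \<open>Acting on universal families\<close>

context finite_module_category
begin

lemma transpose_inverse:
  assumes X: "X \<in> obj C" and P: "P \<in> obj \<M>" and Z: "Z \<in> obj \<M>"
  shows "h \<in> hom \<M> (X \<odot> P) Z \<Longrightarrow>
      (evr C X \<star> Z) \<bullet> (X \<rhd> ((rdual C X \<rhd> h) \<bullet> (coevr C X \<star> P))) = h"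
    and "k \<in> hom \<M> P (rdual C X \<odot> Z) \<Longrightarrow>
      (rdual C X \<rhd> ((evr C X \<star> Z) \<bullet> (X \<rhd> k))) \<bullet> (coevr C X \<star> P) = k"
proof -
  note [simp] = calc X P Z
  show "(evr C X \<star> Z) \<bullet> (X \<rhd> ((rdual C X \<rhd> h) \<bullet> (coevr C X \<star> P))) = h" if h: "h \<in> hom \<M> (X \<odot> P) Z"
  proof -
    note [simp] = M.homD[OF h]
    note n = naturality[of "evr C X" h, simplified]
    show ?thesis by (simp add: precomp[OF n] ev_zigzag(3))
  qed
  show "(rdual C X \<rhd> ((evr C X \<star> Z) \<bullet> (X \<rhd> k))) \<bullet> (coevr C X \<star> P) = k"
    if k: "k \<in> hom \<M> P (rdual C X \<odot> Z)"
  proof -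
    note [simp] = M.homD[OF k]
    note n = naturality[of "coevr C X" k, simplified]
    show ?thesis by (simp add: n[symmetric] precomp[OF ev_zigzag(4)])
  qed
qed

text \<open>
  Since \<open>X \<triangleright> -\<close> has the right adjoint \<open>rdual X \<triangleright> -\<close>, it carries jointly epimorphic families and
  universal families to families of the same kind.  The next two lemmas are uniqueness and existence
  of the induced arrows; copowers and coends are instances.
\<close>

lemma whisker_jointly_epic:
  assumes X: "X \<in> obj C" and P: "P \<in> obj \<M>"
    and e: "\<And>s. s \<in> S \<Longrightarrow> e s \<in> hom \<M> (D s) P"
    and epi: "\<And>Z k k'. k \<in> hom \<M> P Z \<Longrightarrow> k' \<in> hom \<M> P Z \<Longrightarrow>
      (\<And>s. s \<in> S \<Longrightarrow> k \<bullet> e s = k' \<bullet> e s) \<Longrightarrow> k = k'"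
    and h: "h \<in> hom \<M> (X \<odot> P) Z" "h' \<in> hom \<M> (X \<odot> P) Z"
    and eq: "\<And>s. s \<in> S \<Longrightarrow> h \<bullet> (X \<rhd> e s) = h' \<bullet> (X \<rhd> e s)"
  shows "h = h'"
proof -
  note [simp] = calc X P M.homD[OF h(1)] M.homD[OF h(2)] M.hom_objs[OF h(1)]
  define tr where "tr g = (rdual C X \<rhd> g) \<bullet> (coevr C X \<star> P)" for g
  have tr: "tr g \<in> hom \<M> P (rdual C X \<odot> Z)" if "g \<in> hom \<M> (X \<odot> P) Z" for g
    using M.homD[OF that] by (simp add: tr_def hom_def)
  have tr_e: "tr g \<bullet> e s = (rdual C X \<rhd> (g \<bullet> (X \<rhd> e s))) \<bullet> (coevr C X \<star> D s)"
    if g: "g \<in> hom \<M> (X \<odot> P) Z" and s: "s \<in> S" for g s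
  proof -
    note [simp] = M.homD[OF g] M.homD[OF e[OF s]] M.hom_objs[OF e[OF s]]
    note n = naturality[of "coevr C X" "e s", simplified]
    show ?thesis by (simp add: tr_def n)
  qed
  have "tr h = tr h'"
  proof (rule epi[OF tr[OF h(1)] tr[OF h(2)]])
    fix s assume s: "s \<in> S"
    show "tr h \<bullet> e s = tr h' \<bullet> e s" unfolding tr_e[OF h(1) s] tr_e[OF h(2) s] eq[OF s] ..
  qed
  then show ?thesis
    using transpose_inverse(1)[OF X P M.hom_objs(2)[OF h(1)] h(1)]
      transpose_inverse(1)[OF X P M.hom_objs(2)[OF h(1)] h(2)] by (metis tr_def)
qed

lemma whisker_induced:
  assumes X: "X \<in> obj C" and Z: "Z \<in> obj \<M>"
    and e: "\<And>s. s \<in> S \<Longrightarrow> e s \<in> hom \<M> (D s) P" and p: "\<And>s. s \<in> S \<Longrightarrow> p s \<in> hom \<M> (X \<odot> D s) Z"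
    and k: "k \<in> hom \<M> P (rdual C X \<odot> Z)"
    and ke: "\<And>s. s \<in> S \<Longrightarrow> k \<bullet> e s = (rdual C X \<rhd> p s) \<bullet> (coevr C X \<star> D s)"
  shows "\<exists>h. h \<in> hom \<M> (X \<odot> P) Z \<and> (\<forall>s\<in>S. h \<bullet> (X \<rhd> e s) = p s)"
proof (intro exI[of _ "(evr C X \<star> Z) \<bullet> (X \<rhd> k)"] conjI ballI)
  note [simp] = calc X Z M.homD[OF k]
  show "(evr C X \<star> Z) \<bullet> (X \<rhd> k) \<in> hom \<M> (X \<odot> P) Z" by (simp add: hom_def)
  fix s assume s: "s \<in> S"
  note [simp] = M.homD[OF e[OF s]] M.hom_objs[OF e[OF s]]
  have "((evr C X \<star> Z) \<bullet> (X \<rhd> k)) \<bullet> (X \<rhd> e s) = (evr C X \<star> Z) \<bullet> (X \<rhd> (k \<bullet> e s))" by simp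
  also have "\<dots> = p s"
    unfolding ke[OF s] by (rule transpose_inverse(1)[OF X _ Z p[OF s]]) simp
  finally show "((evr C X \<star> Z) \<bullet> (X \<rhd> k)) \<bullet> (X \<rhd> e s) = p s" .
qed

lemma whisker_linear:
  assumes X: "X \<in> obj C" and g: "linear_into_hom \<M> V Y Z g"
  shows "linear_into_hom \<M> V (X \<odot> Y) (X \<odot> Z) (\<lambda>v. X \<rhd> g v)"
proof -
  have h: "g v \<in> hom \<M> Y Z" if "v \<in> V" for v using g that by (auto simp: linear_into_hom_def)
  show ?thesis
    unfolding linear_into_hom_def
    using g act_hom[OF C.ide_hom[OF X] h] act_add_right[OF C.homD(1)[OF C.ide_hom[OF X]] h h]
      act_scl_right[OF C.homD(1)[OF C.ide_hom[OF X]] M.homD(1)[OF h]]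
    by (auto simp: linear_into_hom_def)
qed

lemma transpose_linear:
  assumes X: "X \<in> obj C" and Y: "Y \<in> obj \<M>" and g: "linear_into_hom \<M> V (X \<odot> Y) Z g"
  shows "linear_into_hom \<M> V Y (rdual C X \<odot> Z) (\<lambda>v. (rdual C X \<rhd> g v) \<bullet> (coevr C X \<star> Y))"
  by (rule M.linear_into_hom_pre[OF whisker_linear[OF C.rdual_obj[OF X] g]])
    (simp add: hom_def calc X Y)

lemma whisker_copower:
  assumes X: "X \<in> obj C" and cop: "is_copower \<M> V Y P e" and Y: "Y \<in> obj \<M>"
  shows "is_copower \<M> V (X \<odot> Y) (X \<odot> P) (\<lambda>v. X \<rhd> e v)"
  unfolding is_copower_def
proof (intro conjI ballI allI impI)
  note P = M.is_copower_obj[OF cop]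
  have e: "e v \<in> hom \<M> Y P" if "v \<in> V" for v
    using M.is_copower_lin[OF cop] that by (auto simp: linear_into_hom_def)
  show "X \<odot> P \<in> obj \<M>" by (rule act_obj[OF X P])
  show "linear_into_hom \<M> V (X \<odot> Y) (X \<odot> P) (\<lambda>v. X \<rhd> e v)"
    by (rule whisker_linear[OF X M.is_copower_lin[OF cop]])
  fix Z g assume Z: "Z \<in> obj \<M>" and g: "linear_into_hom \<M> V (X \<odot> Y) Z g"
  have gh: "g v \<in> hom \<M> (X \<odot> Y) Z" if "v \<in> V" for v using g that by (auto simp: linear_into_hom_def)
  note k = M.copower_induced[OF cop act_obj[OF C.rdual_obj[OF X] Z] transpose_linear[OF X Y g]]
  obtain h where h: "h \<in> hom \<M> (X \<odot> P) Z" "\<forall>v\<in>V. h \<bullet> (X \<rhd> e v) = g v"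
    using whisker_induced[where S=V and e=e and D="\<lambda>_. Y" and p=g, OF X Z e gh k] by blast
  moreover have "h' = h" if "h' \<in> hom \<M> (X \<odot> P) Z" "\<forall>v\<in>V. h' \<bullet> (X \<rhd> e v) = g v" for h'
    by (rule whisker_jointly_epic[where S=V and e=e and D="\<lambda>_. Y", OF X P e _ that(1) h(1)])
      (use M.copower_ext[OF cop] that(2) h(2) in auto)
  ultimately show "\<exists>!h. h \<in> hom \<M> (X \<odot> P) Z \<and> (\<forall>v\<in>V. h \<bullet> (X \<rhd> e v) = g v)" by blast
qed

lemma whisker_coend_ext:
  assumes N: "dual_coend \<M> N j" and M: "M \<in> obj \<M>" and X: "X \<in> obj C"
    and h: "h \<in> hom \<M> (X \<odot> fobj N M) Z" "h' \<in> hom \<M> (X \<odot> fobj N M) Z"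
    and eq: "\<And>Y \<xi>. Y \<in> obj \<M> \<Longrightarrow> \<xi> \<in> hom_dual \<M> M Y \<Longrightarrow> h \<bullet> (X \<rhd> j M Y \<xi>) = h' \<bullet> (X \<rhd> j M Y \<xi>)"
  shows "h = h'"
proof (rule whisker_jointly_epic[where S="SIGMA Y:obj \<M>. hom_dual \<M> M Y" and D=fst
      and e="\<lambda>(Y, \<xi>). j M Y \<xi>", OF X dual_coend_obj[OF N M] _ _ h])
  fix s assume "s \<in> (SIGMA Y:obj \<M>. hom_dual \<M> M Y)"
  then show "(case s of (Y, \<xi>) \<Rightarrow> j M Y \<xi>) \<in> hom \<M> (fst s) (fobj N M)"
    using M.dual_family_hom[OF dual_coend_family[OF N M]] by auto
next
  fix Z k k' assume k: "k \<in> hom \<M> (fobj N M) Z" "k' \<in> hom \<M> (fobj N M) Z"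
    and eq: "\<And>s. s \<in> (SIGMA Y:obj \<M>. hom_dual \<M> M Y) \<Longrightarrow>
      k \<bullet> (case s of (Y, \<xi>) \<Rightarrow> j M Y \<xi>) = k' \<bullet> (case s of (Y, \<xi>) \<Rightarrow> j M Y \<xi>)"
  show "k = k'" by (rule M.dual_coend_ext[OF N M k]) (use eq in force)
qed (use eq in auto)

lemma whisker_coend_induced:
  assumes N: "dual_coend \<M> N j" and M: "M \<in> obj \<M>" and X: "X \<in> obj C" and Z: "Z \<in> obj \<M>"
    and lin: "\<And>Y. Y \<in> obj \<M> \<Longrightarrow> linear_into_hom \<M> (hom_dual \<M> M Y) (X \<odot> Y) Z (p Y)"
    and nat: "\<And>Y Y' g \<xi>. g \<in> hom \<M> Y Y' \<Longrightarrow> \<xi> \<in> hom_dual \<M> M Y' \<Longrightarrow>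
      p Y (hom_transpose \<M> M Y (\<lambda>f. g \<bullet> f) \<xi>) = p Y' \<xi> \<bullet> (X \<rhd> g)"
  shows "\<exists>h. h \<in> hom \<M> (X \<odot> fobj N M) Z \<and>
    (\<forall>Y\<in>obj \<M>. \<forall>\<xi>\<in>hom_dual \<M> M Y. h \<bullet> (X \<rhd> j M Y \<xi>) = p Y \<xi>)"
proof -
  note [simp] = calc X Z
  have ph: "p Y \<xi> \<in> hom \<M> (X \<odot> Y) Z" if "Y \<in> obj \<M>" "\<xi> \<in> hom_dual \<M> M Y" for Y \<xi>
    using lin[OF that(1)] that(2) by (auto simp: linear_into_hom_def)
  define q where "q Y \<xi> = (rdual C X \<rhd> p Y \<xi>) \<bullet> (coevr C X \<star> Y)" for Y \<xi>
  have "dual_family \<M> M (rdual C X \<odot> Z) q" unfolding dual_family_def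
  proof (intro conjI ballI allI impI)
    show "linear_into_hom \<M> (hom_dual \<M> M Y) Y (rdual C X \<odot> Z) (q Y)" if "Y \<in> obj \<M>" for Y
      unfolding q_def by (rule transpose_linear[OF X that lin[OF that]])
    fix Y Y' g \<xi> assume g: "g \<in> hom \<M> Y Y'" and \<xi>: "\<xi> \<in> hom_dual \<M> M Y'"
    note Y = M.hom_objs[OF g]
    note [simp] = M.homD[OF g] Y M.homD[OF ph[OF Y(2) \<xi>]]
    note n = naturality[of "coevr C X" g, simplified]
    show "q Y (hom_transpose \<M> M Y (\<lambda>f. g \<bullet> f) \<xi>) = q Y' \<xi> \<bullet> g"
      by (simp add: q_def nat[OF g \<xi>] n)
  qed
  then obtain k where k: "k \<in> hom \<M> (fobj N M) (rdual C X \<odot> Z)"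
      "\<And>Y \<xi>. Y \<in> obj \<M> \<Longrightarrow> \<xi> \<in> hom_dual \<M> M Y \<Longrightarrow> k \<bullet> j M Y \<xi> = q Y \<xi>"
    using dual_coend_universal[OF N M act_obj[OF C.rdual_obj[OF X] Z]] by blast
  have "\<exists>h. h \<in> hom \<M> (X \<odot> fobj N M) Z \<and> (\<forall>s\<in>(SIGMA Y:obj \<M>. hom_dual \<M> M Y).
      h \<bullet> (X \<rhd> (case s of (Y, \<xi>) \<Rightarrow> j M Y \<xi>)) = (case s of (Y, \<xi>) \<Rightarrow> p Y \<xi>))"
    by (rule whisker_induced[where D=fst, OF X Z _ _ k(1)])
      (use k(2) ph M.dual_family_hom[OF dual_coend_family[OF N M]] in \<open>auto simp: q_def\<close>)
  then show ?thesis by auto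
qed

end

section \<open>The Nakayama functor on modules over the double dual\<close>

locale nakayama_module_category = finite_module_category C \<M>
  for C :: "('c, 'd, 'k::field, 'z) moncat_scheme"
    and \<M> :: "('c, 'd, 'o, 'm, 'k, 'y) modcat_scheme" +
  fixes cp :: "('o, 'm, 'k) copow" and N :: "('o, 'm, 'o, 'm) func" and i :: "'o \<Rightarrow> 'o \<Rightarrow> 'm"
  assumes coend: "nakayama_coend \<M> cp N i"
begin

text \<open>The arrow \<open>i M X\<close> on the copy of \<open>X\<close> that belongs to the functional \<open>\<xi>\<close>.\<close>

definition j :: "'o \<Rightarrow> 'o \<Rightarrow> ('m \<Rightarrow> 'k) \<Rightarrow> 'm" where
  "j M X \<xi> = i M X \<bullet> cpunit cp (hom_dual \<M> M X) X \<xi>"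

lemma N_coend: "dual_coend \<M> N j"
  using M.nakayama_coend_imp_dual_coend[OF M.hom_finite coend] unfolding j_def .

lemma j_hom: "M \<in> obj \<M> \<Longrightarrow> X \<in> obj \<M> \<Longrightarrow> \<xi> \<in> hom_dual \<M> M X \<Longrightarrow> j M X \<xi> \<in> hom \<M> X (fobj N M)"
  by (rule M.dual_family_hom[OF dual_coend_family[OF N_coend]])

lemma j_linear: "M \<in> obj \<M> \<Longrightarrow> X \<in> obj \<M> \<Longrightarrow> linear_into_hom \<M> (hom_dual \<M> M X) X (fobj N M) (j M X)"
  using dual_coend_family[OF N_coend] by (auto simp: dual_family_def)

lemma j_dinatural:
  "M \<in> obj \<M> \<Longrightarrow> g \<in> hom \<M> X X' \<Longrightarrow> \<xi> \<in> hom_dual \<M> M X' \<Longrightarrow>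
    j M X (hom_transpose \<M> M X (\<lambda>f. g \<bullet> f) \<xi>) = j M X' \<xi> \<bullet> g"
  using dual_coend_family[OF N_coend] unfolding dual_family_def by blast

lemma N_objects [simp]: "M \<in> obj \<M> \<Longrightarrow> fobj N M \<in> obj \<M>"
  by (rule dual_coend_obj[OF N_coend])

lemma N_arrows: "f \<in> hom \<M> M M' \<Longrightarrow> farr N f \<in> hom \<M> (fobj N M) (fobj N M')"
  by (rule dual_coend_arr[OF N_coend])

text \<open>
  The map \<open>t\<close> in the definition of the canonical arrow, for the
  adjunctions \<open>X\<^sup>\<or>\<^sup>\<or> \<triangleright> - \<stileturn> X\<^sup>\<or> \<triangleright> - \<stileturn> X \<triangleright> -\<close>.
\<close>

definition mate :: "'c \<Rightarrow> 'o \<Rightarrow> 'o \<Rightarrow> 'm \<Rightarrow> 'm" where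
  "mate X M Y f = (ev C X \<star> Y) \<bullet> (ldual C X \<rhd> f) \<bullet> (coev C (ldual C X) \<star> M)"

lemma mate_linear:
  assumes X: "X \<in> obj C" and M: "M \<in> obj \<M>" and Y: "Y \<in> obj \<M>"
  shows "linear_between \<M> (ldual C (ldual C X) \<odot> M) (X \<odot> Y) \<M> M Y (mate X M Y)"
proof -
  let ?d = "ldual C X" and ?dd = "ldual C (ldual C X)"
  note [simp] = calc X M Y
  have ev: "ev C X \<star> Y \<in> hom \<M> (?d \<odot> X \<odot> Y) Y" and co: "coev C ?d \<star> M \<in> hom \<M> M (?d \<odot> ?dd \<odot> M)"
    by (simp_all add: hom_def)
  have d: "ide C ?d \<in> arr C" by simp
  show ?thesis unfolding linear_between_def mate_def
  proof (intro conjI ballI allI)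
    fix f g c assume f: "f \<in> hom \<M> (?dd \<odot> M) (X \<odot> Y)"
    have wf: "?d \<rhd> f \<in> hom \<M> (?d \<odot> ?dd \<odot> M) (?d \<odot> X \<odot> Y)" using M.homD[OF f] by (simp add: hom_def)
    show "(ev C X \<star> Y) \<bullet> (?d \<rhd> f) \<bullet> (coev C ?d \<star> M) \<in> hom \<M> M Y"
      by (rule M.cmp_hom[OF M.cmp_hom[OF co wf] ev])
    show "(ev C X \<star> Y) \<bullet> (?d \<rhd> scl \<M> c f) \<bullet> (coev C ?d \<star> M) =
        scl \<M> c ((ev C X \<star> Y) \<bullet> (?d \<rhd> f) \<bullet> (coev C ?d \<star> M))"
      using act_scl_right[OF d M.homD(1)[OF f], of c] M.cmp_scl_left[OF co wf, of c]
        M.cmp_scl_right[OF M.cmp_hom[OF co wf] ev, of c] by simp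
    assume g: "g \<in> hom \<M> (?dd \<odot> M) (X \<odot> Y)"
    have wg: "?d \<rhd> g \<in> hom \<M> (?d \<odot> ?dd \<odot> M) (?d \<odot> X \<odot> Y)" using M.homD[OF g] by (simp add: hom_def)
    show "(ev C X \<star> Y) \<bullet> (?d \<rhd> (f \<oplus>\<^bsub>\<M>\<^esub> g)) \<bullet> (coev C ?d \<star> M) =
        (ev C X \<star> Y) \<bullet> (?d \<rhd> f) \<bullet> (coev C ?d \<star> M) \<oplus>\<^bsub>\<M>\<^esub> (ev C X \<star> Y) \<bullet> (?d \<rhd> g) \<bullet> (coev C ?d \<star> M)"
      using act_add_right[OF d f g] M.cmp_add_left[OF co wf wg]
        M.cmp_add_right[OF M.cmp_hom[OF co wf] M.cmp_hom[OF co wg] ev] by simp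
  qed
qed

lemma mate_natural:
  assumes X: "X \<in> obj C" and M: "M \<in> obj \<M>" and g: "g \<in> hom \<M> Y Y'"
    and f: "f \<in> hom \<M> (ldual C (ldual C X) \<odot> M) (X \<odot> Y)"
  shows "mate X M Y' ((X \<rhd> g) \<bullet> f) = g \<bullet> mate X M Y f"
proof -
  note [simp] = calc X M M.homD[OF g] M.hom_objs[OF g] M.homD[OF f]
  note n = naturality[of "ev C X" g, simplified]
  show ?thesis by (simp add: mate_def precomp[OF n])
qed

text \<open>
  The arrow is given by a definite description, which is meaningful because \<open>X \<triangleright> -\<close> preserves the coend
  and its copowers.  Restricted to the universal family, the canonical arrow precomposes functionals with \<open>mate\<close>.
\<close>

lemma nak_act_iso:
  assumes X: "X \<in> obj C" and M: "M \<in> obj \<M>"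
  defines "G \<equiv> ldual C (ldual C X) \<odot> M"
  shows "nak_act_iso C \<M> cp N i X M \<in> hom \<M> (X \<odot> fobj N M) (fobj N G)"
    and "Y \<in> obj \<M> \<Longrightarrow> \<xi> \<in> hom_dual \<M> M Y \<Longrightarrow> nak_act_iso C \<M> cp N i X M \<bullet> (X \<rhd> j M Y \<xi>) =
      j G (X \<odot> Y) (hom_transpose \<M> G (X \<odot> Y) (mate X M Y) \<xi>)"
proof -
  note [simp] = calc X M
  have G [simp]: "G \<in> obj \<M>" by (simp add: G_def)
  have cp: "has_copowers \<M> cp" using coend by (simp add: nakayama_coend_def)
  note cop = M.copower_of_hom_dual[OF M.hom_finite cp]
  have ih: "i M Y \<in> hom \<M> (cpobj cp (hom_dual \<M> M Y) Y) (fobj N M)" if "M \<in> obj \<M>" "Y \<in> obj \<M>" for M Y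
    using coend that by (auto simp: nakayama_coend_def nak_dinatural_def)
  let ?T = "\<lambda>Y. hom_transpose \<M> G (X \<odot> Y) (mate X M Y)"
  have Tlin: "linear_on (hom_dual \<M> M Y) (hom_dual \<M> G (X \<odot> Y)) (?T Y)" if "Y \<in> obj \<M>" for Y
    using hom_transpose_linear[OF M.linear_category_axioms mate_linear[OF X M that]] by (simp add: G_def)
  have Tmem: "?T Y \<xi> \<in> hom_dual \<M> G (X \<odot> Y)" if "Y \<in> obj \<M>" "\<xi> \<in> hom_dual \<M> M Y" for Y \<xi>
    using Tlin[OF that(1)] that(2) by (simp add: linear_on_def)
  define c where "c Y = copower_induced \<M> (hom_dual \<M> M Y) (X \<odot> cpobj cp (hom_dual \<M> M Y) Y)
     (\<lambda>v. X \<rhd> cpunit cp (hom_dual \<M> M Y) Y v) (cpobj cp (hom_dual \<M> G (X \<odot> Y)) (X \<odot> Y))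
     (\<lambda>v. cpunit cp (hom_dual \<M> G (X \<odot> Y)) (X \<odot> Y) (?T Y v))" for Y
  have c: "c Y \<in> hom \<M> (X \<odot> cpobj cp (hom_dual \<M> M Y) Y) (cpobj cp (hom_dual \<M> G (X \<odot> Y)) (X \<odot> Y))"
    "\<xi> \<in> hom_dual \<M> M Y \<Longrightarrow> c Y \<bullet> (X \<rhd> cpunit cp (hom_dual \<M> M Y) Y \<xi>) =
      cpunit cp (hom_dual \<M> G (X \<odot> Y)) (X \<odot> Y) (?T Y \<xi>)" if Y: "Y \<in> obj \<M>" for Y \<xi>
  proof -
    note Q = cop[OF G act_obj[OF X Y] act_obj[OF X Y]]
    note k = M.copower_induced[OF whisker_copower[OF X cop[OF M Y Y] Y] M.is_copower_obj[OF Q]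
        linear_into_hom_comp[OF Tlin[OF Y] M.is_copower_lin[OF Q]]]
    show "c Y \<in> hom \<M> (X \<odot> cpobj cp (hom_dual \<M> M Y) Y) (cpobj cp (hom_dual \<M> G (X \<odot> Y)) (X \<odot> Y))"
      "\<xi> \<in> hom_dual \<M> M Y \<Longrightarrow> c Y \<bullet> (X \<rhd> cpunit cp (hom_dual \<M> M Y) Y \<xi>) =
      cpunit cp (hom_dual \<M> G (X \<odot> Y)) (X \<odot> Y) (?T Y \<xi>)" using k unfolding c_def by blast+
  qed
  have char: "f \<bullet> (X \<rhd> i M Y) = i G (X \<odot> Y) \<bullet> c Y \<longleftrightarrow>
      (\<forall>\<xi>\<in>hom_dual \<M> M Y. f \<bullet> (X \<rhd> j M Y \<xi>) = j G (X \<odot> Y) (?T Y \<xi>))"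
    if f: "f \<in> hom \<M> (X \<odot> fobj N M) (fobj N G)" and Y: "Y \<in> obj \<M>" for f Y
  proof -
    have u: "cpunit cp (hom_dual \<M> M Y) Y \<xi> \<in> hom \<M> Y (cpobj cp (hom_dual \<M> M Y) Y)"
      if "\<xi> \<in> hom_dual \<M> M Y" for \<xi>
      using M.is_copower_lin[OF cop[OF M Y Y]] that by (auto simp: linear_into_hom_def)
    have Xi: "X \<rhd> i M Y \<in> hom \<M> (X \<odot> cpobj cp (hom_dual \<M> M Y) Y) (X \<odot> fobj N M)"
      using M.homD[OF ih[OF M Y]] by (simp add: hom_def)
    have "(X \<rhd> i M Y) \<bullet> (X \<rhd> cpunit cp (hom_dual \<M> M Y) Y \<xi>) = X \<rhd> j M Y \<xi>"
      if "\<xi> \<in> hom_dual \<M> M Y" for \<xi>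
      using M.homD[OF u[OF that]] M.homD[OF ih[OF M Y]] by (simp add: j_def)
    then show ?thesis
      unfolding M.copower_arrow_eq[OF whisker_copower[OF X cop[OF M Y Y] Y] Xi f c(1)[OF Y] ih[OF G act_obj[OF X Y]]]
      by (intro ball_cong refl) (simp add: c(2)[OF Y] j_def)
  qed
  have iso_def: "nak_act_iso C \<M> cp N i X M = (THE f. f \<in> hom \<M> (X \<odot> fobj N M) (fobj N G) \<and>
      (\<forall>Y\<in>obj \<M>. f \<bullet> (X \<rhd> i M Y) = i G (X \<odot> Y) \<bullet> c Y))"
  proof -
    have "nak_t \<M> (act_func C \<M> (ldual C X)) (\<lambda>M. coev C (ldual C X) \<star> M) (\<lambda>M. ev C X \<star> M) M Y = mate X M Y"
      for Y by (simp add: fun_eq_iff nak_t_def mate_def act_func_def)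
    then show ?thesis
      by (simp add: nak_act_iso_def nak_phi_def act_func_def Let_def c_def G_def)
  qed
  obtain h where h: "h \<in> hom \<M> (X \<odot> fobj N M) (fobj N G)"
     "\<And>Y \<xi>. Y \<in> obj \<M> \<Longrightarrow> \<xi> \<in> hom_dual \<M> M Y \<Longrightarrow> h \<bullet> (X \<rhd> j M Y \<xi>) = j G (X \<odot> Y) (?T Y \<xi>)"
  proof -
    have "\<exists>h. h \<in> hom \<M> (X \<odot> fobj N M) (fobj N G) \<and> (\<forall>Y\<in>obj \<M>. \<forall>\<xi>\<in>hom_dual \<M> M Y.
        h \<bullet> (X \<rhd> j M Y \<xi>) = j G (X \<odot> Y) (?T Y \<xi>))"
    proof (rule whisker_coend_induced[OF N_coend M X N_objects[OF G]])
      fix Y assume Y: "Y \<in> obj \<M>"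
      show "linear_into_hom \<M> (hom_dual \<M> M Y) (X \<odot> Y) (fobj N G) (\<lambda>\<xi>. j G (X \<odot> Y) (?T Y \<xi>))"
        by (rule linear_into_hom_comp[OF Tlin[OF Y] j_linear[OF G act_obj[OF X Y]]])
    next
      fix Y Y' g \<xi> assume g: "g \<in> hom \<M> Y Y'" and \<xi>: "\<xi> \<in> hom_dual \<M> M Y'"
      note Y = M.hom_objs[OF g]
      have Xg: "X \<rhd> g \<in> hom \<M> (X \<odot> Y) (X \<odot> Y')" using M.homD[OF g] by (simp add: hom_def)
      have m: "mate X M Y f \<in> hom \<M> M Y" if "f \<in> hom \<M> G (X \<odot> Y)" for f
        using mate_linear[OF X M Y(1)] that by (simp add: linear_between_def G_def)
      have "?T Y (hom_transpose \<M> M Y (\<lambda>f. g \<bullet> f) \<xi>) = hom_transpose \<M> G (X \<odot> Y) (\<lambda>f. g \<bullet> mate X M Y f) \<xi>"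
        by (rule hom_transpose_comp[OF m])
      also have "\<dots> = hom_transpose \<M> G (X \<odot> Y) (\<lambda>f. mate X M Y' ((X \<rhd> g) \<bullet> f)) \<xi>"
        by (rule hom_transpose_cong) (simp add: mate_natural[OF X M g] G_def)
      also have "\<dots> = hom_transpose \<M> G (X \<odot> Y) (\<lambda>f. (X \<rhd> g) \<bullet> f) (?T Y' \<xi>)"
        by (rule hom_transpose_comp[symmetric]) (rule M.cmp_hom[OF _ Xg])
      finally show "j G (X \<odot> Y) (?T Y (hom_transpose \<M> M Y (\<lambda>f. g \<bullet> f) \<xi>)) =
          j G (X \<odot> Y') (?T Y' \<xi>) \<bullet> (X \<rhd> g)"
        using j_dinatural[OF G Xg Tmem[OF Y(2) \<xi>]] by simp
    qed
    then show ?thesis using that by blast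
  qed
  have "\<exists>!f. f \<in> hom \<M> (X \<odot> fobj N M) (fobj N G) \<and> (\<forall>Y\<in>obj \<M>. f \<bullet> (X \<rhd> i M Y) = i G (X \<odot> Y) \<bullet> c Y)"
  proof (intro ex1I[of _ h] conjI ballI)
    show "h \<in> hom \<M> (X \<odot> fobj N M) (fobj N G)" by (rule h(1))
    show "h \<bullet> (X \<rhd> i M Y) = i G (X \<odot> Y) \<bullet> c Y" if "Y \<in> obj \<M>" for Y
      using char[OF h(1) that] h(2)[OF that] by blast
    fix f assume f: "f \<in> hom \<M> (X \<odot> fobj N M) (fobj N G) \<and> (\<forall>Y\<in>obj \<M>. f \<bullet> (X \<rhd> i M Y) = i G (X \<odot> Y) \<bullet> c Y)"
    show "f = h"
      by (rule whisker_coend_ext[OF N_coend M X _ h(1)]) (use f char h(2) in auto)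
  qed
  from theI'[OF this] have it: "nak_act_iso C \<M> cp N i X M \<in> hom \<M> (X \<odot> fobj N M) (fobj N G)"
    "\<And>Y. Y \<in> obj \<M> \<Longrightarrow> nak_act_iso C \<M> cp N i X M \<bullet> (X \<rhd> i M Y) = i G (X \<odot> Y) \<bullet> c Y"
    unfolding iso_def by blast+
  show "nak_act_iso C \<M> cp N i X M \<in> hom \<M> (X \<odot> fobj N M) (fobj N G)" by (rule it(1))
  show "Y \<in> obj \<M> \<Longrightarrow> \<xi> \<in> hom_dual \<M> M Y \<Longrightarrow> nak_act_iso C \<M> cp N i X M \<bullet> (X \<rhd> j M Y \<xi>) =
      j G (X \<odot> Y) (?T Y \<xi>)" using char[OF it(1)] it(2) by blast
qed

end

lemma linear_between_comp:
  assumes "linear_between C X Y D X' Y' T" "linear_between D X' Y' E X'' Y'' S"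
  shows "linear_between C X Y E X'' Y'' (\<lambda>f. S (T f))"
  using assms by (auto simp: linear_between_def)

locale nakayama_algebra = module_category_with_algebra C \<M> A + nakayama_module_category C \<M> cp N i
  for C :: "('c, 'd, 'k::field, 'z) moncat_scheme"
    and \<M> :: "('c, 'd, 'o, 'm, 'k, 'y) modcat_scheme"
    and A :: "('c, 'd) algebra_in"
    and cp :: "('o, 'm, 'k) copow" and N :: "('o, 'm, 'o, 'm) func" and i :: "'o \<Rightarrow> 'o \<Rightarrow> 'm"
begin

definition nak_action :: "'o \<Rightarrow> 'm \<Rightarrow> 'm" where
  "nak_action M a = farr N a \<bullet> nak_act_iso C \<M> cp N i \<A> M"

text \<open>
  On the universal family, the lifted action precomposes functionals with \<open>comate\<close>
  (\<open>nak_action_j\<close>).  By \<open>comate_eq\<close> it involves only the coaction, so that the module axioms for the lifted action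
  follow from the comodule axioms.
\<close>

definition comate :: "'o \<Rightarrow> 'm \<Rightarrow> 'o \<Rightarrow> 'm \<Rightarrow> 'm" where
  "comate M a X f = mate \<A> M X (f \<bullet> a)"

lemma ddModD_hom: "(M, a) \<in> obj ddMod \<Longrightarrow> a \<in> hom \<M> (ddA \<odot> M) M"
  using ddModD by (simp add: hom_def)

lemma nak_action_hom:
  assumes "(M, a) \<in> obj ddMod"
  shows "nak_action M a \<in> hom \<M> (\<A> \<odot> fobj N M) (fobj N M)"
  unfolding nak_action_def
  by (rule M.cmp_hom[OF nak_act_iso(1)[OF _ ddModD(1)[OF assms]] N_arrows[OF ddModD_hom[OF assms]]]) simp

lemma comate_eq:
  assumes a: "(M, a) \<in> obj ddMod" and X: "X \<in> obj \<M>" and f: "f \<in> hom \<M> M (\<A> \<odot> X)"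
  shows "comate M a X f = (ev C \<A> \<star> X) \<bullet> (dA \<rhd> f) \<bullet> coaction M a"
proof -
  note [simp] = alg_calc X M.homD[OF f] ddModD(1-4)[OF a]
  show ?thesis by (simp add: comate_def mate_def coaction_def)
qed

lemma comate_linear:
  assumes a: "(M, a) \<in> obj ddMod" and X: "X \<in> obj \<M>"
  shows "linear_between \<M> M (\<A> \<odot> X) \<M> M X (comate M a X)"
  unfolding comate_def
  by (rule linear_between_comp[OF M.linear_between_pre[OF ddModD_hom[OF a]]
        mate_linear[OF algebra_typing(1) ddModD(1)[OF a] X]])

lemma comate_hom:
  "(M, a) \<in> obj ddMod \<Longrightarrow> X \<in> obj \<M> \<Longrightarrow> f \<in> hom \<M> M (\<A> \<odot> X) \<Longrightarrow> comate M a X f \<in> hom \<M> M X"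
  using comate_linear by (simp add: linear_between_def)

lemma comate_transpose:
  assumes "(M, a) \<in> obj ddMod" "X \<in> obj \<M>" "\<xi> \<in> hom_dual \<M> M X"
  shows "hom_transpose \<M> M (\<A> \<odot> X) (comate M a X) \<xi> \<in> hom_dual \<M> M (\<A> \<odot> X)"
  using hom_transpose_linear[OF M.linear_category_axioms comate_linear[OF assms(1,2)]] assms(3)
  by (simp add: linear_on_def)

lemma nak_action_j:
  assumes a: "(M, a) \<in> obj ddMod" and X: "X \<in> obj \<M>" and \<xi>: "\<xi> \<in> hom_dual \<M> M X"
  shows "nak_action M a \<bullet> (\<A> \<rhd> j M X \<xi>) =
    j M (\<A> \<odot> X) (hom_transpose \<M> M (\<A> \<odot> X) (comate M a X) \<xi>)"
proof -
  note a' = ddModD(1-4)[OF a] and ah = ddModD_hom[OF a]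
  note it = nak_act_iso[OF algebra_typing(1) a'(1)]
  let ?z = "hom_transpose \<M> (ddA \<odot> M) (\<A> \<odot> X) (mate \<A> M X) \<xi>"
  have z: "?z \<in> hom_dual \<M> (ddA \<odot> M) (\<A> \<odot> X)"
    using hom_transpose_linear[OF M.linear_category_axioms mate_linear[OF algebra_typing(1) a'(1) X]] \<xi>
    by (simp add: linear_on_def)
  have jh: "\<A> \<rhd> j M X \<xi> \<in> hom \<M> (\<A> \<odot> X) (\<A> \<odot> fobj N M)"
    using M.homD[OF j_hom[OF a'(1) X \<xi>]] by (simp add: hom_def calc)
  have "nak_action M a \<bullet> (\<A> \<rhd> j M X \<xi>) = farr N a \<bullet> (nak_act_iso C \<M> cp N i \<A> M \<bullet> (\<A> \<rhd> j M X \<xi>))"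
    unfolding nak_action_def by (rule M.cmp_assoc[OF jh it(1) N_arrows[OF ah]])
  also have "\<dots> = farr N a \<bullet> j (ddA \<odot> M) (\<A> \<odot> X) ?z" by (simp add: it(2)[OF X \<xi>])
  also have "\<dots> = j M (\<A> \<odot> X) (hom_transpose \<M> M (\<A> \<odot> X) (\<lambda>g. g \<bullet> a) ?z)"
    by (rule dual_coend_natural[OF N_coend ah act_obj[OF algebra_typing(1) X] z])
  also have "hom_transpose \<M> M (\<A> \<odot> X) (\<lambda>g. g \<bullet> a) ?z = hom_transpose \<M> M (\<A> \<odot> X) (comate M a X) \<xi>"
    unfolding comate_def by (rule hom_transpose_comp) (rule M.cmp_hom[OF ah])
  finally show ?thesis .
qed

lemma comate_assoc:
  assumes a: "(M, a) \<in> obj ddMod" and X: "X \<in> obj \<M>" and f: "f \<in> hom \<M> M (\<A> \<odot> \<A> \<odot> X)"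
  shows "comate M a X (comate M a (\<A> \<odot> X) f) = comate M a X ((mul \<star> X) \<bullet> f)"
proof -
  note [simp] = alg_calc X M.homD[OF f] ddModD(1-4)[OF a] coaction_typing[OF a]
  have mulhom: "mul \<in> hom C (\<A> \<otimes>\<^sub>o\<^bsub>C\<^esub> \<A>) \<A>" by (simp add: hom_def)
  have AX: "\<A> \<odot> X \<in> obj \<M>" by simp
  have mf: "(mul \<star> X) \<bullet> f \<in> hom \<M> M (\<A> \<odot> X)" by (simp add: hom_def)
  note e = dual_ev[OF mulhom X, simplified]
  note n = naturality[of dmul f, simplified]
  have ee: "ev C (\<A> \<otimes>\<^sub>o\<^bsub>C\<^esub> \<A>) \<star> X = (ev C \<A> \<star> X) \<bullet> (dA \<rhd> (ev C \<A> \<star> (\<A> \<odot> X)))"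
    by (simp add: C.ev_tobj)
  show ?thesis
    unfolding comate_eq[OF a X comate_hom[OF a AX f]] comate_eq[OF a X mf]
    by (simp add: comate_eq[OF a AX f] coaction_comodule(1)[OF a] C.ldual_tobj precomp[OF n[symmetric]] precomp[OF e[symmetric]] ee)
qed

lemma comate_unit:
  assumes a: "(M, a) \<in> obj ddMod" and X: "X \<in> obj \<M>" and f: "f \<in> hom \<M> M X"
  shows "comate M a X ((un \<star> X) \<bullet> f) = f"
proof -
  note [simp] = alg_calc X M.homD[OF f] ddModD(1-4)[OF a] coaction_typing[OF a]
  have unhom: "un \<in> hom C (one C) \<A>" by (simp add: hom_def)
  have uf: "(un \<star> X) \<bullet> f \<in> hom \<M> M (\<A> \<odot> X)" by (simp add: hom_def)
  note e = dual_ev[OF unhom X, simplified]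
  note n = naturality[of dun f, simplified]
  have e': "(ev C \<A> \<star> X) \<bullet> (dA \<rhd> (un \<star> X)) = dun \<star> X" using e by (simp add: C.ev_one)
  show ?thesis
    by (simp add: comate_eq[OF a X uf] precomp[OF e'] precomp[OF n] coaction_comodule(2)[OF a])
qed

lemma comate_natural:
  assumes f: "((M, a), f, (M', a')) \<in> hom ddMod (M, a) (M', a')" and X: "X \<in> obj \<M>"
    and g: "g \<in> hom \<M> M' (\<A> \<odot> X)"
  shows "comate M a X (g \<bullet> f) = comate M' a' X g \<bullet> f"
proof -
  have ma: "(M, a) \<in> obj ddMod" "(M', a') \<in> obj ddMod" and fh: "f \<in> hom \<M> M M'"
    and eq: "f \<bullet> a = a' \<bullet> (ddA \<rhd> f)" using f by (auto simp: alg_module_hom_iff lldual_algebra_simps)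
  note [simp] = alg_calc X M.homD[OF fh] M.homD[OF g] ddModD(1-4)[OF ma(1)] ddModD(1-4)[OF ma(2)]
  note n = naturality[of "coev C dA" f, simplified]
  show ?thesis by (simp add: comate_def mate_def n precomp[OF whisk[OF eq]] whisk[OF eq])
qed

text \<open>
  Both axioms are equations between arrows out of \<open>A \<triangleright> A \<triangleright> N M\<close> or \<open>N M\<close>, which can be tested on
  the universal family.  There they are \<open>comate_assoc\<close> and \<open>comate_unit\<close>.
\<close>

lemma nak_lift_module:
  assumes a: "(M, a) \<in> obj ddMod"
  shows "(fobj N M, nak_action M a) \<in> obj Mod"
proof -
  note a' = ddModD(1-4)[OF a]
  let ?n = "nak_action M a"
  note [simp] = alg_calc a' M.homD[OF nak_action_hom[OF a]]
  have AA: "\<A> \<otimes>\<^sub>o\<^bsub>C\<^esub> \<A> \<in> obj C" by simp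
  show ?thesis
  proof (rule ModI)
    show "?n \<bullet> (\<A> \<rhd> ?n) = ?n \<bullet> (mul \<star> fobj N M)"
    proof (rule whisker_coend_ext[OF N_coend a'(1) AA])
      show "?n \<bullet> (\<A> \<rhd> ?n) \<in> hom \<M> ((\<A> \<otimes>\<^sub>o\<^bsub>C\<^esub> \<A>) \<odot> fobj N M) (fobj N M)"
        "?n \<bullet> (mul \<star> fobj N M) \<in> hom \<M> ((\<A> \<otimes>\<^sub>o\<^bsub>C\<^esub> \<A>) \<odot> fobj N M) (fobj N M)"
        by (simp_all add: hom_def)
      fix Y \<xi> assume Y: "Y \<in> obj \<M>" and \<xi>: "\<xi> \<in> hom_dual \<M> M Y"
      note [simp] = Y M.homD[OF j_hom[OF a'(1) Y \<xi>]]
      have AY: "\<A> \<odot> Y \<in> obj \<M>" by simp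
      let ?\<xi>1 = "hom_transpose \<M> M (\<A> \<odot> Y) (comate M a Y) \<xi>"
      note \<xi>1 = comate_transpose[OF a Y \<xi>]
      note act1 = nak_action_j[OF a Y \<xi>] and act2 = nak_action_j[OF a AY \<xi>1]
      note n = naturality[of mul "j M Y \<xi>", simplified]
      have m: "mul \<star> Y \<in> hom \<M> (\<A> \<odot> \<A> \<odot> Y) (\<A> \<odot> Y)" by (simp add: hom_def)
      have "(?n \<bullet> (\<A> \<rhd> ?n)) \<bullet> ((\<A> \<otimes>\<^sub>o\<^bsub>C\<^esub> \<A>) \<rhd> j M Y \<xi>) = ?n \<bullet> (\<A> \<rhd> (?n \<bullet> (\<A> \<rhd> j M Y \<xi>)))"
        by simp
      also have "\<dots> = j M (\<A> \<odot> \<A> \<odot> Y) (hom_transpose \<M> M (\<A> \<odot> \<A> \<odot> Y) (comate M a (\<A> \<odot> Y)) ?\<xi>1)"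
        unfolding act1 act2 ..
      also have "hom_transpose \<M> M (\<A> \<odot> \<A> \<odot> Y) (comate M a (\<A> \<odot> Y)) ?\<xi>1 =
          hom_transpose \<M> M (\<A> \<odot> \<A> \<odot> Y) (\<lambda>f. comate M a Y (comate M a (\<A> \<odot> Y) f)) \<xi>"
        by (rule hom_transpose_comp) (rule comate_hom[OF a AY])
      also have "\<dots> = hom_transpose \<M> M (\<A> \<odot> \<A> \<odot> Y) (\<lambda>f. comate M a Y ((mul \<star> Y) \<bullet> f)) \<xi>"
        by (rule hom_transpose_cong) (rule comate_assoc[OF a Y])
      also have "\<dots> = hom_transpose \<M> M (\<A> \<odot> \<A> \<odot> Y) (\<lambda>f. (mul \<star> Y) \<bullet> f) ?\<xi>1"
        by (rule hom_transpose_comp[symmetric]) (rule M.cmp_hom[OF _ m])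
      also have "j M (\<A> \<odot> \<A> \<odot> Y) \<dots> = j M (\<A> \<odot> Y) ?\<xi>1 \<bullet> (mul \<star> Y)"
        by (rule j_dinatural[OF a'(1) m \<xi>1])
      also have "\<dots> = (?n \<bullet> (\<A> \<rhd> j M Y \<xi>)) \<bullet> (mul \<star> Y)" unfolding act1 ..
      also have "\<dots> = (?n \<bullet> (mul \<star> fobj N M)) \<bullet> ((\<A> \<otimes>\<^sub>o\<^bsub>C\<^esub> \<A>) \<rhd> j M Y \<xi>)" by (simp add: n)
      finally show "(?n \<bullet> (\<A> \<rhd> ?n)) \<bullet> ((\<A> \<otimes>\<^sub>o\<^bsub>C\<^esub> \<A>) \<rhd> j M Y \<xi>) =
        (?n \<bullet> (mul \<star> fobj N M)) \<bullet> ((\<A> \<otimes>\<^sub>o\<^bsub>C\<^esub> \<A>) \<rhd> j M Y \<xi>)" .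
    qed
    show "?n \<bullet> (un \<star> fobj N M) = ide \<M> (fobj N M)"
    proof (rule M.dual_coend_ext[OF N_coend a'(1)])
      show "?n \<bullet> (un \<star> fobj N M) \<in> hom \<M> (fobj N M) (fobj N M)"
        "ide \<M> (fobj N M) \<in> hom \<M> (fobj N M) (fobj N M)" by (simp_all add: hom_def)
      fix Y \<xi> assume Y: "Y \<in> obj \<M>" and \<xi>: "\<xi> \<in> hom_dual \<M> M Y"
      note [simp] = Y M.homD[OF j_hom[OF a'(1) Y \<xi>]]
      let ?\<xi>1 = "hom_transpose \<M> M (\<A> \<odot> Y) (comate M a Y) \<xi>"
      note \<xi>1 = comate_transpose[OF a Y \<xi>] and act1 = nak_action_j[OF a Y \<xi>]
      note n = naturality[of un "j M Y \<xi>", simplified]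
      have m: "un \<star> Y \<in> hom \<M> Y (\<A> \<odot> Y)" by (simp add: hom_def)
      have "(?n \<bullet> (un \<star> fobj N M)) \<bullet> j M Y \<xi> = (?n \<bullet> (\<A> \<rhd> j M Y \<xi>)) \<bullet> (un \<star> Y)" by (simp add: n)
      also have "\<dots> = j M Y (hom_transpose \<M> M Y (\<lambda>f. (un \<star> Y) \<bullet> f) ?\<xi>1)"
        unfolding act1 by (rule j_dinatural[OF a'(1) m \<xi>1, symmetric])
      also have "hom_transpose \<M> M Y (\<lambda>f. (un \<star> Y) \<bullet> f) ?\<xi>1 =
          hom_transpose \<M> M Y (\<lambda>f. comate M a Y ((un \<star> Y) \<bullet> f)) \<xi>"
        by (rule hom_transpose_comp) (rule M.cmp_hom[OF _ m])
      also have "\<dots> = \<xi>" by (rule hom_transpose_ident[OF \<xi>]) (rule comate_unit[OF a Y])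
      finally show "(?n \<bullet> (un \<star> fobj N M)) \<bullet> j M Y \<xi> = ide \<M> (fobj N M) \<bullet> j M Y \<xi>" by simp
    qed
  qed simp_all
qed

lemma nak_action_natural:
  assumes f: "((M, a), f, (M', a')) \<in> hom ddMod (M, a) (M', a')"
  shows "farr N f \<bullet> nak_action M a = nak_action M' a' \<bullet> (\<A> \<rhd> farr N f)"
proof -
  have a: "(M, a) \<in> obj ddMod" and a': "(M', a') \<in> obj ddMod" and fh: "f \<in> hom \<M> M M'"
    using f by (auto simp: alg_module_hom_iff)
  note M = ddModD(1)[OF a] ddModD(1)[OF a']
  note [simp] = alg_calc M M.homD[OF nak_action_hom[OF a]] M.homD[OF nak_action_hom[OF a']]
    M.homD[OF N_arrows[OF fh]]
  show ?thesis
  proof (rule whisker_coend_ext[OF N_coend M(1) algebra_typing(1)])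
    show "farr N f \<bullet> nak_action M a \<in> hom \<M> (\<A> \<odot> fobj N M) (fobj N M')"
      "nak_action M' a' \<bullet> (\<A> \<rhd> farr N f) \<in> hom \<M> (\<A> \<odot> fobj N M) (fobj N M')"
      by (simp_all add: hom_def)
    fix Y \<xi> assume Y: "Y \<in> obj \<M>" and \<xi>: "\<xi> \<in> hom_dual \<M> M Y"
    note [simp] = Y M.homD[OF j_hom[OF M(1) Y \<xi>]]
    let ?\<xi>f = "hom_transpose \<M> M' Y (\<lambda>g. g \<bullet> f) \<xi>"
    let ?\<xi>1 = "hom_transpose \<M> M (\<A> \<odot> Y) (comate M a Y) \<xi>"
    note \<xi>f = M.dual_transport_pre[OF fh \<xi>]
    have AY: "\<A> \<odot> Y \<in> obj \<M>" by simp
    have "(farr N f \<bullet> nak_action M a) \<bullet> (\<A> \<rhd> j M Y \<xi>) = farr N f \<bullet> (nak_action M a \<bullet> (\<A> \<rhd> j M Y \<xi>))"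
      by simp
    also have "\<dots> = j M' (\<A> \<odot> Y) (hom_transpose \<M> M' (\<A> \<odot> Y) (\<lambda>g. g \<bullet> f) ?\<xi>1)"
      unfolding nak_action_j[OF a Y \<xi>]
      by (rule dual_coend_natural[OF N_coend fh AY comate_transpose[OF a Y \<xi>]])
    also have "hom_transpose \<M> M' (\<A> \<odot> Y) (\<lambda>g. g \<bullet> f) ?\<xi>1 =
        hom_transpose \<M> M' (\<A> \<odot> Y) (\<lambda>g. comate M a Y (g \<bullet> f)) \<xi>"
      by (rule hom_transpose_comp) (rule M.cmp_hom[OF fh])
    also have "\<dots> = hom_transpose \<M> M' (\<A> \<odot> Y) (\<lambda>g. comate M' a' Y g \<bullet> f) \<xi>"
      by (rule hom_transpose_cong) (rule comate_natural[OF f Y])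
    also have "\<dots> = hom_transpose \<M> M' (\<A> \<odot> Y) (comate M' a' Y) ?\<xi>f"
      by (rule hom_transpose_comp[symmetric]) (rule comate_hom[OF a' Y])
    also have "j M' (\<A> \<odot> Y) \<dots> = nak_action M' a' \<bullet> (\<A> \<rhd> j M' Y ?\<xi>f)"
      by (rule nak_action_j[OF a' Y \<xi>f, symmetric])
    also have "j M' Y ?\<xi>f = farr N f \<bullet> j M Y \<xi>"
      by (rule dual_coend_natural[OF N_coend fh Y \<xi>, symmetric])
    finally show "(farr N f \<bullet> nak_action M a) \<bullet> (\<A> \<rhd> j M Y \<xi>) =
        (nak_action M' a' \<bullet> (\<A> \<rhd> farr N f)) \<bullet> (\<A> \<rhd> j M Y \<xi>)" by simp
  qed
qed

lemma nak_lift_functor: "is_functor ddMod Mod (nak_lift_func C \<M> cp N i A)"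
proof -
  have "is_functor ddMod Mod
    \<lparr>fobj = (\<lambda>p. (fobj N (fst p), nak_action (fst p) (snd p))),
     farr = (\<lambda>(p, f, q). ((fobj N (fst p), nak_action (fst p) (snd p)),
       farr N f, (fobj N (fst q), nak_action (fst q) (snd q))))\<rparr>"
    by (rule lifted_functor[OF dual_coend_functor[OF N_coend]])
      (simp_all add: nak_lift_module nak_action_natural)
  then show ?thesis by (simp add: nak_lift_func_def nak_action_def Let_def)
qed

end

section \<open>The linear category of modules\<close>

context module_category_with_algebra
begin

lemma Mod_homI:
  assumes "p \<in> obj Mod" "q \<in> obj Mod" "f \<in> hom \<M> (fst p) (fst q)" "f \<bullet> snd p = snd q \<bullet> (\<A> \<rhd> f)"
  shows "(p, f, q) \<in> hom Mod p q"
  using assms by (simp add: alg_module_hom_iff)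

lemma Mod_homE:
  assumes "t \<in> hom Mod p q"
  obtains f where "t = (p, f, q)" "p \<in> obj Mod" "q \<in> obj Mod" "f \<in> hom \<M> (fst p) (fst q)"
    "f \<bullet> snd p = snd q \<bullet> (\<A> \<rhd> f)"
  using assms by (rule alg_module_homE)

lemma Mod_hom_eqI: "s \<in> hom Mod p q \<Longrightarrow> t \<in> hom Mod p q \<Longrightarrow> fst (snd s) = fst (snd t) \<Longrightarrow> s = t"
  by (auto elim!: Mod_homE)

lemma Mod_und: "t \<in> hom Mod p q \<Longrightarrow> fst (snd t) \<in> hom \<M> (fst p) (fst q)"
  "t \<in> hom Mod p q \<Longrightarrow> fst (snd t) \<bullet> snd p = snd q \<bullet> (\<A> \<rhd> fst (snd t))"
  "t \<in> hom Mod p q \<Longrightarrow> t = (p, fst (snd t), q)"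
  by (auto elim!: Mod_homE)

lemma Mod_objD: "p \<in> obj Mod \<Longrightarrow> fst p \<in> obj \<M>" "p \<in> obj Mod \<Longrightarrow> snd p \<in> hom \<M> (\<A> \<odot> fst p) (fst p)"
  by (cases p; simp add: alg_module_iff)+

lemma Mod_arrD: "t \<in> arr Mod \<Longrightarrow> t \<in> hom Mod (fst t) (snd (snd t))"
  by (auto simp: hom_def alg_module_cat_def monad_module_cat_def)

lemma whisker_zer: "X \<in> obj C \<Longrightarrow> Y \<in> obj \<M> \<Longrightarrow> Z \<in> obj \<M> \<Longrightarrow> X \<rhd> zer \<M> Y Z = zer \<M> (X \<odot> Y) (X \<odot> Z)"
  using act_scl_right[OF C.homD(1)[OF C.ide_hom[of X]] M.homD(1)[OF M.zer_hom[of Y Z]], of 0]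
    M.scl_zero[OF act_hom[OF C.ide_hom[of X] M.zer_hom[of Y Z]]] M.scl_zero[OF M.zer_hom[of Y Z]] by simp

lemma Mod_ide_hom: "p \<in> obj Mod \<Longrightarrow> ide Mod p \<in> hom Mod p p"
proof -
  assume p: "p \<in> obj Mod"
  have "ide \<M> (fst p) \<bullet> snd p = snd p \<bullet> (\<A> \<rhd> ide \<M> (fst p))"
    using M.cmp_ide_left[OF Mod_objD(2)[OF p]] M.cmp_ide_right[OF Mod_objD(2)[OF p]] Mod_objD(1)[OF p]
    by (simp add: act_ide)
  then show ?thesis
    unfolding alg_module_cat_simps by (rule Mod_homI[OF p p M.ide_hom[OF Mod_objD(1)[OF p]]])
qed

lemma Mod_cmp_hom:
  assumes s: "s \<in> hom Mod p q" and t: "t \<in> hom Mod q r" shows "t \<cdot>\<^bsub>Mod\<^esub> s \<in> hom Mod p r"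
proof -
  obtain f where f: "s = (p, f, q)" "p \<in> obj Mod" "q \<in> obj Mod" "f \<in> hom \<M> (fst p) (fst q)"
    "f \<bullet> snd p = snd q \<bullet> (\<A> \<rhd> f)" using s by (rule Mod_homE)
  obtain g where g: "t = (q, g, r)" "r \<in> obj Mod" "g \<in> hom \<M> (fst q) (fst r)"
    "g \<bullet> snd q = snd r \<bullet> (\<A> \<rhd> g)" using t by (rule Mod_homE)
  note [simp] = calc M.homD[OF f(4)] M.homD[OF g(3)] M.homD[OF Mod_objD(2)[OF f(2)]]
    M.homD[OF Mod_objD(2)[OF f(3)]] M.homD[OF Mod_objD(2)[OF g(2)]]
  have "(g \<bullet> f) \<bullet> snd p = snd r \<bullet> (\<A> \<rhd> (g \<bullet> f))" by (simp add: f(5) precomp[OF g(4)])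
  then show ?thesis
    unfolding f(1) g(1) alg_module_cat_simps fst_conv snd_conv
    by (intro Mod_homI f(2) g(2) M.cmp_hom[OF f(4) g(3)])
qed

lemma Mod_add_hom:
  assumes s: "s \<in> hom Mod p q" and t: "t \<in> hom Mod p q" shows "s \<oplus>\<^bsub>Mod\<^esub> t \<in> hom Mod p q"
proof -
  obtain f where f: "s = (p, f, q)" "p \<in> obj Mod" "q \<in> obj Mod" "f \<in> hom \<M> (fst p) (fst q)"
    "f \<bullet> snd p = snd q \<bullet> (\<A> \<rhd> f)" using s by (rule Mod_homE)
  obtain g where g: "t = (p, g, q)" "g \<in> hom \<M> (fst p) (fst q)"
    "g \<bullet> snd p = snd q \<bullet> (\<A> \<rhd> g)" using t by (rule Mod_homE)
  note w = act_hom[OF C.ide_hom[OF algebra_typing(1)] f(4)] act_hom[OF C.ide_hom[OF algebra_typing(1)] g(2)]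
  have "(f \<oplus>\<^bsub>\<M>\<^esub> g) \<bullet> snd p = snd q \<bullet> (\<A> \<rhd> (f \<oplus>\<^bsub>\<M>\<^esub> g))"
    by (simp add: M.cmp_add_left[OF Mod_objD(2)[OF f(2)] f(4) g(2)] f(5) g(3)
        act_add_right[OF C.homD(1)[OF C.ide_hom[OF algebra_typing(1)]] f(4) g(2)]
        M.cmp_add_right[OF w Mod_objD(2)[OF f(3)]])
  then show ?thesis
    unfolding f(1) g(1) alg_module_cat_simps fst_conv snd_conv
    by (intro Mod_homI f(2,3) M.add_hom[OF f(4) g(2)])
qed

lemma Mod_scl_hom:
  assumes s: "s \<in> hom Mod p q" shows "scl Mod c s \<in> hom Mod p q"
proof -
  obtain f where f: "s = (p, f, q)" "p \<in> obj Mod" "q \<in> obj Mod" "f \<in> hom \<M> (fst p) (fst q)"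
    "f \<bullet> snd p = snd q \<bullet> (\<A> \<rhd> f)" using s by (rule Mod_homE)
  note w = act_hom[OF C.ide_hom[OF algebra_typing(1)] f(4)]
  have "scl \<M> c f \<bullet> snd p = snd q \<bullet> (\<A> \<rhd> scl \<M> c f)"
    by (simp add: M.cmp_scl_left[OF Mod_objD(2)[OF f(2)] f(4)] f(5)
        act_scl_right[OF C.homD(1)[OF C.ide_hom[OF algebra_typing(1)]] M.homD(1)[OF f(4)]]
        M.cmp_scl_right[OF w Mod_objD(2)[OF f(3)]])
  then show ?thesis
    unfolding f(1) alg_module_cat_simps fst_conv snd_conv
    by (intro Mod_homI f(2,3) M.scl_hom[OF f(4)])
qed

lemma Mod_zer_hom:
  assumes p: "p \<in> obj Mod" and q: "q \<in> obj Mod" shows "zer Mod p q \<in> hom Mod p q"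
proof -
  have "zer \<M> (fst p) (fst q) \<bullet> snd p = snd q \<bullet> (\<A> \<rhd> zer \<M> (fst p) (fst q))"
    using M.cmp_zer_left[OF Mod_objD(2)[OF p] Mod_objD(1)[OF q]]
      M.cmp_zer_right[OF Mod_objD(2)[OF q] act_obj[OF algebra_typing(1) Mod_objD(1)[OF p]]]
    by (simp add: whisker_zer Mod_objD(1)[OF p] Mod_objD(1)[OF q])
  then show ?thesis
    unfolding alg_module_cat_simps
    by (intro Mod_homI p q M.zer_hom Mod_objD(1)[OF p] Mod_objD(1)[OF q])
qed

lemma Mod_linear_category: "linear_category Mod"
proof (unfold_locales, goal_cases)
  case (1 f)
  have "fst f \<in> obj Mod" using Mod_arrD[OF 1] by (rule Mod_homE)
  then show ?case using Mod_arrD[OF 1] by (simp add: hom_def)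
next
  case (2 f)
  have "snd (snd f) \<in> obj Mod" using Mod_arrD[OF 2] by (rule Mod_homE)
  then show ?case using Mod_arrD[OF 2] by (simp add: hom_def)
next
  case (3 X) then show ?case by (rule Mod_ide_hom)
next
  case (4 f X Y g Z) then show ?case by (rule Mod_cmp_hom)
next
  case (8 f X Y g) then show ?case by (rule Mod_add_hom)
next
  case (9 X Y) then show ?case by (rule Mod_zer_hom)
next
  case (10 f X Y c) then show ?case by (rule Mod_scl_hom)
next
  case (12 f X Y g)
  show ?case
    using M.add_comm[OF Mod_und(1)[OF 12(1)] Mod_und(1)[OF 12(2)]]
    by (intro Mod_hom_eqI[OF Mod_add_hom[OF 12] Mod_add_hom[OF 12(2,1)]]) (simp add: alg_module_cat_simps)
next
  case (13 f X Y)
  then have "zer Mod X Y \<in> hom Mod X Y" by (auto elim!: Mod_homE intro: Mod_zer_hom)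
  then show ?case
    using M.add_zer[OF Mod_und(1)[OF 13]]
    by (intro Mod_hom_eqI[OF Mod_add_hom[OF 13] 13]) (simp_all add: alg_module_cat_simps)
next
  case (14 f X Y)
  then have z: "zer Mod X Y \<in> hom Mod X Y" by (auto elim!: Mod_homE intro: Mod_zer_hom)
  note u = Mod_und(1)[OF 14]
  have "fst (snd f) \<oplus>\<^bsub>\<M>\<^esub> scl \<M> (-1) (fst (snd f)) = scl \<M> (1 + -1) (fst (snd f))"
    using M.scl_add_left[OF u, of 1 "-1"] M.scl_one[OF u] by simp
  also have "\<dots> = zer \<M> (fst X) (fst Y)" using M.scl_zero[OF u] by simp
  finally have "f \<oplus>\<^bsub>Mod\<^esub> scl Mod (-1) f = zer Mod X Y"
    by (intro Mod_hom_eqI[OF Mod_add_hom[OF 14 Mod_scl_hom[OF 14]] z]) (simp add: alg_module_cat_simps)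
  then show ?case using Mod_scl_hom[OF 14] by blast
qed (auto elim!: Mod_homE simp: alg_module_cat_simps M.cmp_ide_left M.cmp_ide_right M.cmp_assoc
    M.add_assoc M.scl_one M.scl_scl M.scl_add_left M.scl_add_right M.cmp_add_left M.cmp_add_right
    M.cmp_scl_left M.cmp_scl_right)

text \<open>
  Module arrows form a subspace of the arrows in \<open>\<M>\<close>, and functionals can be restricted to it.
\<close>

lemma Mod_hom_finite: "hom_finite Mod"
  unfolding hom_finite_def
proof (intro ballI)
  fix p q assume p: "p \<in> obj Mod" and q: "q \<in> obj Mod"
  obtain \<Phi> where \<Phi>: "finite \<Phi>" "\<Phi> \<subseteq> hom_dual \<M> (fst p) (fst q)"
      "\<And>f. f \<in> hom \<M> (fst p) (fst q) \<Longrightarrow> (\<forall>\<xi>\<in>\<Phi>. \<xi> f = 0) \<Longrightarrow> f = zer \<M> (fst p) (fst q)"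
    using M.hom_finite[unfolded hom_finite_def, rule_format, OF Mod_objD(1)[OF p] Mod_objD(1)[OF q]] by metis
  let ?r = "hom_transpose Mod p q (\<lambda>t. fst (snd t))"
  have lin: "linear_between Mod p q \<M> (fst p) (fst q) (\<lambda>t. fst (snd t))"
    by (auto simp: linear_between_def Mod_und(1) alg_module_cat_simps)
  show "\<exists>\<Phi>. finite \<Phi> \<and> \<Phi> \<subseteq> hom_dual Mod p q \<and>
     (\<forall>f\<in>hom Mod p q. (\<forall>\<xi>\<in>\<Phi>. \<xi> f = 0) \<longrightarrow> f = zer Mod p q)"
  proof (intro exI[of _ "?r ` \<Phi>"] conjI ballI impI)
    show "finite (?r ` \<Phi>)" using \<Phi>(1) by simp
    show "?r ` \<Phi> \<subseteq> hom_dual Mod p q"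
      using hom_transpose_linear[OF Mod_linear_category lin] \<Phi>(2) unfolding linear_on_def by blast
    fix t assume t: "t \<in> hom Mod p q" and van: "\<forall>\<xi>\<in>?r ` \<Phi>. \<xi> t = 0"
    have "fst (snd t) = zer \<M> (fst p) (fst q)"
      by (rule \<Phi>(3)[OF Mod_und(1)[OF t]]) (use van t in \<open>simp add: hom_transpose_apply\<close>)
    then show "t = zer Mod p q"
      by (intro Mod_hom_eqI[OF t Mod_zer_hom[OF p q]]) (simp add: alg_module_cat_simps)
  qed
qed

end

section \<open>The coend of the module category\<close>

lemma comp_functor: "is_functor C D F \<Longrightarrow> is_functor D E G \<Longrightarrow> is_functor C E (comp_func G F)"
  unfolding is_functor_def comp_func_def by (simp, blast)

lemma (in module_category_with_algebra) underlying_linear: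
  assumes "linear_into_hom Mod V q z g"
  shows "linear_into_hom \<M> V (fst q) (fst z) (\<lambda>v. fst (snd (g v)))"
  unfolding linear_into_hom_def
proof (intro conjI ballI allI)
  fix v c assume v: "v \<in> V"
  show "fst (snd (g v)) \<in> hom \<M> (fst q) (fst z)"
    using assms v by (intro Mod_und(1)) (simp add: linear_into_hom_def)
  show "fst (snd (g (fscale c v))) = scl \<M> c (fst (snd (g v)))"
    using assms v by (simp add: linear_into_hom_def alg_module_cat_simps)
  fix w assume "w \<in> V"
  then show "fst (snd (g (v + w))) = fst (snd (g v)) \<oplus>\<^bsub>\<M>\<^esub> fst (snd (g w))"
    using assms v by (simp add: linear_into_hom_def alg_module_cat_simps)
qed

locale nakayama_frobenius = frobenius_algebra C \<M> A I l + nakayama_algebra C \<M> A cp N i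
  for C :: "('c, 'd, 'k::field, 'z) moncat_scheme"
    and \<M> :: "('c, 'd, 'o, 'm, 'k, 'y) modcat_scheme"
    and A :: "('c, 'd) algebra_in" and I :: 'c and l :: 'd
    and cp :: "('o, 'm, 'k) copow" and N :: "('o, 'm, 'o, 'm) func" and i :: "'o \<Rightarrow> 'o \<Rightarrow> 'm"
begin

abbreviation "twisted p \<equiv> twisted_action C \<M> I A l p"
abbreviation "N_Mod \<equiv> comp_func (nak_lift_func C \<M> cp N i A) (twist_func C \<M> I A l)"

lemma N_Mod_functor: "is_functor Mod Mod N_Mod"
  by (rule comp_functor[OF twist_functor nak_lift_functor])

lemma N_Mod_simps:
  "fobj N_Mod p = (fobj N (dI \<odot> fst p), nak_action (dI \<odot> fst p) (twisted p))"
  "farr N_Mod (p, f, q) = (fobj N_Mod p, farr N (dI \<rhd> f), fobj N_Mod q)"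
  by (simp_all add: comp_func_def nak_lift_func_def twist_func_def nak_action_def Let_def)

lemma N_Mod_obj: "p \<in> obj Mod \<Longrightarrow> fobj N_Mod p \<in> obj Mod"
  using N_Mod_functor by (simp add: is_functor_def)

abbreviation "free Y \<equiv> (\<A> \<odot> Y, mul \<star> Y)"

text \<open>
  The functor \<open>(M, a) \<mapsto> I\<^sup>\<or> \<triangleright> M\<close> is left adjoint to the free module functor.  For \<open>p\<close> with underlying
  object \<open>M\<close>, \<open>from_free\<close> is the transposition from \<open>Hom(p, A \<triangleright> Y)\<close> to \<open>Hom(I\<^sup>\<or> \<triangleright> M, Y)\<close>, while \<open>into_mod\<close> is the
  opposite transposition followed by the action \<open>A \<triangleright> X \<rightarrow> X\<close> of a module \<open>q\<close> on \<open>X\<close>.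
\<close>

definition into_mod :: "'o \<times> 'm \<Rightarrow> 'o \<times> 'm \<Rightarrow> 'm \<Rightarrow> ('o \<times> 'm) \<times> 'm \<times> ('o \<times> 'm)" where
  "into_mod p q g = (p, snd q \<bullet> (\<A> \<rhd> g) \<bullet> frob_unit (fst p) (snd p), q)"

definition from_free :: "'o \<Rightarrow> ('o \<times> 'm) \<times> 'm \<times> ('o \<times> 'm) \<Rightarrow> 'm" where
  "from_free Y t = (\<epsilon> \<star> Y) \<bullet> (dI \<rhd> fst (snd t))"

lemma mod_typing:
  assumes p: "p \<in> obj Mod"
  shows "fst p \<in> obj \<M>" "snd p \<in> arr \<M>" "src \<M> (snd p) = \<A> \<odot> fst p" "tgt \<M> (snd p) = fst p"
    "frob_unit (fst p) (snd p) \<in> arr \<M>" "src \<M> (frob_unit (fst p) (snd p)) = fst p"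
    "tgt \<M> (frob_unit (fst p) (snd p)) = \<A> \<odot> dI \<odot> fst p"
  using ModD[of "fst p" "snd p"] frob_unit_typing[of "fst p" "snd p"] p by simp_all

lemma mod_laws:
  assumes p: "p \<in> obj Mod"
  shows "snd p \<bullet> (\<A> \<rhd> snd p) = snd p \<bullet> (mul \<star> fst p)" "snd p \<bullet> (un \<star> fst p) = ide \<M> (fst p)"
    "frob_unit (fst p) (snd p) \<bullet> snd p = (mul \<star> (dI \<odot> fst p)) \<bullet> (\<A> \<rhd> frob_unit (fst p) (snd p))"
  using ModD[of "fst p" "snd p"] frob_unit_linear[of "fst p" "snd p"] p by simp_all

lemma into_mod_linear:
  assumes p: "p \<in> obj Mod" and q: "q \<in> obj Mod"
  shows "linear_between \<M> (dI \<odot> fst p) (fst q) Mod p q (into_mod p q)"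
  unfolding linear_between_def
proof (intro conjI ballI allI)
  fix f g c assume f: "f \<in> hom \<M> (dI \<odot> fst p) (fst q)"
  let ?e = "frob_unit (fst p) (snd p)"
  note [simp] = alg_calc mod_typing[OF p] mod_typing[OF q] M.homD[OF f]
  have x: "snd q \<in> hom \<M> (\<A> \<odot> fst q) (fst q)" and e: "?e \<in> hom \<M> (fst p) (\<A> \<odot> dI \<odot> fst p)"
    and wf: "\<A> \<rhd> f \<in> hom \<M> (\<A> \<odot> dI \<odot> fst p) (\<A> \<odot> fst q)" by (simp_all add: hom_def)
  note n = naturality[of mul f, simplified]
  show "into_mod p q f \<in> hom Mod p q" unfolding into_mod_def
  proof (rule Mod_homI[OF p q])
    show "snd q \<bullet> (\<A> \<rhd> f) \<bullet> ?e \<in> hom \<M> (fst p) (fst q)" by (simp add: hom_def)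
    show "(snd q \<bullet> (\<A> \<rhd> f) \<bullet> ?e) \<bullet> snd p = snd q \<bullet> (\<A> \<rhd> (snd q \<bullet> (\<A> \<rhd> f) \<bullet> ?e))"
      by (simp add: mod_laws(3)[OF p] precomp[OF n[symmetric]] precomp[OF mod_laws(1)[OF q]])
  qed
  show "into_mod p q (scl \<M> c f) = scl Mod c (into_mod p q f)"
    using act_scl_right[OF C.homD(1)[OF C.ide_hom[OF algebra_typing(1)]] M.homD(1)[OF f], of c]
      M.cmp_scl_left[OF e wf, of c] M.cmp_scl_right[OF M.cmp_hom[OF e wf] x, of c]
    by (simp add: into_mod_def alg_module_cat_simps)
  assume g: "g \<in> hom \<M> (dI \<odot> fst p) (fst q)"
  note [simp] = M.homD[OF g]
  have wg: "\<A> \<rhd> g \<in> hom \<M> (\<A> \<odot> dI \<odot> fst p) (\<A> \<odot> fst q)" by (simp add: hom_def)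
  show "into_mod p q (f \<oplus>\<^bsub>\<M>\<^esub> g) = into_mod p q f \<oplus>\<^bsub>Mod\<^esub> into_mod p q g"
    using act_add_right[OF C.homD(1)[OF C.ide_hom[OF algebra_typing(1)]] f g]
      M.cmp_add_left[OF e wf wg] M.cmp_add_right[OF M.cmp_hom[OF e wf] M.cmp_hom[OF e wg] x]
    by (simp add: into_mod_def alg_module_cat_simps)
qed

lemma into_mod_hom: "p \<in> obj Mod \<Longrightarrow> q \<in> obj Mod \<Longrightarrow> f \<in> hom \<M> (dI \<odot> fst p) (fst q) \<Longrightarrow>
    into_mod p q f \<in> hom Mod p q"
  using into_mod_linear by (simp add: linear_between_def)

lemma from_free_linear:
  assumes p: "p \<in> obj Mod" and Y: "Y \<in> obj \<M>"
  shows "linear_between Mod p (free Y) \<M> (dI \<odot> fst p) Y (from_free Y)"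
  unfolding linear_between_def
proof (intro conjI ballI allI)
  fix s t c assume s: "s \<in> hom Mod p (free Y)"
  note f = Mod_und(1)[OF s, unfolded fst_conv]
  note [simp] = alg_calc mod_typing[OF p] Y M.homD[OF f]
  have d: "ide C dI \<in> arr C" by simp
  have e: "\<epsilon> \<star> Y \<in> hom \<M> (dI \<odot> \<A> \<odot> Y) Y"
    and wf: "dI \<rhd> fst (snd s) \<in> hom \<M> (dI \<odot> fst p) (dI \<odot> \<A> \<odot> Y)" by (simp_all add: hom_def)
  show "from_free Y s \<in> hom \<M> (dI \<odot> fst p) Y" by (simp add: from_free_def hom_def)
  show "from_free Y (scl Mod c s) = scl \<M> c (from_free Y s)"
    using act_scl_right[OF d M.homD(1)[OF f], of c] M.cmp_scl_right[OF wf e, of c]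
    by (simp add: from_free_def alg_module_cat_simps)
  assume t: "t \<in> hom Mod p (free Y)"
  note g = Mod_und(1)[OF t, unfolded fst_conv]
  note [simp] = M.homD[OF g]
  have wg: "dI \<rhd> fst (snd t) \<in> hom \<M> (dI \<odot> fst p) (dI \<odot> \<A> \<odot> Y)" by (simp add: hom_def)
  show "from_free Y (s \<oplus>\<^bsub>Mod\<^esub> t) = from_free Y s \<oplus>\<^bsub>\<M>\<^esub> from_free Y t"
    using act_add_right[OF d f g] M.cmp_add_right[OF wf wg e]
    by (simp add: from_free_def alg_module_cat_simps)
qed

lemma from_free_hom: "p \<in> obj Mod \<Longrightarrow> Y \<in> obj \<M> \<Longrightarrow> t \<in> hom Mod p (free Y) \<Longrightarrow>
    from_free Y t \<in> hom \<M> (dI \<odot> fst p) Y"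
  using from_free_linear by (simp add: linear_between_def)

lemma into_mod_post:
  assumes p: "p \<in> obj Mod" and s: "s \<in> hom Mod q q'" and f: "f \<in> hom \<M> (dI \<odot> fst p) (fst q)"
  shows "into_mod p q' (fst (snd s) \<bullet> f) = s \<cdot>\<^bsub>Mod\<^esub> into_mod p q f"
proof -
  obtain g where g: "s = (q, g, q')" "q \<in> obj Mod" "q' \<in> obj Mod" "g \<in> hom \<M> (fst q) (fst q')"
    "g \<bullet> snd q = snd q' \<bullet> (\<A> \<rhd> g)" using s by (rule Mod_homE)
  note [simp] = alg_calc mod_typing[OF p] mod_typing[OF g(2)] mod_typing[OF g(3)] M.homD[OF f] M.homD[OF g(4)]
  show ?thesis by (simp add: into_mod_def g(1) alg_module_cat_simps precomp[OF g(5)])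
qed

lemma into_mod_pre:
  assumes s: "s \<in> hom Mod p p'" and q: "q \<in> obj Mod" and g: "g \<in> hom \<M> (dI \<odot> fst p') (fst q)"
  shows "into_mod p q (g \<bullet> (dI \<rhd> fst (snd s))) = into_mod p' q g \<cdot>\<^bsub>Mod\<^esub> s"
proof -
  obtain f where f: "s = (p, f, p')" "p \<in> obj Mod" "p' \<in> obj Mod" "f \<in> hom \<M> (fst p) (fst p')"
    using s by (rule Mod_homE)
  have nat: "(\<A> \<rhd> (dI \<rhd> f)) \<bullet> frob_unit (fst p) (snd p) = frob_unit (fst p') (snd p') \<bullet> f"
    by (rule frob_unit_naturality) (use s f(1) in \<open>simp add: alg_module_hom_iff\<close>)
  note [simp] = alg_calc mod_typing[OF f(2)] mod_typing[OF f(3)] mod_typing[OF q] M.homD[OF f(4)] M.homD[OF g]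
  show ?thesis by (simp add: into_mod_def f(1) alg_module_cat_simps nat)
qed

text \<open>
  Transposing back and forth leaves the action of \<open>q\<close>, seen as a module arrow from the free module.
\<close>

lemma into_mod_from_free:
  assumes p: "p \<in> obj Mod" and q: "q \<in> obj Mod" and t: "t \<in> hom Mod p (free (fst q))"
  shows "into_mod p q (from_free (fst q) t) = (free (fst q), snd q, q) \<cdot>\<^bsub>Mod\<^esub> t"
proof -
  let ?Y = "fst q"
  note [simp] = alg_calc mod_typing[OF p] mod_typing[OF q]
  obtain f where f: "t = (p, f, free ?Y)" "f \<in> hom \<M> (fst p) (\<A> \<odot> ?Y)"
    "f \<bullet> snd p = (mul \<star> ?Y) \<bullet> (\<A> \<rhd> f)" using t by (rule Mod_homE) simp
  note [simp] = M.homD[OF f(2)] frob_unit_typing[OF free_module[of ?Y]]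
  have nat: "(\<A> \<rhd> (dI \<rhd> f)) \<bullet> frob_unit (fst p) (snd p) = frob_unit (\<A> \<odot> ?Y) (mul \<star> ?Y) \<bullet> f"
    by (rule frob_unit_naturality) (use t f(1) in \<open>simp add: alg_module_hom_iff\<close>)
  show ?thesis
    by (simp add: into_mod_def from_free_def f(1) alg_module_cat_simps nat precomp[OF frob_triangle_free])
qed

lemma from_free_into_mod:
  assumes p: "p \<in> obj Mod" and g: "g \<in> hom \<M> (dI \<odot> fst p) Y"
  shows "from_free Y (into_mod p (free Y) ((un \<star> Y) \<bullet> g)) = g"
proof -
  note [simp] = alg_calc mod_typing[OF p] M.homD[OF g] M.hom_objs[OF g]
  note n = naturality[of \<epsilon> g, simplified]
  have tri: "(\<epsilon> \<star> (dI \<odot> fst p)) \<bullet> (dI \<rhd> frob_unit (fst p) (snd p)) = ide \<M> (dI \<odot> fst p)"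
    using frob_triangle_module[of "fst p" "snd p"] p by simp
  show ?thesis
    by (simp add: from_free_def into_mod_def precomp[OF whisk[OF mul_unit(2)]] precomp[OF n] tri)
qed

lemma into_mod_comate:
  assumes p: "p \<in> obj Mod" and q: "q \<in> obj Mod" and f: "f \<in> hom \<M> (dI \<odot> fst p) (\<A> \<odot> fst q)"
  shows "into_mod p q (comate (dI \<odot> fst p) (twisted p) (fst q) f) = into_mod p q (snd q \<bullet> f)"
proof -
  have p': "(fst p, snd p) \<in> obj Mod" using p by simp
  note tm = twisted_module[OF p', unfolded prod.collapse]
  note [simp] = alg_calc mod_typing[OF p] mod_typing[OF q] M.homD[OF f]
  have fq: "fst q \<in> obj \<M>" by simp
  have "comate (dI \<odot> fst p) (twisted p) (fst q) f =
      (ev C \<A> \<star> fst q) \<bullet> (dA \<rhd> f) \<bullet> twist_coaction (fst p) (snd p)"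
    by (simp only: comate_eq[OF tm(1) fq f] tm(2))
  then have "into_mod p q (comate (dI \<odot> fst p) (twisted p) (fst q) f) =
      (p, snd q \<bullet> (mul \<star> fst q) \<bullet> (\<A> \<rhd> f) \<bullet> frob_unit (fst p) (snd p), q)"
    by (simp only: into_mod_def frobenius_balance[OF p' fq f])
  also have "\<dots> = into_mod p q (snd q \<bullet> f)"
    by (simp add: into_mod_def precomp[OF mod_laws(1)[OF q]])
  finally show ?thesis .
qed

text \<open>
  A functional on module arrows \<open>p \<rightarrow> q\<close> pulls back along \<open>into_mod\<close> to a functional on
  \<open>Hom(I\<^sup>\<or> \<triangleright> M, X)\<close>, to which the universal family of \<open>\<M>\<close> applies.
\<close>

definition mod_coend :: "'o \<times> 'm \<Rightarrow> 'o \<times> 'm \<Rightarrow> (('o \<times> 'm) \<times> 'm \<times> ('o \<times> 'm) \<Rightarrow> 'k) \<Rightarrow>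
    ('o \<times> 'm) \<times> 'm \<times> ('o \<times> 'm)" where
  "mod_coend p q \<xi> = (q, j (dI \<odot> fst p) (fst q)
     (hom_transpose \<M> (dI \<odot> fst p) (fst q) (into_mod p q) \<xi>), fobj N_Mod p)"

lemma into_mod_transpose:
  assumes "p \<in> obj Mod" "q \<in> obj Mod"
  shows "linear_on (hom_dual Mod p q) (hom_dual \<M> (dI \<odot> fst p) (fst q))
    (hom_transpose \<M> (dI \<odot> fst p) (fst q) (into_mod p q))"
  by (rule hom_transpose_linear[OF M.linear_category_axioms into_mod_linear[OF assms]])

lemma from_free_transpose:
  assumes "p \<in> obj Mod" "Y \<in> obj \<M>"
  shows "linear_on (hom_dual \<M> (dI \<odot> fst p) Y) (hom_dual Mod p (free Y))
    (hom_transpose Mod p (free Y) (from_free Y))"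
  by (rule hom_transpose_linear[OF Mod_linear_category from_free_linear[OF assms]])

text \<open>
  By \<open>into_mod_comate\<close>, the action on the target and the action on the source change the functional in the
  same way.
\<close>

lemma mod_coend_hom:
  assumes p: "p \<in> obj Mod" and q: "q \<in> obj Mod" and \<xi>: "\<xi> \<in> hom_dual Mod p q"
  shows "mod_coend p q \<xi> \<in> hom Mod q (fobj N_Mod p)"
  unfolding mod_coend_def
proof (rule Mod_homI[OF q N_Mod_obj[OF p]])
  let ?K = "dI \<odot> fst p" and ?X = "fst q"
  let ?z = "hom_transpose \<M> ?K ?X (into_mod p q) \<xi>"
  have p': "(fst p, snd p) \<in> obj Mod" using p by simp
  note tm = twisted_module[OF p', unfolded prod.collapse]
  note [simp] = alg_calc mod_typing[OF p] mod_typing[OF q]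
  have K: "?K \<in> obj \<M>" and X: "?X \<in> obj \<M>" by simp_all
  have z: "?z \<in> hom_dual \<M> ?K ?X" using into_mod_transpose[OF p q] \<xi> by (simp add: linear_on_def)
  show "j ?K ?X ?z \<in> hom \<M> (fst q) (fst (fobj N_Mod p))"
    using j_hom[OF K X z] by (simp add: N_Mod_simps)
  have x: "snd q \<in> hom \<M> (\<A> \<odot> ?X) ?X" by (simp add: hom_def)
  have "j ?K ?X ?z \<bullet> snd q = j ?K (\<A> \<odot> ?X) (hom_transpose \<M> ?K (\<A> \<odot> ?X) (\<lambda>f. snd q \<bullet> f) ?z)"
    by (rule j_dinatural[OF K x z, symmetric])
  also have "hom_transpose \<M> ?K (\<A> \<odot> ?X) (\<lambda>f. snd q \<bullet> f) ?z =
      hom_transpose \<M> ?K (\<A> \<odot> ?X) (\<lambda>f. into_mod p q (snd q \<bullet> f)) \<xi>"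
    by (rule hom_transpose_comp) (rule M.cmp_hom[OF _ x])
  also have "\<dots> = hom_transpose \<M> ?K (\<A> \<odot> ?X) (\<lambda>f. into_mod p q (comate ?K (twisted p) ?X f)) \<xi>"
    by (rule hom_transpose_cong) (rule into_mod_comate[OF p q, symmetric])
  also have "\<dots> = hom_transpose \<M> ?K (\<A> \<odot> ?X) (comate ?K (twisted p) ?X) ?z"
    by (rule hom_transpose_comp[symmetric]) (rule comate_hom[OF tm(1) X])
  also have "j ?K (\<A> \<odot> ?X) \<dots> = nak_action ?K (twisted p) \<bullet> (\<A> \<rhd> j ?K ?X ?z)"
    by (rule nak_action_j[OF tm(1) X z, symmetric])
  finally show "j ?K ?X ?z \<bullet> snd q = snd (fobj N_Mod p) \<bullet> (\<A> \<rhd> j ?K ?X ?z)"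
    by (simp add: N_Mod_simps)
qed

lemma mod_coend_family:
  assumes p: "p \<in> obj Mod"
  shows "dual_family Mod p (fobj N_Mod p) (mod_coend p)"
  unfolding dual_family_def
proof (intro conjI ballI allI impI)
  let ?K = "dI \<odot> fst p"
  have K: "?K \<in> obj \<M>" using mod_typing(1)[OF p] by (simp add: objects)
  fix q assume q: "q \<in> obj Mod"
  have lin: "linear_into_hom \<M> (hom_dual Mod p q) (fst q) (fobj N ?K)
      (\<lambda>\<xi>. j ?K (fst q) (hom_transpose \<M> ?K (fst q) (into_mod p q) \<xi>))"
    by (rule linear_into_hom_comp[OF into_mod_transpose[OF p q] j_linear[OF K mod_typing(1)[OF q]]])
  show "linear_into_hom Mod (hom_dual Mod p q) q (fobj N_Mod p) (mod_coend p q)"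
    using lin mod_coend_hom[OF p q] unfolding linear_into_hom_def mod_coend_def
    by (auto simp: alg_module_cat_simps)
next
  fix q q' t \<xi> assume t: "t \<in> hom Mod q q'" and \<xi>: "\<xi> \<in> hom_dual Mod p q'"
  obtain g where g: "t = (q, g, q')" "q \<in> obj Mod" "q' \<in> obj Mod" "g \<in> hom \<M> (fst q) (fst q')"
    using t by (rule Mod_homE)
  let ?K = "dI \<odot> fst p"
  have K: "?K \<in> obj \<M>" using mod_typing(1)[OF p] by (simp add: objects)
  have z: "hom_transpose \<M> ?K (fst q') (into_mod p q') \<xi> \<in> hom_dual \<M> ?K (fst q')"
    using into_mod_transpose[OF p g(3)] \<xi> by (simp add: linear_on_def)
  have "hom_transpose \<M> ?K (fst q) (into_mod p q) (hom_transpose Mod p q (\<lambda>f. t \<cdot>\<^bsub>Mod\<^esub> f) \<xi>) =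
      hom_transpose \<M> ?K (fst q) (\<lambda>f. t \<cdot>\<^bsub>Mod\<^esub> into_mod p q f) \<xi>"
    by (rule hom_transpose_comp) (rule into_mod_hom[OF p g(2)])
  also have "\<dots> = hom_transpose \<M> ?K (fst q) (\<lambda>f. into_mod p q' (g \<bullet> f)) \<xi>"
    by (rule hom_transpose_cong) (use into_mod_post[OF p t] in \<open>simp add: g(1)\<close>)
  also have "\<dots> = hom_transpose \<M> ?K (fst q) (\<lambda>f. g \<bullet> f) (hom_transpose \<M> ?K (fst q') (into_mod p q') \<xi>)"
    by (rule hom_transpose_comp[symmetric]) (rule M.cmp_hom[OF _ g(4)])
  finally show "mod_coend p q (hom_transpose Mod p q (\<lambda>f. t \<cdot>\<^bsub>Mod\<^esub> f) \<xi>) = mod_coend p q' \<xi> \<cdot>\<^bsub>Mod\<^esub> t"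
    using j_dinatural[OF K g(4) z] by (simp add: mod_coend_def alg_module_cat_simps g(1))
qed

lemma mod_coend_natural:
  assumes t: "t \<in> hom Mod p p'" and q: "q \<in> obj Mod" and \<xi>: "\<xi> \<in> hom_dual Mod p q"
  shows "farr N_Mod t \<cdot>\<^bsub>Mod\<^esub> mod_coend p q \<xi> =
    mod_coend p' q (hom_transpose Mod p' q (\<lambda>g. g \<cdot>\<^bsub>Mod\<^esub> t) \<xi>)"
proof -
  obtain f where f: "t = (p, f, p')" "p \<in> obj Mod" "p' \<in> obj Mod" "f \<in> hom \<M> (fst p) (fst p')"
    using t by (rule Mod_homE)
  let ?K = "dI \<odot> fst p" and ?K' = "dI \<odot> fst p'"
  note [simp] = alg_calc mod_typing[OF f(2)] mod_typing[OF f(3)] mod_typing[OF q] M.homD[OF f(4)]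
  have wf: "dI \<rhd> f \<in> hom \<M> ?K ?K'" by (simp add: hom_def)
  have z: "hom_transpose \<M> ?K (fst q) (into_mod p q) \<xi> \<in> hom_dual \<M> ?K (fst q)"
    using into_mod_transpose[OF f(2) q] \<xi> by (simp add: linear_on_def)
  have "hom_transpose \<M> ?K' (fst q) (\<lambda>g. g \<bullet> (dI \<rhd> f)) (hom_transpose \<M> ?K (fst q) (into_mod p q) \<xi>) =
      hom_transpose \<M> ?K' (fst q) (\<lambda>g. into_mod p q (g \<bullet> (dI \<rhd> f))) \<xi>"
    by (rule hom_transpose_comp) (rule M.cmp_hom[OF wf])
  also have "\<dots> = hom_transpose \<M> ?K' (fst q) (\<lambda>g. into_mod p' q g \<cdot>\<^bsub>Mod\<^esub> t) \<xi>"
    by (rule hom_transpose_cong) (use into_mod_pre[OF t q] in \<open>simp add: f(1)\<close>)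
  also have "\<dots> = hom_transpose \<M> ?K' (fst q) (into_mod p' q) (hom_transpose Mod p' q (\<lambda>g. g \<cdot>\<^bsub>Mod\<^esub> t) \<xi>)"
    by (rule hom_transpose_comp[symmetric]) (rule into_mod_hom[OF f(3) q])
  finally show ?thesis
    using dual_coend_natural[OF N_coend wf mod_typing(1)[OF q] z]
    by (simp add: mod_coend_def alg_module_cat_simps f(1) N_Mod_simps)
qed

text \<open>
  Every component of the coend of \<open>\<M>\<close> at \<open>I\<^sup>\<or> \<triangleright> M\<close> factors through a component at a free module.
  Hence an arrow out of the coend is determined by its restriction to the family on modules.
\<close>

lemma coend_via_free:
  assumes p: "p \<in> obj Mod" and Y: "Y \<in> obj \<M>" and \<zeta>: "\<zeta> \<in> hom_dual \<M> (dI \<odot> fst p) Y"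
  shows "j (dI \<odot> fst p) Y \<zeta> =
    fst (snd (mod_coend p (free Y) (hom_transpose Mod p (free Y) (from_free Y) \<zeta>))) \<bullet> (un \<star> Y)"
proof -
  let ?K = "dI \<odot> fst p"
  note [simp] = alg_calc mod_typing[OF p] Y
  have K: "?K \<in> obj \<M>" and u: "un \<star> Y \<in> hom \<M> Y (\<A> \<odot> Y)" by (simp_all add: hom_def)
  let ?\<xi> = "hom_transpose Mod p (free Y) (from_free Y) \<zeta>"
  have \<xi>: "?\<xi> \<in> hom_dual Mod p (free Y)" using from_free_transpose[OF p Y] \<zeta> by (simp add: linear_on_def)
  let ?z = "hom_transpose \<M> ?K (\<A> \<odot> Y) (into_mod p (free Y)) ?\<xi>"
  have z: "?z \<in> hom_dual \<M> ?K (\<A> \<odot> Y)"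
    using into_mod_transpose[OF p free_module[OF Y]] \<xi> by (simp add: linear_on_def)
  have im: "into_mod p (free Y) f \<in> hom Mod p (free Y)" if "f \<in> hom \<M> ?K (\<A> \<odot> Y)" for f
    using into_mod_hom[OF p free_module[OF Y]] that by simp
  have "hom_transpose \<M> ?K Y (\<lambda>f. (un \<star> Y) \<bullet> f) ?z =
     hom_transpose \<M> ?K Y (\<lambda>f. into_mod p (free Y) ((un \<star> Y) \<bullet> f)) ?\<xi>"
    by (rule hom_transpose_comp) (rule M.cmp_hom[OF _ u])
  also have "\<dots> = hom_transpose \<M> ?K Y (\<lambda>f. from_free Y (into_mod p (free Y) ((un \<star> Y) \<bullet> f))) \<zeta>"
    by (rule hom_transpose_comp) (rule im[OF M.cmp_hom[OF _ u]])
  also have "\<dots> = \<zeta>" by (rule hom_transpose_ident[OF \<zeta>]) (rule from_free_into_mod[OF p])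
  finally show ?thesis using j_dinatural[OF K u z] by (simp add: mod_coend_def)
qed

lemma free_arrow:
  assumes g: "g \<in> hom \<M> Y Y'"
  shows "(free Y, \<A> \<rhd> g, free Y') \<in> hom Mod (free Y) (free Y')"
proof -
  note [simp] = alg_calc M.homD[OF g] M.hom_objs[OF g]
  note n = naturality[of mul g, simplified]
  show ?thesis by (rule Mod_homI) (simp_all add: free_module n hom_def)
qed

lemma action_arrow: "q \<in> obj Mod \<Longrightarrow> (free (fst q), snd q, q) \<in> hom Mod (free (fst q)) q"
  using mod_laws(1)[of q] mod_typing[of q] by (intro Mod_homI) (simp_all add: free_module hom_def)

text \<open>
  The values of a family \<open>k\<close> at free modules, restricted along the units \<open>Y \<rightarrow> A \<triangleright> Y\<close>, form a family on \<open>\<M>\<close> and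
  induce an arrow \<open>h\<close>.  That \<open>h\<close> restricts to \<open>k\<close> at every module \<open>q\<close> follows from naturality of \<open>k\<close>
  along the action of \<open>q\<close>, an arrow of modules from a free module that is split in \<open>\<M>\<close> by the unit.  Linearity of \<open>h\<close> and
  uniqueness are tested on the universal family of \<open>\<M>\<close>, whose members factor through free modules.
\<close>

lemma mod_coend_universal:
  assumes p: "p \<in> obj Mod" and z: "z \<in> obj Mod" and k: "dual_family Mod p z k"
  shows "\<exists>!h. h \<in> hom Mod (fobj N_Mod p) z \<and>
    (\<forall>q\<in>obj Mod. \<forall>\<xi>\<in>hom_dual Mod p q. h \<cdot>\<^bsub>Mod\<^esub> mod_coend p q \<xi> = k q \<xi>)"
proof -
  interpret Mod: linear_category Mod by (rule Mod_linear_category)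
  let ?K = "dI \<odot> fst p" and ?Z = "fst z" and ?n = "snd (fobj N_Mod p)"
  let ?v = "\<lambda>Y \<zeta>. hom_transpose Mod p (free Y) (from_free Y) \<zeta>"
  note [simp] = alg_calc mod_typing[OF p] mod_typing[OF z] mod_typing[OF N_Mod_obj[OF p]]
  have K: "?K \<in> obj \<M>" by simp
  have Nfst: "fst (fobj N_Mod p) = fobj N ?K" by (simp add: N_Mod_simps)
  have v: "?v Y \<zeta> \<in> hom_dual Mod p (free Y)" if "Y \<in> obj \<M>" "\<zeta> \<in> hom_dual \<M> ?K Y" for Y \<zeta>
    using from_free_transpose[OF p that(1)] that(2) by (simp add: linear_on_def)
  have kh: "k q \<xi> \<in> hom Mod q z" if "q \<in> obj Mod" "\<xi> \<in> hom_dual Mod p q" for q \<xi>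
    by (rule Mod.dual_family_hom[OF k that])
  have knat: "k q (hom_transpose Mod p q (\<lambda>f. g \<cdot>\<^bsub>Mod\<^esub> f) \<xi>) = k q' \<xi> \<cdot>\<^bsub>Mod\<^esub> g"
    if "g \<in> hom Mod q q'" "\<xi> \<in> hom_dual Mod p q'" for q q' g \<xi>
    using k that unfolding dual_family_def by blast
  define k' where "k' Y \<zeta> = fst (snd (k (free Y) (?v Y \<zeta>))) \<bullet> (un \<star> Y)" for Y \<zeta>
  have fam: "dual_family \<M> ?K ?Z k'" unfolding dual_family_def
  proof (intro conjI ballI allI impI)
    fix Y assume Y: "Y \<in> obj \<M>"
    have "linear_into_hom Mod (hom_dual Mod p (free Y)) (free Y) z (k (free Y))"
      using k free_module[OF Y] by (simp add: dual_family_def)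
    then have "linear_into_hom Mod (hom_dual \<M> ?K Y) (free Y) z (\<lambda>\<zeta>. k (free Y) (?v Y \<zeta>))"
      by (rule linear_into_hom_comp[OF from_free_transpose[OF p Y]])
    then have "linear_into_hom \<M> (hom_dual \<M> ?K Y) (\<A> \<odot> Y) ?Z (\<lambda>\<zeta>. fst (snd (k (free Y) (?v Y \<zeta>))))"
      by (rule underlying_linear[where q="free Y", unfolded fst_conv])
    then show "linear_into_hom \<M> (hom_dual \<M> ?K Y) Y ?Z (k' Y)"
      unfolding k'_def by (rule M.linear_into_hom_pre) (simp add: hom_def Y)
  next
    fix Y Y' g \<zeta> assume g: "g \<in> hom \<M> Y Y'" and \<zeta>: "\<zeta> \<in> hom_dual \<M> ?K Y'"
    note Y = M.hom_objs[OF g]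
    note [simp] = M.homD[OF g] Y
    let ?g = "(free Y, \<A> \<rhd> g, free Y')"
    have ff: "from_free Y' (?g \<cdot>\<^bsub>Mod\<^esub> t) = g \<bullet> from_free Y t" if t: "t \<in> hom Mod p (free Y)" for t
    proof -
      note [simp] = M.homD[OF Mod_und(1)[OF t, unfolded fst_conv]]
      note n = naturality[of \<epsilon> g, simplified]
      show ?thesis by (simp add: from_free_def alg_module_cat_simps precomp[OF n])
    qed
    have "?v Y (hom_transpose \<M> ?K Y (\<lambda>f. g \<bullet> f) \<zeta>) = hom_transpose Mod p (free Y) (\<lambda>t. g \<bullet> from_free Y t) \<zeta>"
      by (rule hom_transpose_comp) (rule from_free_hom[OF p Y(1)])
    also have "\<dots> = hom_transpose Mod p (free Y) (\<lambda>t. from_free Y' (?g \<cdot>\<^bsub>Mod\<^esub> t)) \<zeta>"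
      by (rule hom_transpose_cong) (rule ff[symmetric])
    also have "\<dots> = hom_transpose Mod p (free Y) (\<lambda>t. ?g \<cdot>\<^bsub>Mod\<^esub> t) (?v Y' \<zeta>)"
      by (rule hom_transpose_comp[symmetric]) (rule Mod_cmp_hom[OF _ free_arrow[OF g]])
    finally have "k (free Y) (?v Y (hom_transpose \<M> ?K Y (\<lambda>f. g \<bullet> f) \<zeta>)) = k (free Y') (?v Y' \<zeta>) \<cdot>\<^bsub>Mod\<^esub> ?g"
      using knat[OF free_arrow[OF g] v[OF Y(2) \<zeta>]] by simp
    then have "k' Y (hom_transpose \<M> ?K Y (\<lambda>f. g \<bullet> f) \<zeta>) =
        (fst (snd (k (free Y') (?v Y' \<zeta>))) \<bullet> (\<A> \<rhd> g)) \<bullet> (un \<star> Y)"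
      by (simp only: k'_def alg_module_cat_simps fst_conv snd_conv)
    also have "\<dots> = k' Y' \<zeta> \<bullet> g"
    proof -
      note [simp] = M.homD[OF Mod_und(1)[OF kh[OF free_module[OF Y(2)] v[OF Y(2) \<zeta>]], unfolded fst_conv]]
      note n = naturality[of un g, simplified]
      show ?thesis by (simp add: k'_def n)
    qed
    finally show "k' Y (hom_transpose \<M> ?K Y (\<lambda>f. g \<bullet> f) \<zeta>) = k' Y' \<zeta> \<bullet> g" .
  qed
  obtain h where h: "h \<in> hom \<M> (fobj N ?K) ?Z"
    and hj: "\<And>Y \<zeta>. Y \<in> obj \<M> \<Longrightarrow> \<zeta> \<in> hom_dual \<M> ?K Y \<Longrightarrow> h \<bullet> j ?K Y \<zeta> = k' Y \<zeta>"
    using dual_coend_universal[OF N_coend K mod_typing(1)[OF z] fam] by blast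
  note [simp] = M.homD[OF h]
  have hu: "h \<bullet> fst (snd (mod_coend p q \<xi>)) = fst (snd (k q \<xi>))"
    if q: "q \<in> obj Mod" and \<xi>: "\<xi> \<in> hom_dual Mod p q" for q \<xi>
  proof -
    let ?X = "fst q" and ?a = "(free (fst q), snd q, q)"
    note [simp] = mod_typing[OF q]
    have X: "?X \<in> obj \<M>" by simp
    have zz: "hom_transpose \<M> ?K ?X (into_mod p q) \<xi> \<in> hom_dual \<M> ?K ?X"
      using into_mod_transpose[OF p q] \<xi> by (simp add: linear_on_def)
    have "h \<bullet> fst (snd (mod_coend p q \<xi>)) = k' ?X (hom_transpose \<M> ?K ?X (into_mod p q) \<xi>)"
      using hj[OF X zz] by (simp add: mod_coend_def)
    also have "?v ?X (hom_transpose \<M> ?K ?X (into_mod p q) \<xi>) =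
        hom_transpose Mod p (free ?X) (\<lambda>t. into_mod p q (from_free ?X t)) \<xi>"
      by (rule hom_transpose_comp) (rule from_free_hom[OF p X])
    then have "k' ?X (hom_transpose \<M> ?K ?X (into_mod p q) \<xi>) = fst (snd (k q \<xi> \<cdot>\<^bsub>Mod\<^esub> ?a)) \<bullet> (un \<star> ?X)"
      using hom_transpose_cong[of Mod p "free ?X" "\<lambda>t. into_mod p q (from_free ?X t)" "\<lambda>t. ?a \<cdot>\<^bsub>Mod\<^esub> t" \<xi>]
        into_mod_from_free[OF p q] knat[OF action_arrow[OF q] \<xi>] by (simp add: k'_def)
    also have "\<dots> = fst (snd (k q \<xi>))"
      using M.homD[OF Mod_und(1)[OF kh[OF q \<xi>]]] mod_laws(2)[OF q] by (simp add: alg_module_cat_simps)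
    finally show ?thesis .
  qed
  have lin: "h \<bullet> ?n = snd z \<bullet> (\<A> \<rhd> h)"
  proof (rule whisker_coend_ext[OF N_coend K algebra_typing(1)])
    show "h \<bullet> ?n \<in> hom \<M> (\<A> \<odot> fobj N ?K) ?Z" "snd z \<bullet> (\<A> \<rhd> h) \<in> hom \<M> (\<A> \<odot> fobj N ?K) ?Z"
      by (simp_all add: hom_def Nfst)
    fix Y \<zeta> assume Y [simp]: "Y \<in> obj \<M>" and \<zeta>: "\<zeta> \<in> hom_dual \<M> ?K Y"
    let ?u = "fst (snd (mod_coend p (free Y) (?v Y \<zeta>)))" and ?kk = "fst (snd (k (free Y) (?v Y \<zeta>)))"
    note uh = mod_coend_hom[OF p free_module[OF Y] v[OF Y \<zeta>]] and kkh = kh[OF free_module[OF Y] v[OF Y \<zeta>]]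
    note [simp] = M.homD[OF Mod_und(1)[OF uh, unfolded fst_conv]] M.homD[OF Mod_und(1)[OF kkh, unfolded fst_conv]]
    note ul = Mod_und(2)[OF uh, unfolded snd_conv] and kl = Mod_und(2)[OF kkh, unfolded snd_conv]
    have huk: "h \<bullet> ?u = ?kk" by (rule hu[OF free_module[OF Y] v[OF Y \<zeta>]])
    show "(h \<bullet> ?n) \<bullet> (\<A> \<rhd> j ?K Y \<zeta>) = (snd z \<bullet> (\<A> \<rhd> h)) \<bullet> (\<A> \<rhd> j ?K Y \<zeta>)"
      by (simp add: coend_via_free[OF p Y \<zeta>] Nfst precomp[OF ul[symmetric]] precomp[OF huk] precomp[OF whisk[OF huk]]
          precomp[OF kl[symmetric]])
  qed
  have hM: "(fobj N_Mod p, h, z) \<in> hom Mod (fobj N_Mod p) z"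
    by (rule Mod_homI[OF N_Mod_obj[OF p] z _ lin]) (simp add: Nfst h)
  show ?thesis
  proof (intro ex1I[of _ "(fobj N_Mod p, h, z)"] conjI ballI)
    show "(fobj N_Mod p, h, z) \<in> hom Mod (fobj N_Mod p) z" by (rule hM)
    show "(fobj N_Mod p, h, z) \<cdot>\<^bsub>Mod\<^esub> mod_coend p q \<xi> = k q \<xi>"
      if "q \<in> obj Mod" "\<xi> \<in> hom_dual Mod p q" for q \<xi>
      by (rule Mod_hom_eqI[OF Mod_cmp_hom[OF mod_coend_hom[OF p that] hM] kh[OF that]])
        (use hu[OF that] in \<open>simp add: alg_module_cat_simps\<close>)
    fix t assume t: "t \<in> hom Mod (fobj N_Mod p) z \<and>
      (\<forall>q\<in>obj Mod. \<forall>\<xi>\<in>hom_dual Mod p q. t \<cdot>\<^bsub>Mod\<^esub> mod_coend p q \<xi> = k q \<xi>)"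
    then have th: "t \<in> hom Mod (fobj N_Mod p) z" by blast
    note tm = Mod_und(1)[OF th, unfolded Nfst]
    note [simp] = M.homD[OF tm]
    have "fst (snd t) = h"
    proof (rule M.dual_coend_ext[OF N_coend K tm h])
      fix Y \<zeta> assume Y [simp]: "Y \<in> obj \<M>" and \<zeta>: "\<zeta> \<in> hom_dual \<M> ?K Y"
      let ?u = "fst (snd (mod_coend p (free Y) (?v Y \<zeta>)))"
      note uh = mod_coend_hom[OF p free_module[OF Y] v[OF Y \<zeta>]]
      note [simp] = M.homD[OF Mod_und(1)[OF uh, unfolded fst_conv]]
      have "fst (snd (t \<cdot>\<^bsub>Mod\<^esub> mod_coend p (free Y) (?v Y \<zeta>))) = fst (snd (k (free Y) (?v Y \<zeta>)))"
        using t free_module[OF Y] v[OF Y \<zeta>] by simp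
      then have tu: "fst (snd t) \<bullet> ?u = fst (snd (k (free Y) (?v Y \<zeta>)))"
        by (simp add: alg_module_cat_simps)
      have hk: "h \<bullet> ?u = fst (snd (k (free Y) (?v Y \<zeta>)))" by (rule hu[OF free_module[OF Y] v[OF Y \<zeta>]])
      show "fst (snd t) \<bullet> j ?K Y \<zeta> = h \<bullet> j ?K Y \<zeta>"
        by (simp add: coend_via_free[OF p Y \<zeta>] precomp[OF tu] precomp[OF hk] Nfst)
    qed
    then show "t = (fobj N_Mod p, h, z)" using Mod_und(3)[OF th] by simp
  qed
qed

lemma mod_dual_coend: "dual_coend Mod N_Mod mod_coend"
  unfolding dual_coend_def
  using N_Mod_functor mod_coend_family mod_coend_universal mod_coend_natural by simp

end

section \<open>Copowers of modules\<close>

context linear_category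
begin

lemma copower_transport:
  assumes cop: "is_copower C V' X P e" and T: "linear_on V V' T" "T ` V = V'" "inj_on T V"
    and V: "fun_vs.subspace V"
  shows "is_copower C V X P (\<lambda>v. e (T v))"
  unfolding is_copower_def
proof (intro conjI ballI allI impI)
  show "P \<in> obj C" by (rule is_copower_obj[OF cop])
  show "linear_into_hom C V X P (\<lambda>v. e (T v))"
    by (rule linear_into_hom_comp[OF T(1) is_copower_lin[OF cop]])
  fix Y g assume Y: "Y \<in> obj C" and g: "linear_into_hom C V X Y g"
  let ?i = "inv_into V T"
  have i: "?i w \<in> V" "T (?i w) = w" if "w \<in> V'" for w
    using that T(2) inv_into_into[of w T V] f_inv_into_f[of w T V] by auto
  have iT: "?i (T v) = v" if "v \<in> V" for v using that T(3) by simp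
  have lin: "linear_on V' V ?i"
    unfolding linear_on_def
  proof (intro conjI ballI allI)
    fix v w c assume v: "v \<in> V'"
    show "?i v \<in> V" by (rule i(1)[OF v])
    have "T (fscale c (?i v)) = fscale c v" using T(1) i[OF v] unfolding linear_on_def by simp
    then show "?i (fscale c v) = fscale c (?i v)"
      using iT[OF fun_vs.subspace_scale[OF V i(1)[OF v]]] by metis
    assume w: "w \<in> V'"
    have "T (?i v + ?i w) = v + w" using T(1) i[OF v] i[OF w] unfolding linear_on_def by simp
    then show "?i (v + w) = ?i v + ?i w"
      using iT[OF fun_vs.subspace_add[OF V i(1)[OF v] i(1)[OF w]]] by metis
  qed
  have eq: "(\<forall>v\<in>V. h \<cdot> e (T v) = g v) \<longleftrightarrow> (\<forall>w\<in>V'. h \<cdot> e w = g (?i w))" for h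
    using i iT T(2) by auto
  show "\<exists>!h. h \<in> hom C P Y \<and> (\<forall>v\<in>V. h \<cdot> e (T v) = g v)"
    unfolding eq using cop Y linear_into_hom_comp[OF lin g] unfolding is_copower_def by blast
qed

lemma zero_object_hom:
  assumes "ide C X = zer C X X" "f \<in> hom C X Y" shows "f = zer C X Y"
  using cmp_ide_right[OF assms(2)] cmp_zer_right[OF assms(2) hom_objs(1)[OF assms(2)]] assms(1) by simp

text \<open>
  Copowers in \<open>C\<close> are given for spaces of functions on the type of arrows of \<open>C\<close>, but the dual hom-spaces of
  a module category consist of functions on a different type.  To transport such a space one needs room in
  the type of arrows.  If this type were finite, the space of all functions on it would be
  finite-dimensional, and its copower with a nonzero object would embed this space into the type of arrows,
  against Cantor's theorem.
\<close>

lemma infinite_arrows: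
  fixes cp :: "('o, 'm, 'k) copow"
  assumes cp: "has_copowers C cp" and X: "X \<in> obj C" and nz: "ide C X \<noteq> zer C X X"
  shows "infinite (UNIV :: 'm set)"
proof
  assume fin: "finite (UNIV :: 'm set)"
  have "fd_space (UNIV :: ('m \<Rightarrow> 'k) set)"
    by (rule separated_imp_fd_space[OF fin]) (auto simp: fun_eq_iff)
  then have cop: "is_copower C UNIV X (cpobj cp UNIV X) (cpunit cp UNIV X)"
    using cp X by (simp add: has_copowers_def)
  have "inj (cpunit cp UNIV X)"
  proof (rule injI, rule ccontr)
    fix v w :: "'m \<Rightarrow> 'k" assume eq: "cpunit cp UNIV X v = cpunit cp UNIV X w" and ne: "v \<noteq> w"
    then obtain x where x: "v x \<noteq> w x" by (auto simp: fun_eq_iff)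
    have idh: "ide C X \<in> hom C X X" by (rule ide_hom[OF X])
    \<comment> \<open>evaluation at \<open>x\<close>, as a multiple of the identity, tells the two images apart\<close>
    have "linear_into_hom C UNIV X X (\<lambda>u. scl C (u x) (ide C X))"
      using scl_hom[OF idh] scl_add_left[OF idh] scl_scl[OF idh]
      by (simp add: linear_into_hom_def fscale_def)
    then obtain h where "\<And>u. h \<cdot> cpunit cp UNIV X u = scl C (u x) (ide C X)"
      using cop X unfolding is_copower_def by blast
    then have "scl C (v x) (ide C X) = scl C (w x) (ide C X)" using eq by metis
    then have "scl C (v x - w x) (ide C X) = zer C X X"
      using scl_add_left[OF idh, of "v x" "- w x"] scl_add_left[OF idh, of "w x" "- w x"] scl_zero[OF idh]
      by simp
    then have "scl C (1 / (v x - w x)) (scl C (v x - w x) (ide C X)) = zer C X X"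
      using scl_zer[OF X X] by simp
    then show False using nz x scl_scl[OF idh] scl_one[OF idh] by simp
  qed
  moreover have "inj (\<lambda>S :: 'm set. (\<lambda>x. if x \<in> S then 1 else 0 :: 'k))"
    by (rule injI) (auto simp: fun_eq_iff split: if_splits)
  ultimately have "inj (\<lambda>S :: 'm set. cpunit cp UNIV X (\<lambda>x. if x \<in> S then 1 else 0))"
    by (rule inj_compose[unfolded comp_def])
  then have "surj (inv (\<lambda>S :: 'm set. cpunit cp UNIV X (\<lambda>x. if x \<in> S then 1 else 0)))"
    by (rule inj_imp_surj_inv)
  then show False using Cantors_theorem[of "UNIV :: 'm set"] by (metis Pow_UNIV)
qed

text \<open>
  A finite-dimensional space is determined by finitely many points, which can be
  renamed to elements of an infinite type of arrows.  A copower of a zero object is a zero object.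
\<close>

lemma copower_exists:
  fixes cp :: "('o, 'm, 'k) copow" and V :: "('x \<Rightarrow> 'k) set"
  assumes cp: "has_copowers C cp" and X: "X \<in> obj C" and V: "fd_space V"
  shows "\<exists>P e. is_copower C V X P e"
proof (cases "ide C X = zer C X X")
  case True
  have z: "zer C X X \<in> hom C X X" by (rule zer_hom[OF X X])
  have "is_copower C V X X (\<lambda>v. zer C X X)"
    unfolding is_copower_def
  proof (intro conjI ballI allI impI)
    show "X \<in> obj C" by (rule X)
    show "linear_into_hom C V X X (\<lambda>v. zer C X X)"
      by (simp add: linear_into_hom_def z add_zer[OF z] scl_zer[OF X X])
    fix Y g assume Y: "Y \<in> obj C" and g: "linear_into_hom C V X Y g"
    have gz: "g v = zer C X Y" if "v \<in> V" for v
      using g that by (intro zero_object_hom[OF True]) (simp add: linear_into_hom_def)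
    show "\<exists>!h. h \<in> hom C X Y \<and> (\<forall>v\<in>V. h \<cdot> zer C X X = g v)"
    proof (intro ex1I[of _ "zer C X Y"] conjI ballI)
      show "zer C X Y \<in> hom C X Y" by (rule zer_hom[OF X Y])
      show "zer C X Y \<cdot> zer C X X = g v" if "v \<in> V" for v
        unfolding gz[OF that] by (rule cmp_zer_left[OF z Y])
      show "h = zer C X Y" if "h \<in> hom C X Y \<and> (\<forall>v\<in>V. h \<cdot> zer C X X = g v)" for h
        using that zero_object_hom[OF True] by blast
    qed
  qed
  then show ?thesis by blast
next
  case False
  have inf: "infinite (UNIV :: 'm set)" by (rule infinite_arrows[OF cp X False])
  obtain B where "finite B" "V = fun_vs.span B" using V by (auto simp: fd_space_def)
  then obtain S where S: "finite S" "\<And>v. v \<in> V \<Longrightarrow> (\<forall>x\<in>S. v x = 0) \<Longrightarrow> v = 0"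
    using span_separated by metis
  obtain S' :: "'m set" where S': "finite S'" "card S' = card S"
    using infinite_arbitrarily_large[OF inf] by blast
  then obtain \<beta> where \<beta>: "bij_betw \<beta> S' S" using finite_same_card_bij[OF S'(1) S(1)] by blast
  \<comment> \<open>restrict to the separating points and rename them into the type of arrows\<close>
  define T where "T v = (\<lambda>y. if y \<in> S' then v (\<beta> y) else 0)" for v :: "'x \<Rightarrow> 'k"
  have sub: "fun_vs.subspace V" by (rule fd_space_subspace[OF V])
  have Tadd: "T (v + w) = T v + T w" and Tscl: "T (fscale c v) = fscale c (T v)" for v w c
    by (auto simp: T_def fun_eq_iff fscale_def)
  have lin: "linear_on V (T ` V) T" by (simp add: linear_on_def Tadd Tscl)
  have inj: "inj_on T V"
  proof (rule inj_onI)
    fix v w assume v: "v \<in> V" "w \<in> V" and eq: "T v = T w"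
    have "v - w = 0"
    proof (rule S(2)[OF fun_vs.subspace_diff[OF sub v]], rule ballI)
      fix x assume "x \<in> S"
      then obtain y where y: "y \<in> S'" "x = \<beta> y" using \<beta> by (auto simp: bij_betw_def)
      then show "(v - w) x = 0" using fun_cong[OF eq, of y] by (simp add: T_def)
    qed
    then show "v = w" by simp
  qed
  have T0: "T 0 = 0" by (auto simp: T_def fun_eq_iff)
  have "fun_vs.subspace (T ` V)" unfolding fun_vs.subspace_def
  proof (intro conjI ballI allI)
    show "0 \<in> T ` V" using T0 fun_vs.subspace_0[OF sub] by (metis imageI)
    fix v w c assume "v \<in> T ` V"
    then obtain v' where v': "v' \<in> V" "v = T v'" by blast
    show "fscale c v \<in> T ` V" unfolding v'(2) Tscl[symmetric]
      by (intro imageI fun_vs.subspace_scale[OF sub v'(1)])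
    assume "w \<in> T ` V"
    then obtain w' where w': "w' \<in> V" "w = T w'" by blast
    show "v + w \<in> T ` V" unfolding v'(2) w'(2) Tadd[symmetric]
      by (intro imageI fun_vs.subspace_add[OF sub v'(1) w'(1)])
  qed
  then have "fd_space (T ` V)"
    by (rule separated_imp_fd_space[OF S'(1)]) (auto simp: T_def fun_eq_iff)
  then have "is_copower C (T ` V) X (cpobj cp (T ` V) X) (cpunit cp (T ` V) X)"
    using cp X by (simp add: has_copowers_def)
  from copower_transport[OF this lin refl inj sub] show ?thesis by blast
qed

end

context module_category_with_algebra
begin

text \<open>
  The functor \<open>A \<triangleright> -\<close> preserves copowers, so the copower of the underlying object inherits an action for
  which the universal arrows are linear.
\<close>

lemma module_copower:
  assumes p: "(M, a) \<in> obj Mod" and cop: "is_copower \<M> V M P e"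
  shows "\<exists>b. is_copower Mod V (M, a) (P, b) (\<lambda>v. ((M, a), e v, (P, b)))"
proof -
  note M = ModD(1)[OF p] and P = M.is_copower_obj[OF cop] and elin = M.is_copower_lin[OF cop]
  have e: "e v \<in> hom \<M> M P" if "v \<in> V" for v using elin that by (auto simp: linear_into_hom_def)
  have ah: "a \<in> hom \<M> (\<A> \<odot> M) M" using ModD[OF p] by (simp add: hom_def)
  have AA: "\<A> \<otimes>\<^sub>o\<^bsub>C\<^esub> \<A> \<in> obj C" by (simp add: objects)
  note copA = whisker_copower[OF algebra_typing(1) cop M] and copAA = whisker_copower[OF AA cop M]
  note ind = M.copower_induced[OF copA P M.linear_into_hom_pre[OF elin ah]]
  define b where "b = copower_induced \<M> V (\<A> \<odot> P) (\<lambda>v. \<A> \<rhd> e v) P (\<lambda>v. e v \<bullet> a)"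
  have bh: "b \<in> hom \<M> (\<A> \<odot> P) P" and be: "\<And>v. v \<in> V \<Longrightarrow> b \<bullet> (\<A> \<rhd> e v) = e v \<bullet> a"
    using ind unfolding b_def by blast+
  note [simp] = alg_calc ModD(1-4)[OF p] P M.homD[OF bh]
  have b: "(P, b) \<in> obj Mod"
  proof (rule ModI)
    show "b \<bullet> (\<A> \<rhd> b) = b \<bullet> (mul \<star> P)"
    proof (rule M.copower_ext[OF copAA])
      show "b \<bullet> (\<A> \<rhd> b) \<in> hom \<M> ((\<A> \<otimes>\<^sub>o\<^bsub>C\<^esub> \<A>) \<odot> P) P" "b \<bullet> (mul \<star> P) \<in> hom \<M> ((\<A> \<otimes>\<^sub>o\<^bsub>C\<^esub> \<A>) \<odot> P) P"
        by (simp_all add: hom_def)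
      fix v assume v: "v \<in> V"
      note [simp] = M.homD[OF e[OF v]]
      note n = naturality[of mul "e v", simplified]
      show "(b \<bullet> (\<A> \<rhd> b)) \<bullet> ((\<A> \<otimes>\<^sub>o\<^bsub>C\<^esub> \<A>) \<rhd> e v) = (b \<bullet> (mul \<star> P)) \<bullet> ((\<A> \<otimes>\<^sub>o\<^bsub>C\<^esub> \<A>) \<rhd> e v)"
        by (simp add: n whisk[OF be[OF v]] be[OF v] precomp[OF be[OF v]] ModD(5)[OF p])
    qed
    show "b \<bullet> (un \<star> P) = ide \<M> P"
    proof (rule M.copower_ext[OF cop])
      show "b \<bullet> (un \<star> P) \<in> hom \<M> P P" "ide \<M> P \<in> hom \<M> P P" by (simp_all add: hom_def)
      fix v assume v: "v \<in> V"
      note [simp] = M.homD[OF e[OF v]]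
      note n = naturality[of un "e v", simplified]
      show "(b \<bullet> (un \<star> P)) \<bullet> e v = ide \<M> P \<bullet> e v"
        by (simp add: n precomp[OF be[OF v]] ModD(6)[OF p])
    qed
  qed simp_all
  have eM: "((M, a), e v, (P, b)) \<in> hom Mod (M, a) (P, b)" if v: "v \<in> V" for v
    by (rule Mod_homI[OF p b]) (simp_all add: e[OF v] be[OF v])
  have "is_copower Mod V (M, a) (P, b) (\<lambda>v. ((M, a), e v, (P, b)))"
    unfolding is_copower_def
  proof (intro conjI ballI allI impI)
    show "(P, b) \<in> obj Mod" by (rule b)
    show "linear_into_hom Mod V (M, a) (P, b) (\<lambda>v. ((M, a), e v, (P, b)))"
      using elin eM by (simp add: linear_into_hom_def alg_module_cat_simps)
    fix z g assume z: "z \<in> obj Mod" and g: "linear_into_hom Mod V (M, a) z g"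
    have gh: "g v \<in> hom Mod (M, a) z" if "v \<in> V" for v using g that by (simp add: linear_into_hom_def)
    note zz = Mod_objD[OF z]
    note [simp] = zz(1) M.homD[OF zz(2)]
    note k = M.copower_induced[OF cop zz(1) underlying_linear[OF g, unfolded fst_conv]]
    define h where "h = copower_induced \<M> V P e (fst z) (\<lambda>v. fst (snd (g v)))"
    have hh: "h \<in> hom \<M> P (fst z)" and he: "\<And>v. v \<in> V \<Longrightarrow> h \<bullet> e v = fst (snd (g v))"
      using k unfolding h_def by blast+
    note [simp] = M.homD[OF hh]
    have "h \<bullet> b = snd z \<bullet> (\<A> \<rhd> h)"
    proof (rule M.copower_ext[OF copA])
      show "h \<bullet> b \<in> hom \<M> (\<A> \<odot> P) (fst z)" "snd z \<bullet> (\<A> \<rhd> h) \<in> hom \<M> (\<A> \<odot> P) (fst z)"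
        by (simp_all add: hom_def)
      fix v assume v: "v \<in> V"
      note [simp] = M.homD[OF e[OF v]]
      note gl = Mod_und(2)[OF gh[OF v], unfolded snd_conv]
      show "(h \<bullet> b) \<bullet> (\<A> \<rhd> e v) = (snd z \<bullet> (\<A> \<rhd> h)) \<bullet> (\<A> \<rhd> e v)"
        by (simp add: be[OF v] precomp[OF he[OF v]] whisk[OF he[OF v]] gl)
    qed
    then have hM: "((P, b), h, z) \<in> hom Mod (P, b) z" by (intro Mod_homI b z) (simp_all add: hh)
    show "\<exists>!t. t \<in> hom Mod (P, b) z \<and> (\<forall>v\<in>V. t \<cdot>\<^bsub>Mod\<^esub> ((M, a), e v, (P, b)) = g v)"
    proof (intro ex1I[of _ "((P, b), h, z)"] conjI ballI)
      show "((P, b), h, z) \<in> hom Mod (P, b) z" by (rule hM)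
      show "((P, b), h, z) \<cdot>\<^bsub>Mod\<^esub> ((M, a), e v, (P, b)) = g v" if v: "v \<in> V" for v
        by (rule Mod_hom_eqI[OF Mod_cmp_hom[OF eM[OF v] hM] gh[OF v]])
          (simp add: alg_module_cat_simps he[OF v])
      fix t assume t: "t \<in> hom Mod (P, b) z \<and> (\<forall>v\<in>V. t \<cdot>\<^bsub>Mod\<^esub> ((M, a), e v, (P, b)) = g v)"
      then have th: "t \<in> hom Mod (P, b) z" by blast
      have "fst (snd t) = h"
      proof (rule M.copower_ext[OF cop Mod_und(1)[OF th, unfolded fst_conv] hh])
        fix v assume v: "v \<in> V"
        have "fst (snd (t \<cdot>\<^bsub>Mod\<^esub> ((M, a), e v, (P, b)))) = fst (snd (g v))" using t v by simp
        then show "fst (snd t) \<bullet> e v = h \<bullet> e v" by (simp add: alg_module_cat_simps he[OF v])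
      qed
      then show "t = ((P, b), h, z)" using Mod_und(3)[OF th] by simp
    qed
  qed
  then show ?thesis by blast
qed

lemma Mod_has_copowers:
  assumes cp: "has_copowers \<M> cp"
  shows "\<exists>cp'. has_copowers Mod cp'"
proof -
  have "\<exists>q. is_copower Mod V p (fst q) (snd q)"
    if V: "fd_space V" and p: "p \<in> obj Mod" for V :: "(('o \<times> 'm) \<times> 'm \<times> ('o \<times> 'm) \<Rightarrow> 'k) set" and p
  proof -
    obtain P e where "is_copower \<M> V (fst p) P e"
      using M.copower_exists[OF cp Mod_objD(1)[OF p] V] by blast
    then obtain b where "is_copower Mod V p (P, b) (\<lambda>v. (p, e v, (P, b)))"
      using module_copower[of "fst p" "snd p"] p by fastforce
    then show ?thesis by (intro exI[of _ "((P, b), \<lambda>v. (p, e v, (P, b)))"]) simp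
  qed
  then have "is_copower Mod V p (fst (SOME q. is_copower Mod V p (fst q) (snd q)))
      (snd (SOME q. is_copower Mod V p (fst q) (snd q)))"
    if "fd_space V" "p \<in> obj Mod" for V :: "(('o \<times> 'm) \<times> 'm \<times> ('o \<times> 'm) \<Rightarrow> 'k) set" and p
    using that by (intro someI_ex[of "\<lambda>q. is_copower Mod V p (fst q) (snd q)"])
  then have "has_copowers Mod \<lparr>cpobj = (\<lambda>V p. fst (SOME q. is_copower Mod V p (fst q) (snd q))),
      cpunit = (\<lambda>V p. snd (SOME q. is_copower Mod V p (fst q) (snd q)))\<rparr>"
    by (simp add: has_copowers_def)
  then show ?thesis by blast
qed

end

section \<open>The Nakayama functor of the module category\<close>

theorem theorem5p7:
  fixes C :: "('c, 'd, 'k::field) moncat"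
    and \<M> :: "('c, 'd, 'o, 'm, 'k) modcat"
    and I :: 'c and A :: "('c, 'd) algebra_in" and l :: 'd
    and cp :: "('o, 'm, 'k) copow"
    and N :: "('o, 'm, 'o, 'm) func"
    and i :: "'o \<Rightarrow> 'o \<Rightarrow> 'm"
  assumes "finite_multitensor_category C"
    and "invertible_object C I"
    and "is_algebra C A"
    and "frobenius_trace C I A l"
    and "finite_module_category C \<M>"
    and "nakayama_coend \<M> cp N i"
  shows "is_functor (alg_module_cat C \<M> A) (alg_module_cat C \<M> (lldual_algebra C A))
           (twist_func C \<M> I A l) \<and>
         is_functor (alg_module_cat C \<M> (lldual_algebra C A)) (alg_module_cat C \<M> A)
           (nak_lift_func C \<M> cp N i A) \<and>
         (\<exists>N'. is_nakayama_functor (alg_module_cat C \<M> A) N') \<and>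
         (\<forall>N'. is_nakayama_functor (alg_module_cat C \<M> A) N' \<longrightarrow>
           nat_isomorphic (alg_module_cat C \<M> A) (alg_module_cat C \<M> A)
             N' (comp_func (nak_lift_func C \<M> cp N i A) (twist_func C \<M> I A l)))"
proof -
  interpret finite_module_category C \<M> by (rule assms(5))
  interpret nakayama_frobenius C \<M> A I l cp N i
    by unfold_locales (use assms in \<open>auto simp: invertible_object_def\<close>)
  interpret Mod: linear_category Mod by (rule Mod_linear_category)
  have "has_copowers \<M> cp" using assms(6) by (simp add: nakayama_coend_def)
  then obtain cp' where cp': "has_copowers Mod cp'" using Mod_has_copowers by blast
  have "is_nakayama_functor Mod N_Mod"
    unfolding is_nakayama_functor_def
    using Mod.dual_coend_imp_nakayama_coend[OF Mod_hom_finite cp' mod_dual_coend] by blast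
  moreover have "nat_isomorphic Mod Mod N' N_Mod" if "is_nakayama_functor Mod N'" for N'
    using that Mod.dual_coend_unique[OF Mod.nakayama_coend_imp_dual_coend[OF Mod_hom_finite] mod_dual_coend]
    unfolding is_nakayama_functor_def by blast
  ultimately show ?thesis using twist_functor nak_lift_functor by blast
qed

end
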